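(* Let $p\in(0,1)$, $\delta_{\text{in}},\delta_{\text{out}}>0$, $\lambda>0$, and let $(\mathbf I(n),\mathbf O(n))_{n\ge0}$ be the in- and out-degree sequences, with node sets $\mathbf V(n)$, of the directed preferential attachment model with Poisson measurement. Then for integers $m\ge0$, $l\ge1$, as $n\to\infty$, $$\frac1{|\mathbf V(n)|}\sum_{v\in\mathbf V(n)}\mathbf 1_{\{I_v(n)=m\}}\stackrel{P}{\longrightarrow}\int_0^1\mathbf P\left(Z_{\delta_{\text{in}}}\left(t^{1/(1+\delta_{\text{in}}p)}\right)=m\right)\mathrm dt=:p^{\text{in}}_m,$$ $$\frac1{|\mathbf V(n)|}\sum_{v\in\mathbf V(n)}\mathbf 1_{\{O_v(n)=l\}}\stackrel{P}{\longrightarrow}\int_0^1\mathbf P\left(1+\widetilde Z_{1+\delta_{\text{out}}}\left(t^{(1-p)/(1+\delta_{\text{out}}p)}\right)=l\right)\mathrm dt=:p^{\text{out}}_l,$$ where $$p^{\text{in}}_m\sim(1+\delta_{\text{in}}p)\frac{\Gamma(1+\delta_{\text{in}}(1+p))}{\Gamma(\delta_{\text{in}})}\,m^{-(1+\iota_{\text{in}})},\qquad m\to\infty,$$ $$p^{\text{out}}_l\sim\left(\frac{1+\delta_{\text{out}}p}{1-p}\right)\frac{\Gamma\left(1+\frac{1+\delta_{\text{out}}}{1-p}\right)}{\Gamma(1+\delta_{\text{out}})}\,l^{-(1+\iota_{\text{out}})},\qquad l\to\infty,$$ with $$\iota_{\text{in}}=1+\delta_{\text{in}}p,\qquad\iot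a_{\text{out}}=\frac{1+\delta_{\text{out}}p}{1-p}.$$
   Context: Notation. $\mathbb N=\{0,1,2,\dots\}$. For $v\ge1$, $\mathbf e_v$ (resp. $\widetilde{\mathbf e}_v$) is the element of $(\mathbb N^2)^\infty$ whose $v$-th entry is $(1,0)$ (resp. $(0,1)$) and whose other entries are $(0,0)$. $\{B_k\}_{k\ge1}$ are iid Bernoulli with $\mathbf P(B_k=1)=p=1-\mathbf P(B_k=0)$. $\{\tau_{k,v},\widetilde\tau_{k,v}:k,v\ge1\}$ are iid unit-rate exponential random variables. $\{\Delta M_k\}_{k\ge1}$ are iid with $\mathbf P(\Delta M_k=j)=e^{-\lambda}\lambda^{j-1}/(j-1)!$, $j\ge1$. These three families are independent. PA model with Poisson measurement. Put $M_0=0$, $M_n=\sum_{k=1}^n\Delta M_k$, and $\mathbf V(n)=\{1,\dots,1+\sum_{k=1}^{M_n}B_k\}$ (so $\mathbf V(0)=\{1\}$). The process $(\mathbf I(n),\mathbf O(n))=(I_v(n),O_v(n))_{v\ge1}\in(\mathbb N^2)^\infty$ starts at $((1,1),(0,0),(0,0),\dots)$. For $n\ge0$ and $M_n+1\le k\le M_{n+1}$ put $$\mathcal J_k=\operatorname*{argmin}_{v\in\mathbf V(n)}\frac{\tau_{k,v}}{I_v(n)+\delta_{\text{in}}},\qquad \widetilde{\mathcal J}_k=\operatorname*{argmin}_{v\in\mathbf V(n)}\frac{\widetilde\tau_{k,v}}{O_v(n)+\delta_{\text{out}}},$$ $$(\mathbf I(n+1),\mathbf O(n+1))=(\mathbf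 I(n),\mathbf O(n))+\sum_{k=M_n+1}^{M_{n+1}}\left[\mathbf e_{\mathcal J_k}+(1-B_k)\widetilde{\mathbf e}_{\widetilde{\mathcal J}_k}+B_k\widetilde{\mathbf e}_{1+\sum_{j=1}^kB_j}\right].$$ Thus $\Delta M_{n+1}$ edges are added in step $n+1$ with attachment probabilities frozen at the configuration at step $n$. $Z_\delta(q)$ (and likewise $\widetilde Z_\delta(q)$), $\delta>0$, $q\in(0,1)$, is a negative binomial random variable with generating function $\mathbf E(s^{Z_\delta(q)})=(s+(1-s)/q)^{-\delta}$, $s\in[0,1]$. $\Gamma(\cdot)$ is the Gamma function, $\sim$ means the ratio tends to 1, and $\stackrel{P}{\longrightarrow}$ is convergence in probability. *)

theory Defs
  imports
    "HOL-Probability.Probability"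
    "HOL-Complex_Analysis.Cauchy_Integral_Formula"
    "HOL-Library.Landau_Symbols"
begin


section \<open>The negative binomial distribution with real parameter\<close>

definition is_neg_binomial :: "real \<Rightarrow> real \<Rightarrow> nat pmf \<Rightarrow> bool" where
  "is_neg_binomial \<delta> q P \<longleftrightarrow>
     (\<forall>s\<in>{0..1}. measure_pmf.expectation P (\<lambda>z. s ^ z) = (s + (1 - s) / q) powr (- \<delta>))"

text \<open>The law of $Z_\delta(q)$. It is only meaningful for \<open>\<delta> > 0\<close> and \<open>0 < q < 1\<close>, where the lemma
  \<open>ex1_is_neg_binomial\<close> below guarantees that the description determines exactly one law.\<close>

definition neg_binomial_law :: "real \<Rightarrow> real \<Rightarrow> nat pmf" where
  "neg_binomial_law \<delta> q = (THE P. is_neg_binomial \<delta> q P)"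

lemma expectation_power_sums:
  fixes P :: "nat pmf" and x :: real
  assumes "\<bar>x\<bar> \<le> 1"
  shows "(\<lambda>n. pmf P n * x ^ n) sums measure_pmf.expectation P (\<lambda>z. x ^ z)"
proof -
  have int: "integrable (measure_pmf P) (\<lambda>z. x ^ z)"
    by (rule measure_pmf.integrable_const_bound[where B = 1])
       (use assms in \<open>auto simp: power_abs intro!: power_le_one\<close>)
  have "integrable (density (count_space UNIV) (\<lambda>z. ennreal (pmf P z))) (\<lambda>z. x ^ z)"
    using int by (simp add: measure_pmf_eq_density)
  hence "integrable (count_space UNIV) (\<lambda>z. pmf P z *\<^sub>R x ^ z)"
    by (subst (asm) integrable_density) auto
  from sums_integral_count_space_nat[OF this]
  have "(\<lambda>n. pmf P n * x ^ n) sums (\<integral>z. pmf P z *\<^sub>R x ^ z \<partial>count_space UNIV)"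
    by simp
  also have "(\<integral>z. pmf P z *\<^sub>R x ^ z \<partial>count_space UNIV) = measure_pmf.expectation P (\<lambda>z. x ^ z)"
    by (simp add: measure_pmf_eq_density integral_density)
  finally show ?thesis .
qed

lemma pmf_eq_of_expectation_power:
  fixes P Q :: "nat pmf"
  assumes eq: "\<And>s::real. 0 \<le> s \<Longrightarrow> s < 1 \<Longrightarrow>
    measure_pmf.expectation P (\<lambda>z. s ^ z) = measure_pmf.expectation Q (\<lambda>z. s ^ z)"
  shows "P = Q"
proof (rule pmf_eqI)
  fix m
  define a where "a n = pmf P n - pmf Q n" for n
  define f :: "real \<Rightarrow> real" where
    "f x = measure_pmf.expectation P (\<lambda>z. x ^ z) - measure_pmf.expectation Q (\<lambda>z. x ^ z)" for x
  have sm: "(\<lambda>n. a n * (x - 0) ^ n) sums f x" if "norm (x - 0) < 1" for x :: real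
    using sums_diff[OF expectation_power_sums[of x P] expectation_power_sums[of x Q]] that
    by (simp add: a_def f_def algebra_simps)
  have f0: "f s = 0" if "0 \<le> s" "s < 1" for s
    using eq[OF that] by (simp add: f_def)
  have a0: "a 0 = 0"
    using sm[of 0] f0[of 0] by (simp add: powser_sums_zero_iff)
  show "pmf P m = pmf Q m"
  proof (rule ccontr)
    assume "pmf P m \<noteq> pmf Q m"
    hence am: "a m \<noteq> 0" by (simp add: a_def)
    hence "m > 0" using a0 by (cases m) auto
    from powser_0_nonzero[OF zero_less_one sm f0[of 0] am this]
    obtain s where s: "0 < s" "\<And>z. z \<in> cball 0 s - {0} \<Longrightarrow> f z \<noteq> 0" by auto
    have "f (min s (1/2)) \<noteq> 0" using s(1) by (intro s(2)) auto
    moreover have "f (min s (1/2)) = 0" using s(1) by (intro f0) auto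
    ultimately show False by simp
  qed
qed

lemma ex1_is_neg_binomial:
  assumes "\<delta> > 0" "0 < q" "q < 1"
  shows "\<exists>!P. is_neg_binomial \<delta> q P"
proof (rule ex_ex1I)
  define c where "c k = q powr \<delta> * (pochhammer \<delta> k / fact k * (1 - q) ^ k)" for k
  have c_nonneg: "c k \<ge> 0" for k
    using assms pochhammer_pos[of \<delta> k] by (auto simp: c_def intro!: mult_nonneg_nonneg)
  have c_sums: "(\<lambda>k. c k * s ^ k) sums ((s + (1 - s) / q) powr (- \<delta>))"
    if s: "0 \<le> s" "s \<le> 1" for s
  proof -
    have "(1 - q) * s \<le> 1 - q" using assms s by (simp add: mult_left_le)
    also have "\<dots> < 1" using assms by simp
    finally have lt: "(1 - q) * s < 1" .
    have "(\<lambda>n. (- \<delta> gchoose n) * (- ((1 - q) * s)) ^ n) sums (1 + - ((1 - q) * s)) powr (- \<delta>)"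
      by (rule gen_binomial_real) (use assms s lt in auto)
    moreover have "(- \<delta> gchoose n) * (- ((1 - q) * s)) ^ n
                     = pochhammer \<delta> n / fact n * (1 - q) ^ n * s ^ n" for n
    proof -
      have "(- ((1 - q) * s)) ^ n = (- 1) ^ n * ((1 - q) ^ n * s ^ n)"
        by (metis mult_minus1 power_mult_distrib)
      moreover have "(- 1 :: real) ^ n * (- 1) ^ n = 1"
        by (simp flip: power_mult_distrib)
      ultimately show ?thesis by (simp add: gbinomial_pochhammer)
    qed
    ultimately have "(\<lambda>n. pochhammer \<delta> n / fact n * (1 - q) ^ n * s ^ n) sums
                       (1 - (1 - q) * s) powr (- \<delta>)" by simp
    from sums_mult[OF this, of "q powr \<delta>"]
    have "(\<lambda>k. c k * s ^ k) sums (q powr \<delta> * (1 - (1 - q) * s) powr (- \<delta>))"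
      by (simp add: c_def mult_ac)
    also have "s + (1 - s) / q = (1 - (1 - q) * s) / q"
      using assms by (simp add: field_simps)
    hence "q powr \<delta> * (1 - (1 - q) * s) powr (- \<delta>) = (s + (1 - s) / q) powr (- \<delta>)"
      using assms lt by (simp add: powr_divide powr_minus field_simps)
    finally show ?thesis .
  qed
  have c1: "c sums 1" using c_sums[of 1] by simp
  have "(\<integral>\<^sup>+k. ennreal (c k) \<partial>count_space UNIV) = (\<Sum>k. ennreal (c k))"
    by (rule nn_integral_count_space_nat)
  also have "\<dots> = 1"
    using suminf_ennreal2[OF c_nonneg sums_summable[OF c1]] sums_unique[OF c1] by simp
  finally have tot: "(\<integral>\<^sup>+k. ennreal (c k) \<partial>count_space UNIV) = 1" .
  define P where "P = embed_pmf c"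
  have pmf: "pmf P k = c k" for k
    unfolding P_def by (rule pmf_embed_pmf[OF c_nonneg tot])
  have "measure_pmf.expectation P (\<lambda>z. s ^ z) = (s + (1 - s) / q) powr (- \<delta>)"
    if s: "0 \<le> s" "s \<le> 1" for s
    by (rule sums_unique2[OF _ c_sums[OF s]])
       (use expectation_power_sums[of s P] s in \<open>simp add: pmf\<close>)
  hence "is_neg_binomial \<delta> q P" by (simp add: is_neg_binomial_def)
  thus "\<exists>P. is_neg_binomial \<delta> q P" ..
next
  fix P Q assume "is_neg_binomial \<delta> q P" "is_neg_binomial \<delta> q Q"
  thus "P = Q"
    by (intro pmf_eq_of_expectation_power) (auto simp: is_neg_binomial_def)
qed

lemma is_neg_binomial_law:
  "\<delta> > 0 \<Longrightarrow> 0 < q \<Longrightarrow> q < 1 \<Longrightarrow> is_neg_binomial \<delta> q (neg_binomial_law \<delta> q)"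
  unfolding neg_binomial_law_def by (rule theI', rule ex1_is_neg_binomial)


section \<open>The random input\<close>

datatype source = Coin nat | In_Clock nat nat | Out_Clock nat nat | Batch nat

text \<open>All indices start at 1; the values of the input at index 0 are irrelevant. The three families
  being iid and independent of each other amounts to mutual independence of all the variables
  together, which is stated with \<open>source\<close> as index type and with the integer-valued variables
  regarded as real ones.\<close>

locale pa_poisson_input = prob_space M for M :: "'a measure" +
  fixes p lam :: real
    and B :: "nat \<Rightarrow> 'a \<Rightarrow> nat"
    and \<tau> \<tau>' :: "nat \<Rightarrow> nat \<Rightarrow> 'a \<Rightarrow> real"
    and dM :: "nat \<Rightarrow> 'a \<Rightarrow> nat"
  assumes indep: "indep_vars (\<lambda>_. borel)
      (\<lambda>i \<omega>. case i of
          Coin k \<Rightarrow> real (B k \<omega>)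
        | In_Clock k v \<Rightarrow> \<tau> k v \<omega>
        | Out_Clock k v \<Rightarrow> \<tau>' k v \<omega>
        | Batch k \<Rightarrow> real (dM k \<omega>))
      ({Coin k | k. k \<ge> 1} \<union> {In_Clock k v | k v. k \<ge> 1 \<and> v \<ge> 1}
        \<union> {Out_Clock k v | k v. k \<ge> 1 \<and> v \<ge> 1} \<union> {Batch k | k. k \<ge> 1})"
    and coin_1: "k \<ge> 1 \<Longrightarrow> prob {\<omega> \<in> space M. B k \<omega> = 1} = p"
    and coin_0: "k \<ge> 1 \<Longrightarrow> prob {\<omega> \<in> space M. B k \<omega> = 0} = 1 - p"
    and in_clock: "k \<ge> 1 \<Longrightarrow> v \<ge> 1 \<Longrightarrow> distributed M lborel (\<tau> k v) (exponential_density 1)"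
    and out_clock: "k \<ge> 1 \<Longrightarrow> v \<ge> 1 \<Longrightarrow> distributed M lborel (\<tau>' k v) (exponential_density 1)"
    and batch: "k \<ge> 1 \<Longrightarrow> j \<ge> 1 \<Longrightarrow>
      prob {\<omega> \<in> space M. dM k \<omega> = j} = exp (- lam) * lam ^ (j - 1) / fact (j - 1)"


section \<open>Preferential attachment with batches\<close>

text \<open>The model is a deterministic function of a realisation of the input: \<open>b k\<close>, \<open>t k v\<close>,
  \<open>t' k v\<close> and \<open>d k\<close> stand for realisations of $B_k$, $\tau_{k,v}$, $\widetilde\tau_{k,v}$ and
  $\Delta M_k$. Nodes are the positive integers. The recursions for the in- and the out-degrees
  are the two components, at node \<open>v\<close>, of the recursion in $(\mathbb N^2)^\infty$, with
  $\mathbf e_u$ read off as \<open>of_bool (u = v)\<close>. The truncated difference \<open>1 - b k\<close>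
  is the true one whenever \<open>b k\<close> is 0 or 1, that is, almost surely.\<close>

definition edges_upto :: "(nat \<Rightarrow> nat) \<Rightarrow> nat \<Rightarrow> nat" where
  "edges_upto d n = (\<Sum>k=1..n. d k)"

definition nodes :: "(nat \<Rightarrow> nat) \<Rightarrow> (nat \<Rightarrow> nat) \<Rightarrow> nat \<Rightarrow> nat set" where
  "nodes b d n = {1..1 + (\<Sum>k=1..edges_upto d n. b k)}"

text \<open>If the minimiser is not unique, which happens with probability 0, \<open>arg_min_on\<close> picks one.\<close>

definition attach :: "(nat \<Rightarrow> real) \<Rightarrow> real \<Rightarrow> (nat \<Rightarrow> nat) \<Rightarrow> nat set \<Rightarrow> nat" where
  "attach t \<delta> deg V = arg_min_on (\<lambda>v. t v / (real (deg v) + \<delta>)) V"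

primrec indeg ::
    "real \<Rightarrow> (nat \<Rightarrow> nat) \<Rightarrow> (nat \<Rightarrow> nat \<Rightarrow> real) \<Rightarrow> (nat \<Rightarrow> nat) \<Rightarrow> nat \<Rightarrow> nat \<Rightarrow> nat" where
  "indeg \<delta> b t d 0 = (\<lambda>v. of_bool (v = 1))"
| "indeg \<delta> b t d (Suc n) = (\<lambda>v. indeg \<delta> b t d n v +
     (\<Sum>k = edges_upto d n + 1..edges_upto d (Suc n).
        of_bool (attach (t k) \<delta> (indeg \<delta> b t d n) (nodes b d n) = v)))"

primrec outdeg ::
    "real \<Rightarrow> (nat \<Rightarrow> nat) \<Rightarrow> (nat \<Rightarrow> nat \<Rightarrow> real) \<Rightarrow> (nat \<Rightarrow> nat) \<Rightarrow> nat \<Rightarrow> nat \<Rightarrow> nat" where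
  "outdeg \<delta> b t' d 0 = (\<lambda>v. of_bool (v = 1))"
| "outdeg \<delta> b t' d (Suc n) = (\<lambda>v. outdeg \<delta> b t' d n v +
     (\<Sum>k = edges_upto d n + 1..edges_upto d (Suc n).
        (1 - b k) * of_bool (attach (t' k) \<delta> (outdeg \<delta> b t' d n) (nodes b d n) = v)
        + b k * of_bool (1 + (\<Sum>j=1..k. b j) = v)))"

definition node_fraction :: "nat set \<Rightarrow> (nat \<Rightarrow> nat) \<Rightarrow> nat \<Rightarrow> real" where
  "node_fraction V deg m = 1 / real (card V) * (\<Sum>v\<in>V. of_bool (deg v = m))"


section \<open>Limits\<close>

definition tendsto_in_prob :: "'a measure \<Rightarrow> (nat \<Rightarrow> 'a \<Rightarrow> real) \<Rightarrow> real \<Rightarrow> bool" where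
  "tendsto_in_prob M X c \<longleftrightarrow>
     (\<forall>n. X n \<in> borel_measurable M) \<and>
     (\<forall>\<epsilon>>0. (\<lambda>n. measure M {\<omega> \<in> space M. \<bar>X n \<omega> - c\<bar> > \<epsilon>}) \<longlonglongrightarrow> 0)"

definition p_in :: "real \<Rightarrow> real \<Rightarrow> nat \<Rightarrow> real" where
  "p_in p \<delta> m = (LBINT t=0..1.
     measure_pmf.prob (neg_binomial_law \<delta> (t powr (1 / (1 + \<delta> * p)))) {z. z = m})"

definition p_out :: "real \<Rightarrow> real \<Rightarrow> nat \<Rightarrow> real" where
  "p_out p \<delta> l = (LBINT t=0..1.
     measure_pmf.prob (neg_binomial_law (1 + \<delta>) (t powr ((1 - p) / (1 + \<delta> * p)))) {z. 1 + z = l})"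

definition iota_in :: "real \<Rightarrow> real \<Rightarrow> real" where
  "iota_in p \<delta> = 1 + \<delta> * p"

definition iota_out :: "real \<Rightarrow> real \<Rightarrow> real" where
  "iota_out p \<delta> = (1 + \<delta> * p) / (1 - p)"

end

(* For both degrees, the number N_m(n) of nodes of degree m is the same kind of process; only the
   degree s of a newborn node (0 or 1) and the probability q = 1 - s p that an edge raises the
   degree of an old node differ. Conditionally on the history, each edge of batch n + 1 hits a node
   of degree j with probability q (j + delta) N_j(n) / W_n, where W_n = 1 + M_n + delta |V(n)|.
   Up to collisions inside the batch at nodes of degree at most m, whose probability is of order
   1 / n, the change of N_m is therefore a sum with mean
     (1 + lam) q ((m - 1 + delta) N_(m-1) - (m + delta) N_m) / W_n + (1 + lam) p [m = s].
   Let c_m be the fixed point of this linear recursion and Y_m(n) = N_m(n) - c_m (n + 1). The drift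
   of Y_m is -const Y_m / n plus errors controlled by Y_(m-1) and by W_n - w (n + 1), so induction
   on m gives E Y_m(n)^2 = O(n), and Chebyshev's inequality yields the convergence. Integration by
   parts shows that the integrals p_in and p_out satisfy the recursion for c_m, which also gives
   them as quotients of rising factorials, whence the power laws. *)

theory Submission
  imports Defs "HOL-Real_Asymp.Real_Asymp"
begin

section \<open>The limit laws\<close>

text \<open>The edges are numbered consecutively and carry their own coins and clocks, but batch
  \<open>n + 1\<close> starts at a random number. Conditioning therefore has to fix that number:
  once the value of the history, and with it \<open>edges n \<omega> = K\<close>, is given, the
  history event depends only on the first \<open>n\<close> batch sizes and on the coins and clocks
  up to \<open>K\<close>. This is a deterministic block of inputs, disjoint from those of the next
  batch. The errors have to be bounded after multiplication by the deviation Y_m, which may itself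
  be of order n. The total weight is the common scale: delta N_m <= W_n and n + 1 <= W_n give |Y_m|
  = O(W_n), while two edges meet at one of the at most W_n / delta nodes, each of low degree, with
  probability O(1 / W_n). The products are thus bounded, whatever the fluctuations of W_n. Batches
  have no upper bound on their size. One exponential moment of the batch size replaces it, and a
  fourth moment suffices, because the pairs that can collide number at most the square of the batch
  size.\<close>

lemma powser_coeffs_eq:
  fixes a b :: "nat \<Rightarrow> real"
  assumes "\<And>s. 0 \<le> s \<Longrightarrow> s < 1 \<Longrightarrow> (\<lambda>n. a n * s ^ n) sums f s"
    and "\<And>s. 0 \<le> s \<Longrightarrow> s < 1 \<Longrightarrow> (\<lambda>n. b n * s ^ n) sums f s"
  shows "a = b"
proof
  fix m
  define d where "d n = a n - b n" for n
  have d: "(\<lambda>n. d n * s ^ n) sums 0" if "0 \<le> s" "s < 1" for s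
    using sums_diff[OF assms[OF that]] by (simp add: d_def algebra_simps)
  \<comment> \<open>The hypotheses concern \<open>s \<ge> 0\<close> only. Convergence at the single
    point 1/2 yields the two-sided disc that the theorem on isolated zeros asks for.\<close>
  have sm: "(\<lambda>n. d n * (x - 0) ^ n) sums (\<Sum>n. d n * x ^ n)" if "norm (x - 0) < 1 / 2" for x
    using powser_inside[OF sums_summable[OF d[of "1 / 2"]], of x] that by (simp add: summable_sums)
  have f0: "(\<Sum>n. d n * s ^ n) = 0" if "0 \<le> s" "s < 1" for s
    using sums_unique[OF d[OF that]] by simp
  have d0: "d 0 = 0" using d[of 0] by (simp add: powser_sums_zero_iff)
  show "a m = b m"
  proof (rule ccontr)
    assume "a m \<noteq> b m"
    hence dm: "d m \<noteq> 0" by (simp add: d_def)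
    hence "m > 0" using d0 by (cases m) auto
    \<comment> \<open>Zeros of a nontrivial power series are isolated, whereas this one vanishes on
      a right neighbourhood of 0.\<close>
    from powser_0_nonzero[OF half_gt_zero[OF zero_less_one] sm f0[of 0] dm this]
    obtain s where s: "0 < s" "\<And>z. z \<in> cball 0 s - {0} \<Longrightarrow> (\<Sum>n. d n * z ^ n) \<noteq> 0"
      by auto
    have "(\<Sum>n. d n * min s (1/2) ^ n) \<noteq> 0" using s(1) by (intro s(2)) auto
    moreover have "(\<Sum>n. d n * min s (1/2) ^ n) = 0" using s(1) by (intro f0) auto
    ultimately show False by simp
  qed
qed

text \<open>The generating function is
  \<open>q powr \<delta> * (1 - (1 - q) * s) powr (- \<delta>)\<close>, and its binomial series has
  these coefficients.\<close>

lemma pmf_neg_binomial_law: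
  assumes "\<delta> > 0" "0 < q" "q < 1"
  shows "pmf (neg_binomial_law \<delta> q) k = q powr \<delta> * (pochhammer \<delta> k / fact k * (1 - q) ^ k)"
proof -
  have "pmf (neg_binomial_law \<delta> q) = (\<lambda>k. q powr \<delta> * (pochhammer \<delta> k / fact k * (1 - q) ^ k))"
  proof (rule powser_coeffs_eq[where f = "\<lambda>s. (s + (1 - s) / q) powr (- \<delta>)"])
    fix s :: real assume s: "0 \<le> s" "s < 1"
    show "(\<lambda>n. pmf (neg_binomial_law \<delta> q) n * s ^ n) sums (s + (1 - s) / q) powr - \<delta>"
      using expectation_power_sums[of s "neg_binomial_law \<delta> q"] is_neg_binomial_law[OF assms] s
      by (simp add: is_neg_binomial_def)
    have "(1 - q) * s < 1 * 1"
      using assms s by (intro mult_strict_mono') auto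
    hence lt: "(1 - q) * s < 1" by simp
    have "(\<lambda>n. (- \<delta> gchoose n) * (- ((1 - q) * s)) ^ n) sums (1 + - ((1 - q) * s)) powr (- \<delta>)"
      by (rule gen_binomial_real) (use assms s lt in auto)
    moreover have "(- \<delta> gchoose n) * (- ((1 - q) * s)) ^ n
                     = pochhammer \<delta> n / fact n * (1 - q) ^ n * s ^ n" for n
    proof -
      have "(- ((1 - q) * s)) ^ n = (- 1) ^ n * ((1 - q) ^ n * s ^ n)"
        by (metis mult_minus1 power_mult_distrib)
      moreover have "(- 1 :: real) ^ n * (- 1) ^ n = 1"
        by (simp flip: power_mult_distrib)
      ultimately show ?thesis by (simp add: gbinomial_pochhammer)
    qed
    ultimately have "(\<lambda>n. pochhammer \<delta> n / fact n * (1 - q) ^ n * s ^ n) sums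
                       (1 - (1 - q) * s) powr (- \<delta>)" by simp
    from sums_mult[OF this, of "q powr \<delta>"]
    have "(\<lambda>n. q powr \<delta> * (pochhammer \<delta> n / fact n * (1 - q) ^ n) * s ^ n) sums
        (q powr \<delta> * (1 - (1 - q) * s) powr (- \<delta>))"
      by (simp add: mult_ac)
    moreover have "s + (1 - s) / q = (1 - (1 - q) * s) / q"
      using assms by (simp add: field_simps)
    hence "q powr \<delta> * (1 - (1 - q) * s) powr (- \<delta>) = (s + (1 - s) / q) powr (- \<delta>)"
      using assms lt by (simp add: powr_divide powr_minus field_simps)
    ultimately show "(\<lambda>n. q powr \<delta> * (pochhammer \<delta> n / fact n * (1 - q) ^ n) * s ^ n) sums
        (s + (1 - s) / q) powr (- \<delta>)" by simp
  qed
  thus ?thesis by simp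
qed

text \<open>The Waring distribution, B(x + m, r + 1) / B(x, r) in terms of the Beta function. Both
  limit laws have this form.\<close>

definition beta_weight :: "real \<Rightarrow> real \<Rightarrow> nat \<Rightarrow> real" where
  "beta_weight x r m = pochhammer x m / pochhammer (x + r) (Suc m) * r"

lemma beta_weight_0: "beta_weight x r 0 * (x + r) = r" if "x > 0" "r > 0"
  using that by (simp add: beta_weight_def)

text \<open>With the value at 0, this first-order recursion determines the weights. The integrals
  and the fixed-point equation of the drift are both reduced to it.\<close>

lemma beta_weight_Suc:
  assumes "x > 0" "r > 0"
  shows "beta_weight x r (Suc m) * (x + r + Suc m) = (x + m) * beta_weight x r m"
proof -
  have "pochhammer (x + r) (Suc m) \<noteq> 0" "x + r + Suc m \<noteq> 0"
    using assms pochhammer_pos[of "x + r" "Suc m"] by auto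
  thus ?thesis
    unfolding beta_weight_def pochhammer_Suc[of x m] pochhammer_Suc[of "x + r" "Suc m"]
    by (simp add: divide_simps del: of_nat_Suc)
qed

text \<open>Divided by r = 1 + delta p, the factor x + r + m of \<open>beta_weight_Suc\<close>
  becomes 1 + (m + delta) / r. This is the form that \<open>node_fraction_tendsto\<close> asks
  for.\<close>

lemma beta_weight_rec_in:
  fixes \<delta> p :: real
  assumes "0 < p" "\<delta> > 0"
  defines "r \<equiv> beta_weight \<delta> (1 + \<delta> * p)"
  shows "r m * (1 + (real m + \<delta>) / (1 + \<delta> * p)) =
      (if m = 0 then 0 else (real (m - 1) + \<delta>) / (1 + \<delta> * p) * r (m - 1)) + of_bool (m = 0)"
proof -
  have pos: "1 + \<delta> * p > 0" using assms by (simp add: add_pos_pos)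
  show ?thesis
  proof (cases m)
    case 0
    thus ?thesis using beta_weight_0[of \<delta> "1 + \<delta> * p"] pos assms(2)
      by (simp add: r_def field_simps)
  next
    case (Suc k)
    thus ?thesis using beta_weight_Suc[of \<delta> "1 + \<delta> * p" k] pos assms(2)
      by (simp add: r_def field_simps)
  qed
qed

text \<open>Out-degrees start at 1, so the weights are shifted by one place: m + delta is x + (m -
  1) with x = 1 + delta, and degree 0 gets the value 0.\<close>

lemma beta_weight_rec_out:
  fixes \<delta> p :: real
  assumes "0 < p" "p < 1" "\<delta> > 0"
  defines "r \<equiv> \<lambda>m. if m = 0 then 0 else beta_weight (1 + \<delta>) ((1 + \<delta> * p) / (1 - p)) (m - 1)"
  shows "r m * (1 + (1 - p) * (real m + \<delta>) / (1 + \<delta> * p)) =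
      (if m = 0 then 0 else (1 - p) * (real (m - 1) + \<delta>) / (1 + \<delta> * p) * r (m - 1)) + of_bool (m = 1)"
proof -
  define R where "R = (1 + \<delta> * p) / (1 - p)"
  have R: "R > 0" using assms by (simp add: R_def add_pos_pos)
  have div: "(1 - p) * x / (1 + \<delta> * p) = x / R" for x
    using assms by (simp add: R_def)
  consider "m = 0" | "m = 1" | k where "m = Suc (Suc k)" by (metis One_nat_def not0_implies_Suc)
  thus ?thesis
  proof cases
    case 2
    thus ?thesis using beta_weight_0[of "1 + \<delta>" R] R assms(3) unfolding div
      by (simp add: r_def R_def[symmetric] field_simps)
  next
    case 3
    thus ?thesis using beta_weight_Suc[of "1 + \<delta>" R k] R assms(3) unfolding div
      by (simp add: r_def R_def[symmetric] field_simps)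
  qed (simp add: r_def)
qed

text \<open>\<open>J\<close> is a beta integral in the variable \<open>t powr a\<close>. The two
  relations replace the substitution and are all that the comparison with \<open>beta_weight\<close>
  uses.\<close>

lemma integral_powr_times_power:
  fixes \<delta> a :: real and J :: "nat \<Rightarrow> real"
  assumes "\<delta> > 0" "a > 0"
  defines "J \<equiv> \<lambda>m. (LBINT t=0..1. t powr (\<delta> * a) * (1 - t powr a) ^ m)"
  shows "J 0 * (1 + \<delta> * a) = 1"
    and "(1 + \<delta> * a + Suc m * a) * J (Suc m) = Suc m * a * J m"
proof -
  define f where "f m t = t powr (\<delta> * a) * (1 - t powr a) ^ m" for m and t :: real
  have da: "\<delta> * a > 0" using assms by simp
  hence da1: "1 + \<delta> * a > 0" "1 + \<delta> * a \<noteq> 0" by linarith+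
  have cont: "continuous_on {0..1} (f m)" for m
    unfolding f_def using assms da by (intro continuous_intros continuous_on_powr') auto
  have int: "interval_lebesgue_integrable lborel 0 1 (f m)" for m
    unfolding interval_lebesgue_integrable_def
    using set_integrable_subset[OF borel_integrable_atLeastAtMost'[OF cont], of "{0<..<1}" m]
    by (simp add: zero_ereal_def one_ereal_def greaterThanLessThan_subseteq_atLeastAtMost_iff)
  \<comment> \<open>The integrand is the derivative of \<open>F\<close> below: writing t^a = 1 - (1
    - t^a) in the product rule produces the difference of \<open>f (m - 1)\<close> and
    \<open>f m\<close>. For \<open>m = 0\<close> the truncated index is multiplied by 0, and only
    there is the boundary term nonzero.\<close>
  have key: "(LBINT t=0..1. (1 + \<delta> * a) * f m t - m * a * (f (m - 1) t - f m t)) = of_bool (m = 0)" for m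
  proof -
    define F where "F t = t powr (1 + \<delta> * a) * (1 - t powr a) ^ m" for t :: real
    have contF: "continuous_on {0..1} F"
      unfolding F_def using assms da1 by (intro continuous_intros continuous_on_powr') auto
    have "(LBINT t=0..1. (1 + \<delta> * a) * f m t - m * a * (f (m - 1) t - f m t)) = F 1 - F 0"
    proof (rule interval_integral_FTC_integrable)
      fix t :: real assume "0 < ereal t" "ereal t < 1"
      hence t: "0 < t" "t < 1" by (auto simp: zero_ereal_def one_ereal_def)
      have pw: "t powr (1 + \<delta> * a) = t * t powr (\<delta> * a)" using t by (simp add: powr_add)
      have "(F has_real_derivative
          (1 + \<delta> * a) * t powr (\<delta> * a) * (1 - t powr a) ^ m
            + t powr (1 + \<delta> * a) * (m * (1 - t powr a) ^ (m - 1) * - (a * t powr (a - 1)))) (at t)"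
        unfolding F_def by (rule derivative_eq_intros refl | use t in simp)+
      also have "t powr (a - 1) = t powr a / t" using t by (simp add: powr_diff)
      also have "(1 + \<delta> * a) * t powr (\<delta> * a) * (1 - t powr a) ^ m
            + t powr (1 + \<delta> * a) * (m * (1 - t powr a) ^ (m - 1) * - (a * (t powr a / t)))
          = (1 + \<delta> * a) * f m t - m * a * (f (m - 1) t - f m t)"
        using t unfolding pw f_def by (cases m) (auto simp: algebra_simps)
      finally show "(F has_vector_derivative (1 + \<delta> * a) * f m t - m * a * (f (m - 1) t - f m t)) (at t)"
        by (simp add: has_real_derivative_iff_has_vector_derivative)
      have "continuous_on {0<..<1} (f k)" for k
        by (rule continuous_on_subset[OF cont]) auto
      hence "isCont (f k) t" for k
        using t by (simp add: continuous_on_eq_continuous_at)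
      thus "isCont (\<lambda>t. (1 + \<delta> * a) * f m t - m * a * (f (m - 1) t - f m t)) t"
        by (intro continuous_intros)
    next
      show "set_integrable lborel (einterval 0 1) (\<lambda>t. (1 + \<delta> * a) * f m t - m * a * (f (m - 1) t - f m t))"
        using int by (intro set_integral_diff set_integrable_mult_right)
          (auto simp: interval_lebesgue_integrable_def)
      have 0: "(F \<longlongrightarrow> F 0) (at_right 0)" and 1: "(F \<longlongrightarrow> F 1) (at_left 1)"
        using contF by (auto simp: continuous_on_Icc_at_rightD continuous_on_Icc_at_leftD)
      show "((F \<circ> real_of_ereal) \<longlongrightarrow> F 0) (at_right 0)"
        using 0 by (simp add: ereal_tendsto_simps zero_ereal_def)
      show "((F \<circ> real_of_ereal) \<longlongrightarrow> F 1) (at_left 1)"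
        using 1 by (simp add: ereal_tendsto_simps one_ereal_def)
    qed simp
    also have "\<dots> = of_bool (m = 0)" by (cases m) (auto simp: F_def)
    finally show ?thesis .
  qed
  have J: "J m = (LBINT t=0..1. f m t)" for m by (simp add: J_def f_def)
  have split: "(LBINT t=0..1. (1 + \<delta> * a) * f m t - m * a * (f (m - 1) t - f m t))
      = (1 + \<delta> * a) * J m - m * a * (J (m - 1) - J m)" for m
    unfolding J using int
    by (simp add: interval_lebesgue_integral_diff interval_lebesgue_integral_mult_right)
  show "J 0 * (1 + \<delta> * a) = 1" using key[of 0] unfolding split by (simp add: mult.commute)
  show "(1 + \<delta> * a + Suc m * a) * J (Suc m) = Suc m * a * J m"
    using key[of "Suc m"] unfolding split by (simp add: algebra_simps)
qed

text \<open>With \<open>q = t powr a\<close> the mass at \<open>m\<close> integrates to a multiple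
  of \<open>J m\<close>. Multiplied by the ratio of consecutive prefactors, the recursion of
  \<open>J\<close> becomes \<open>beta_weight_Suc\<close> with \<open>r = 1 / a\<close>.\<close>

lemma integral_neg_binomial:
  fixes \<delta> a :: real
  assumes "\<delta> > 0" "a > 0"
  shows "(LBINT t=0..1. measure_pmf.prob (neg_binomial_law \<delta> (t powr a)) {m}) = beta_weight \<delta> (1 / a) m"
proof -
  define J :: "nat \<Rightarrow> real" where "J m = (LBINT t=0..1. t powr (\<delta> * a) * (1 - t powr a) ^ m)" for m
  have "(LBINT t=0..1. measure_pmf.prob (neg_binomial_law \<delta> (t powr a)) {m}) =
      (LBINT t=0..1. pochhammer \<delta> m / fact m * (t powr (\<delta> * a) * (1 - t powr a) ^ m))"
  proof (rule interval_integral_cong, goal_cases)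
    case (1 t)
    hence t: "0 < t" "t < 1" by (auto simp: einterval_def min_def zero_ereal_def one_ereal_def)
    have "t powr a < 1" using t assms powr_less_mono2[of a t 1] by simp
    with t pmf_neg_binomial_law[of \<delta> "t powr a" m] assms show ?case
      by (simp add: measure_pmf_single powr_powr mult_ac)
  qed
  also have "\<dots> = pochhammer \<delta> m / fact m * J m"
    by (simp add: J_def)
  also have "\<dots> = beta_weight \<delta> (1 / a) m"
  proof (induction m)
    case 0
    have "(1 + \<delta> * a) \<noteq> 0" using assms by (smt (verit) mult_pos_pos)
    with integral_powr_times_power(1)[OF assms] show ?case
      using assms by (simp add: J_def beta_weight_def field_simps)
  next
    case (Suc m)
    have pos: "1 + \<delta> * a + Suc m * a > 0" using assms by (simp add: add_pos_nonneg)
    have "\<delta> + 1 / a + Suc m = (1 + \<delta> * a + Suc m * a) / a" using assms by (simp add: field_simps)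
    with pos assms have pos': "\<delta> + 1 / a + Suc m > 0" by (metis divide_pos_pos)
    have "(pochhammer \<delta> (Suc m) / fact (Suc m) * J (Suc m)) * (\<delta> + 1 / a + Suc m)
        = (\<delta> + m) * (pochhammer \<delta> m / fact m) / Suc m / a * ((1 + \<delta> * a + Suc m * a) * J (Suc m))"
      using assms by (simp add: pochhammer_Suc divide_simps del: of_nat_Suc)
    also have "\<dots> = (\<delta> + m) * (pochhammer \<delta> m / fact m) / Suc m / a * (Suc m * a * J m)"
      unfolding J_def integral_powr_times_power(2)[OF assms] ..
    also have "\<dots> = (\<delta> + m) * (pochhammer \<delta> m / fact m * J m)"
      using assms by (simp del: of_nat_Suc)
    also have "\<dots> = beta_weight \<delta> (1 / a) (Suc m) * (\<delta> + 1 / a + Suc m)"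
      unfolding Suc.IH using beta_weight_Suc[of \<delta> "1 / a" m] assms by simp
    finally show ?case using pos' by (metis less_irrefl mult_right_cancel)
  qed
  finally show ?thesis .
qed

text \<open>Euler's limit formula for the Gamma function, solved for the rising factorial; this is
  possible because the limit is not 0.\<close>

lemma pochhammer_asymp_equiv:
  fixes x :: real
  assumes "x > 0"
  shows "(\<lambda>n. pochhammer x (Suc n)) \<sim>[at_top] (\<lambda>n. fact n * real n powr x / Gamma x)"
proof -
  have "Gamma x \<noteq> 0" using Gamma_real_pos[OF assms] by simp
  hence "Gamma_series x \<sim>[at_top] (\<lambda>_. Gamma x)"
    using Gamma_series_LIMSEQ[of x] by (simp add: tendsto_imp_asymp_equiv_const)
  hence "(\<lambda>n. fact n * real n powr x / Gamma_series x n) \<sim>[at_top] (\<lambda>n. fact n * real n powr x / Gamma x)"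
    by (intro asymp_equiv_intros)
  moreover have "eventually (\<lambda>n. fact n * real n powr x / Gamma_series x n = pochhammer x (Suc n)) at_top"
    using eventually_gt_at_top[of 0]
    by eventually_elim (simp add: Gamma_series_def powr_def field_simps)
  ultimately show ?thesis
    by (rule asymp_equiv_cong[THEN iffD1, rotated -1]) auto
qed

text \<open>The numerator is rewritten as \<open>pochhammer x (Suc m) / (m + x)\<close>, so that the
  same asymptotics apply above and below. The factorials cancel, and the extra division by m turns
  the exponent -r into -(1 + r).\<close>

lemma beta_weight_asymp_equiv:
  assumes "x > 0" "r > 0"
  shows "beta_weight x r \<sim>[at_top] (\<lambda>m. r * (Gamma (x + r) / Gamma x) * real m powr (- (1 + r)))"
proof -
  have "(\<lambda>m. real m + x) \<sim>[at_top] (\<lambda>m. real m)"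
    by real_asymp
  with assms have "(\<lambda>m. pochhammer x (Suc m) / (real m + x) / pochhammer (x + r) (Suc m) * r) \<sim>[at_top]
     (\<lambda>m. fact m * real m powr x / Gamma x / real m / (fact m * real m powr (x + r) / Gamma (x + r)) * r)"
    by (intro asymp_equiv_intros pochhammer_asymp_equiv) auto
  moreover have "pochhammer x (Suc m) / (real m + x) / pochhammer (x + r) (Suc m) * r = beta_weight x r m" for m
    using assms by (simp add: beta_weight_def pochhammer_Suc[of x m] add_ac)
  moreover have "eventually (\<lambda>m. fact m * real m powr x / Gamma x / real m / (fact m * real m powr (x + r) / Gamma (x + r)) * r
     = r * (Gamma (x + r) / Gamma x) * real m powr (- (1 + r))) at_top"
    using eventually_gt_at_top[of 0]
    by eventually_elim (use Gamma_real_pos[OF assms(1)] Gamma_real_pos[of "x + r"] assms in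
       \<open>simp add: powr_add powr_minus_divide powr_diff field_simps\<close>)
  ultimately show ?thesis
    using asymp_equiv_trans[OF _ asymp_equiv_refl_ev] by simp
qed

lemma
  assumes "0 < p" "p < 1" "\<delta> > 0"
  shows p_in_eq: "p_in p \<delta> m = beta_weight \<delta> (1 + \<delta> * p) m"
    and p_out_eq: "p_out p \<delta> (Suc m) = beta_weight (1 + \<delta>) ((1 + \<delta> * p) / (1 - p)) m"
proof -
  have pos: "1 + \<delta> * p > 0" using assms by (simp add: add_pos_pos)
  have s1: "{z. z = m} = {m}" and s2: "{z. 1 + z = Suc m} = {m}" by auto
  show "p_in p \<delta> m = beta_weight \<delta> (1 + \<delta> * p) m"
    unfolding p_in_def s1 using integral_neg_binomial[of \<delta> "1 / (1 + \<delta> * p)" m] assms pos by simp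
  show "p_out p \<delta> (Suc m) = beta_weight (1 + \<delta>) ((1 + \<delta> * p) / (1 - p)) m"
    unfolding p_out_def s2
    using integral_neg_binomial[of "1 + \<delta>" "(1 - p) / (1 + \<delta> * p)" m] assms pos by simp
qed

section \<open>Degrees in a realisation of the model\<close>

text \<open>The parameter \<open>s\<close> is the degree of a node at its birth: 0 for in-degrees, 1 for out-degrees.\<close>

primrec batch_deg ::
    "nat \<Rightarrow> real \<Rightarrow> (nat \<Rightarrow> nat) \<Rightarrow> (nat \<Rightarrow> nat \<Rightarrow> real) \<Rightarrow> (nat \<Rightarrow> nat) \<Rightarrow> nat \<Rightarrow> nat \<Rightarrow> nat" where
  "batch_deg s \<delta> b t d 0 = (\<lambda>v. of_bool (v = 1))"
| "batch_deg s \<delta> b t d (Suc n) = (\<lambda>v. batch_deg s \<delta> b t d n v +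
     (\<Sum>k = edges_upto d n + 1..edges_upto d (Suc n).
        (1 - s * b k) * of_bool (attach (t k) \<delta> (batch_deg s \<delta> b t d n) (nodes b d n) = v)
        + s * b k * of_bool (1 + (\<Sum>j=1..k. b j) = v)))"

lemma indeg_eq_batch_deg: "indeg \<delta> b t d n = batch_deg 0 \<delta> b t d n"
  by (induction n) simp_all

lemma outdeg_eq_batch_deg: "outdeg \<delta> b t d n = batch_deg 1 \<delta> b t d n"
  by (induction n) simp_all

lemma edges_upto_0 [simp]: "edges_upto d 0 = 0"
  by (simp add: edges_upto_def)

lemma edges_upto_Suc [simp]: "edges_upto d (Suc n) = edges_upto d n + d (Suc n)"
  by (simp add: edges_upto_def)

definition node_count :: "(nat \<Rightarrow> nat) \<Rightarrow> nat \<Rightarrow> nat" where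
  "node_count b k = 1 + (\<Sum>j=1..k. b j)"

lemma node_count_Suc [simp]: "node_count b (Suc k) = node_count b k + b (Suc k)"
  by (simp add: node_count_def)

lemma node_count_mono: "k \<le> l \<Longrightarrow> node_count b k \<le> node_count b l"
  unfolding node_count_def by (intro add_left_mono sum_mono2) auto

lemma node_count_add: "k \<le> l \<Longrightarrow> node_count b l = node_count b k + (\<Sum>j\<in>{k + 1..l}. b j)"
  by (induction l rule: dec_induct) simp_all

lemma node_count_pos [simp]: "node_count b k > 0"
  by (simp add: node_count_def)

lemma nodes_eq: "nodes b d n = {1..node_count b (edges_upto d n)}"
  by (simp add: nodes_def node_count_def)

text \<open>The choice operator sees only the predicate of being a minimiser, so the same node is
  picked even when there are ties.\<close>

lemma attach_cong:
  assumes "\<And>v. v \<in> V \<Longrightarrow> deg v = deg' v" "\<And>v. v \<in> V \<Longrightarrow> t v = t' v"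
  shows "attach t \<delta> deg V = attach t' \<delta> deg' V"
proof -
  have "is_arg_min (\<lambda>v. t v / (real (deg v) + \<delta>)) (\<lambda>x. x \<in> V) =
    is_arg_min (\<lambda>v. t' v / (real (deg' v) + \<delta>)) (\<lambda>x. x \<in> V)"
    using assms by (auto simp: is_arg_min_def fun_eq_iff)
  thus ?thesis by (simp add: attach_def arg_min_on_def arg_min_def)
qed

lemma attach_in: "finite V \<Longrightarrow> V \<noteq> {} \<Longrightarrow> attach t \<delta> deg V \<in> V"
  unfolding attach_def by (rule arg_min_if_finite)

lemma attach_nodes: "attach t \<delta> deg (nodes b d n) \<in> nodes b d n"
  by (rule attach_in) (auto simp: nodes_def)

text \<open>The state after \<open>n\<close> steps is determined by \<open>n\<close> batch sizes and
  by the coins and clocks of the edges placed so far. This makes the history measurable with respect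
  to a finite range of edge numbers.\<close>

lemma batch_deg_cong:
  assumes "\<And>k. k \<in> {1..n} \<Longrightarrow> d k = d' k"
    and "\<And>k. k \<in> {1..edges_upto d n} \<Longrightarrow> b k = b' k"
    and "\<And>k. k \<in> {1..edges_upto d n} \<Longrightarrow> t k = t' k"
  shows "edges_upto d n = edges_upto d' n \<and> nodes b d n = nodes b' d' n
    \<and> batch_deg s \<delta> b t d n = batch_deg s \<delta> b' t' d' n"
  using assms
proof (induction n)
  case 0
  show ?case by (simp add: nodes_def)
next
  case (Suc n)
  have IH: "edges_upto d n = edges_upto d' n" "nodes b d n = nodes b' d' n"
    "batch_deg s \<delta> b t d n = batch_deg s \<delta> b' t' d' n"
    using Suc by auto
  have e: "edges_upto d (Suc n) = edges_upto d' (Suc n)" using IH(1) Suc.prems(1) by simp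
  have nc: "(\<Sum>j=1..k. b j) = (\<Sum>j=1..k. b' j)" if "k \<le> edges_upto d (Suc n)" for k
    using that Suc.prems(2) by (intro sum.cong) auto
  have "nodes b d (Suc n) = nodes b' d' (Suc n)"
    using nc[of "edges_upto d (Suc n)"] e unfolding nodes_def by simp
  moreover have "batch_deg s \<delta> b t d (Suc n) v = batch_deg s \<delta> b' t' d' (Suc n) v" for v
    unfolding batch_deg.simps IH[symmetric] e[symmetric]
    by (intro arg_cong2[where f = "(+)"] refl sum.cong)
       (use Suc.prems(2,3) in \<open>simp_all add: nc del: edges_upto_Suc\<close>)
  ultimately show ?case using e by blast
qed

text \<open>Inserting the edges of a batch one at a time, with the attachment probabilities still frozen, turns
  the change of the degree counts over the batch into a telescoping sum.\<close>

definition partial_deg ::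
    "nat \<Rightarrow> real \<Rightarrow> (nat \<Rightarrow> nat) \<Rightarrow> (nat \<Rightarrow> nat \<Rightarrow> real) \<Rightarrow> (nat \<Rightarrow> nat) \<Rightarrow> nat \<Rightarrow> nat \<Rightarrow> nat \<Rightarrow> nat" where
  "partial_deg s \<delta> b t d n i v = batch_deg s \<delta> b t d n v +
     (\<Sum>k = edges_upto d n + 1..edges_upto d n + i.
        (1 - s * b k) * of_bool (attach (t k) \<delta> (batch_deg s \<delta> b t d n) (nodes b d n) = v)
        + s * b k * of_bool (node_count b k = v))"

lemma partial_deg_0 [simp]: "partial_deg s \<delta> b t d n 0 = batch_deg s \<delta> b t d n"
  by (simp add: partial_deg_def fun_eq_iff)

lemma partial_deg_all: "partial_deg s \<delta> b t d n (d (Suc n)) = batch_deg s \<delta> b t d (Suc n)"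
  by (simp add: partial_deg_def fun_eq_iff node_count_def)

lemma partial_deg_Suc:
  "partial_deg s \<delta> b t d n (Suc i) v = partial_deg s \<delta> b t d n i v +
     ((1 - s * b (Suc (edges_upto d n + i))) *
        of_bool (attach (t (Suc (edges_upto d n + i))) \<delta> (batch_deg s \<delta> b t d n) (nodes b d n) = v)
      + s * b (Suc (edges_upto d n + i)) * of_bool (node_count b (Suc (edges_upto d n + i)) = v))"
  by (simp add: partial_deg_def)

section \<open>Counting nodes by degree\<close>

definition deg_count :: "nat \<Rightarrow> (nat \<Rightarrow> nat) \<Rightarrow> nat \<Rightarrow> nat" where
  "deg_count N deg m = card {v \<in> {1..N}. deg v = m}"

lemma deg_count_le: "deg_count N deg m \<le> N"
  unfolding deg_count_def by (rule order.trans[OF card_mono[of "{1..N}"]]) auto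

lemma node_fraction_eq: "node_fraction (nodes b d n) deg m =
    real (deg_count (node_count b (edges_upto d n)) deg m) / real (node_count b (edges_upto d n))"
  by (simp add: node_fraction_def deg_count_def nodes_eq of_bool_def sum.If_cases Int_def)

lemma deg_count_eq_sum: "real (deg_count N deg m) = (\<Sum>v=1..N. of_bool (deg v = m))"
  by (simp add: deg_count_def of_bool_def sum.If_cases Int_def)

lemma deg_count_cong: "(\<And>v. 1 \<le> v \<Longrightarrow> v \<le> N \<Longrightarrow> deg v = deg' v) \<Longrightarrow> deg_count N deg m = deg_count N deg' m"
  unfolding deg_count_def by (intro arg_cong[where f = card]) auto

lemma deg_count_incr:
  assumes "j \<in> {1..N}"
  shows "real (deg_count N (\<lambda>v. deg v + of_bool (j = v)) m) = real (deg_count N deg m)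
      + of_bool (Suc (deg j) = m) - of_bool (deg j = m)"
proof -
  have split: "real (deg_count N f m) = of_bool (f j = m) + (\<Sum>v\<in>{1..N}-{j}. of_bool (f v = m))" for f
    unfolding deg_count_eq_sum by (rule sum.remove) (use assms in auto)
  have "(\<Sum>v\<in>{1..N}-{j}. of_bool (deg v + of_bool (j = v) = m)) =
      (\<Sum>v\<in>{1..N}-{j}. of_bool (deg v = m) :: real)"
    by (rule sum.cong) auto
  thus ?thesis unfolding split by simp
qed

text \<open>The values of the input that occur almost surely.\<close>

locale good_input =
  fixes s :: nat and \<delta> :: real and b :: "nat \<Rightarrow> nat" and t :: "nat \<Rightarrow> nat \<Rightarrow> real" and d :: "nat \<Rightarrow> nat"
  assumes s: "s \<in> {0, 1}" and b: "k \<ge> 1 \<Longrightarrow> b k \<in> {0, 1}" and d: "k \<ge> 1 \<Longrightarrow> d k \<ge> 1"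
begin

abbreviation "M n \<equiv> edges_upto d n"
abbreviation "V n \<equiv> node_count b (M n)"
abbreviation "deg n \<equiv> batch_deg s \<delta> b t d n"
abbreviation "J n k \<equiv> attach (t k) \<delta> (deg n) (nodes b d n)"

lemma J_range: "1 \<le> J n k" "J n k \<le> V n"
  using attach_nodes[of "t k" \<delta> "deg n" b d n] by (auto simp: nodes_eq)

lemma edges_upto_ge: "n \<le> M n"
  proof (induction n)
  case (Suc n)
  thus ?case using d[of "Suc n"] by simp
qed simp

lemma node_count_le: "node_count b k \<le> k + 1"
proof (induction k)
  case (Suc k)
  thus ?case using b[of "Suc k"] by auto
qed (simp add: node_count_def)

text \<open>The statement for whole steps stays a hypothesis here, because \<open>deg_new\<close> is
  proved by induction on \<open>n\<close> with this lemma as its step.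
  \<open>partial_deg_new'\<close> is the version without it.\<close>

lemma partial_deg_new:
  assumes new: "\<And>v. v > V n \<Longrightarrow> deg n v = 0" and "v > node_count b (M n + i)"
  shows "partial_deg s \<delta> b t d n i v = 0"
  using assms(2)
proof (induction i)
  case 0
  thus ?case using new by simp
next
  case (Suc i)
  have "J n (Suc (M n + i)) < v"
    using J_range(2)[of "Suc (M n + i)" n] node_count_mono[of "M n" "M n + Suc i" b] Suc.prems by simp
  thus ?case
    using Suc by (simp add: partial_deg_Suc)
qed

lemma deg_new: "v > V n \<Longrightarrow> deg n v = 0"
proof (induction n arbitrary: v)
  case 0
  thus ?case by (simp add: node_count_def)
next
  case (Suc n)
  thus ?case using partial_deg_new[of n "d (Suc n)" v] by (simp add: partial_deg_all[symmetric] del: batch_deg.simps)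
qed

lemmas partial_deg_new' = partial_deg_new[OF deg_new]

text \<open>Edge \<open>k\<close> does at most two things: unless its end belongs to the newborn
  node (\<open>s * b k = 1\<close>), it moves the node that it hits up by one degree; and if
  \<open>b k = 1\<close> it adds a node of degree \<open>s\<close>.\<close>

lemma partial_deg_count_Suc:
  fixes i n defines "k \<equiv> Suc (M n + i)"
  shows "real (deg_count (node_count b k) (partial_deg s \<delta> b t d n (Suc i)) m) =
      real (deg_count (node_count b (M n + i)) (partial_deg s \<delta> b t d n i) m)
      + of_bool (s * b k = 0) * (of_bool (Suc (partial_deg s \<delta> b t d n i (J n k)) = m)
           - of_bool (partial_deg s \<delta> b t d n i (J n k) = m))
      + real (b k) * of_bool (m = s)"
proof -
  let ?P = "partial_deg s \<delta> b t d n i" and ?N = "node_count b (M n + i)"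
  have J: "J n k \<in> {1..?N}"
    using J_range[of k n] node_count_mono[of "M n" "M n + i" b] by simp
  have bk: "b k \<in> {0, 1}" by (rule b) (simp add: k_def)
  have Nk: "node_count b k = ?N + b k" by (simp add: k_def)
  have new: "?P (Suc ?N) = 0" by (rule partial_deg_new') simp_all
  have eq: "partial_deg s \<delta> b t d n (Suc i) v = ?P v + of_bool (s * b k = 0) * of_bool (J n k = v)
     + s * b k * of_bool (node_count b k = v)" for v
    using s bk unfolding partial_deg_Suc k_def[symmetric] by auto
  have cnt: "real (deg_count ?N (partial_deg s \<delta> b t d n (Suc i)) m) = real (deg_count ?N ?P m)
      + of_bool (s * b k = 0) * (of_bool (Suc (?P (J n k)) = m) - of_bool (?P (J n k) = m))"
  proof (cases "s * b k = 0")
    case True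
    hence "deg_count ?N (partial_deg s \<delta> b t d n (Suc i)) m = deg_count ?N (\<lambda>v. ?P v + of_bool (J n k = v)) m"
      by (intro deg_count_cong) (simp add: eq)
    thus ?thesis using True deg_count_incr[OF J, of ?P m] by simp
  next
    case False
    hence "b k = 1" using bk by auto
    hence "deg_count ?N (partial_deg s \<delta> b t d n (Suc i)) m = deg_count ?N ?P m"
      using False Nk by (intro deg_count_cong) (simp add: eq)
    thus ?thesis using False by simp
  qed
  show ?thesis
  proof (cases "b k = 0")
    case True
    thus ?thesis using cnt Nk by simp
  next
    case False
    hence bk1: "b k = 1" using bk by simp
    \<comment> \<open>The target is chosen among the nodes present at step \<open>n\<close>, so the
      newborn node is not hit by its own edge.\<close>
    have "J n k \<noteq> Suc ?N" using J by auto
    hence "partial_deg s \<delta> b t d n (Suc i) (Suc ?N) = s"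
      unfolding eq using new bk1 Nk by simp
    moreover have "real (deg_count (Suc ?N) (partial_deg s \<delta> b t d n (Suc i)) m)
      = real (deg_count ?N (partial_deg s \<delta> b t d n (Suc i)) m)
        + of_bool (partial_deg s \<delta> b t d n (Suc i) (Suc ?N) = m)"
      by (simp add: deg_count_eq_sum)
    ultimately show ?thesis using cnt Nk bk1 by auto
  qed
qed

text \<open>Whether its end goes to an old node or to the newborn one, each edge adds 1 to the total
  degree. Hence the total weight depends on the state only through the numbers of edges and of
  nodes.\<close>

lemma sum_partial_deg:
  "(\<Sum>v=1..node_count b (M n + i). partial_deg s \<delta> b t d n i v) = (\<Sum>v=1..V n. deg n v) + i"
proof (induction i)
  case (Suc i)
  define k where "k = Suc (M n + i)"
  let ?P = "partial_deg s \<delta> b t d n i" and ?N = "node_count b (M n + i)"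
  have J: "J n k \<in> {1..?N}"
    using J_range[of k n] node_count_mono[of "M n" "M n + i" b] by simp
  have bk: "b k \<in> {0, 1}" by (rule b) (simp add: k_def)
  have Nk: "node_count b k = ?N + b k" by (simp add: k_def)
  have new: "?P (Suc ?N) = 0" by (rule partial_deg_new') simp_all
  have eq: "partial_deg s \<delta> b t d n (Suc i) v = ?P v + (1 - s * b k) * of_bool (J n k = v)
     + s * b k * of_bool (node_count b k = v)" for v
    unfolding partial_deg_Suc k_def by simp
  have "(\<Sum>v=1..node_count b k. partial_deg s \<delta> b t d n (Suc i) v) =
    (\<Sum>v=1..node_count b k. ?P v) + (1 - s * b k) * (\<Sum>v=1..node_count b k. of_bool (J n k = v))
    + s * b k * (\<Sum>v=1..node_count b k. of_bool (node_count b k = v))"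
    unfolding eq sum.distrib sum_distrib_left ..
  also have "(\<Sum>v=1..node_count b k. of_bool (J n k = v)) = (1::nat)"
    using J Nk by (simp add: of_bool_def)
  also have "(\<Sum>v=1..node_count b k. of_bool (node_count b k = v)) = (1::nat)"
    by (simp add: of_bool_def Suc_le_eq)
  also have "(\<Sum>v=1..node_count b k. ?P v) = (\<Sum>v=1..?N. ?P v)"
    using bk Nk new by auto
  finally show ?case using Suc bk s by (auto simp: k_def)
qed simp

lemma sum_deg: "(\<Sum>v=1..V n. deg n v) = 1 + M n"
proof (induction n)
  case 0
  thus ?case by (simp add: node_count_def)
next
  case (Suc n)
  thus ?case using sum_partial_deg[of n "d (Suc n)"] by (simp add: partial_deg_all)
qed

text \<open>The increment in \<open>partial_deg_count_Suc\<close> with the degree of the target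
  frozen at step \<open>n\<close>. Given the state at step \<open>n\<close>, it depends on nothing
  but the coin and the clocks of edge \<open>k\<close>.\<close>

definition "lin n m k = of_bool (s * b k = 0) * (of_bool (Suc (deg n (J n k)) = m)
           - of_bool (deg n (J n k) = m)) + b k * (of_bool (m = s) :: real)"

lemma partial_deg_ge: "deg n v \<le> partial_deg s \<delta> b t d n i v"
  by (simp add: partial_deg_def)

text \<open>Newborn nodes have labels above \<open>V n\<close>, so an old node gains degree only
  from edges attached to it. If its degree has changed, an earlier edge of the batch must have hit
  it.\<close>

lemma partial_deg_le:
  assumes "v \<le> V n"
  shows "partial_deg s \<delta> b t d n i v \<le> deg n v + (\<Sum>k = M n + 1..M n + i. of_bool (J n k = v))"
  unfolding partial_deg_def
proof (intro add_left_mono sum_mono)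
  fix k assume k: "k \<in> {M n + 1..M n + i}"
  obtain k' where k': "k = Suc k'" using k by (cases k) auto
  have "M n \<le> k'" using k k' by simp
  have "b k \<in> {0,1}" using k by (intro b) auto
  moreover have "b k = 1 \<Longrightarrow> V n < node_count b k"
    unfolding k' using node_count_mono[OF \<open>M n \<le> k'\<close>, of b] by simp
  ultimately show "(1 - s * b k) * of_bool (J n k = v) + s * b k * of_bool (node_count b k = v)
      \<le> of_bool (J n k = v)"
    using assms s by auto
qed

lemma deg_count_step_error:
  "\<bar>real (deg_count (V (Suc n)) (deg (Suc n)) m) - real (deg_count (V n) (deg n) m)
      - (\<Sum>k = M n + 1..M (Suc n). lin n m k)\<bar>
   \<le> 2 * (\<Sum>k = M n + 1..M (Suc n). \<Sum>l = M n + 1..<k. of_bool (J n l = J n k \<and> deg n (J n k) \<le> m))"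
proof -
  let ?P = "partial_deg s \<delta> b t d n"
  have "\<bar>real (deg_count (node_count b (M n + i)) (?P i) m) - real (deg_count (V n) (deg n) m)
      - (\<Sum>k = M n + 1..M n + i. lin n m k)\<bar>
   \<le> 2 * (\<Sum>k = M n + 1..M n + i. \<Sum>l = M n + 1..<k. of_bool (J n l = J n k \<and> deg n (J n k) \<le> m))" for i
  proof (induction i)
    case (Suc i)
    define k where "k = Suc (M n + i)"
    let ?P = "partial_deg s \<delta> b t d n i"
    define R :: real where "R = (\<Sum>l = M n + 1..<k. of_bool (J n l = J n k \<and> deg n (J n k) \<le> m))"
    have "\<bar>(of_bool (Suc (?P (J n k)) = m) - of_bool (?P (J n k) = m))
        - (of_bool (Suc (deg n (J n k)) = m) - of_bool (deg n (J n k) = m))\<bar>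
      \<le> 2 * R" (is "\<bar>?L - ?L'\<bar> \<le> _")
    \<comment> \<open>Degrees only grow: a target whose frozen degree exceeds \<open>m\<close> is
      counted in neither increment, even if it has been hit before.\<close>
    proof (cases "?P (J n k) = deg n (J n k) \<or> deg n (J n k) > m")
      case True
      have "R \<ge> 0" unfolding R_def by (intro sum_nonneg) auto
      thus ?thesis using True partial_deg_ge[of n "J n k" i] by (auto simp: not_le)
    next
      case False
      have "(\<Sum>l = M n + 1..M n + i. of_bool (J n l = J n k)) \<noteq> (0::nat)"
        using False partial_deg_ge[of n "J n k" i] partial_deg_le[OF J_range(2)[of k n], of i] by linarith
      then obtain l where "l \<in> {M n + 1..M n + i}" "of_bool (J n l = J n k) \<noteq> (0::nat)"
        by (rule sum.not_neutral_contains_not_neutral)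
      hence l: "l \<in> {M n + 1..M n + i}" "J n l = J n k" by auto
      have "(1::real) = (\<Sum>l\<in>{l}. of_bool (J n l = J n k \<and> deg n (J n k) \<le> m))"
        using False l by simp
      also have "\<dots> \<le> R"
        using l unfolding R_def by (intro sum_mono2) (auto simp: k_def)
      finally show ?thesis by (auto simp: of_bool_def)
    qed
    moreover have "\<bar>of_bool (s * b k = 0) * x\<bar> \<le> \<bar>x\<bar>" for x :: real by simp
    ultimately have "\<bar>of_bool (s * b k = 0) * (?L - ?L')\<bar> \<le> 2 * R" by (meson order_trans)
    hence R: "\<bar>of_bool (s * b k = 0) * ?L - of_bool (s * b k = 0) * ?L'\<bar> \<le> 2 * R"
      by (simp add: right_diff_distrib)
    have k: "M n + Suc i = k"
      by (simp add: k_def)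
    have sums: "(\<Sum>k = M n + 1..k. f k) = (\<Sum>k = M n + 1..M n + i. f k) + f k" for f :: "nat \<Rightarrow> real"
      by (simp add: k_def)
    show ?case
      using Suc R partial_deg_count_Suc[of n i m]
      unfolding k sums k_def[symmetric] R_def[symmetric] lin_def distrib_left by linarith
  qed simp
  from this[of "d (Suc n)"] show ?thesis by (simp add: partial_deg_all)
qed

end

section \<open>Exponential clocks and square-integrable variables\<close>

context prob_space begin

text \<open>Integrating P(x < Y) = exp (- b x) against the density of \<open>X\<close> leaves a / (a
  + b) times the density with rate a + b.\<close>

lemma prob_exponential_less:
  assumes X: "distributed M lborel X (exponential_density a)" and a: "a > 0"
    and Y: "distributed M lborel Y (exponential_density b)" and b: "b > 0"
    and ind: "indep_var borel X borel Y"
  shows "prob {\<omega> \<in> space M. X \<omega> < Y \<omega>} = a / (a + b)"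
proof -
  have [measurable]: "X \<in> borel_measurable M" "Y \<in> borel_measurable M"
    using X Y by (auto dest: distributed_measurable)
  interpret Y: prob_space "distr M borel Y" by (rule prob_space_distr) simp
  have dX: "distr M borel X = density lborel (exponential_density a)"
    using distributed_distr_eq_density[OF X] distr_cong[of M M borel lborel X X] by simp
  have "Measurable.pred (borel \<Otimes>\<^sub>M borel) (\<lambda>z::real \<times> real. fst z < snd z)" by measurable
  hence pr: "{z::real \<times> real. fst z < snd z} \<in> sets (borel \<Otimes>\<^sub>M borel)"
    by (simp add: pred_def space_pair_measure)
  have "emeasure M {\<omega> \<in> space M. X \<omega> < Y \<omega>}
      = emeasure (distr M (borel \<Otimes>\<^sub>M borel) (\<lambda>\<omega>. (X \<omega>, Y \<omega>))) {z. fst z < snd z}"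
    by (subst emeasure_distr[OF _ pr]) (auto intro!: arg_cong[where f = "emeasure M"])
  also have "distr M (borel \<Otimes>\<^sub>M borel) (\<lambda>\<omega>. (X \<omega>, Y \<omega>)) = distr M borel X \<Otimes>\<^sub>M distr M borel Y"
    using ind unfolding indep_var_distribution_eq by simp
  also have "emeasure \<dots> {z. fst z < snd z} = (\<integral>\<^sup>+ x. emeasure (distr M borel Y) {y. x < y} \<partial>distr M borel X)"
    by (subst Y.emeasure_pair_measure_alt) (use pr in \<open>simp_all add: vimage_def cong: sets_pair_measure_cong\<close>)
  also have "\<dots> = (\<integral>\<^sup>+ x. ennreal (exponential_density a x) * emeasure (distr M borel Y) {y. x < y} \<partial>lborel)"
    unfolding dX
  proof (subst nn_integral_density)
    have "(\<lambda>x. emeasure (distr M borel Y) (Pair x -` {z. fst z < snd z})) \<in> borel_measurable borel"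
      using pr by (intro Y.measurable_emeasure_Pair) (simp cong: sets_pair_measure_cong)
    thus "(\<lambda>x. emeasure (distr M borel Y) {y. x < y}) \<in> borel_measurable lborel"
      by (simp add: vimage_def)
  qed auto
  also have "\<dots> = (\<integral>\<^sup>+ x. ennreal (a / (a + b)) * ennreal (exponential_density (a + b) x) \<partial>lborel)"
  proof (intro nn_integral_cong)
    fix x :: real
    show "ennreal (exponential_density a x) * emeasure (distr M borel Y) {y. x < y} =
      ennreal (a / (a + b)) * ennreal (exponential_density (a + b) x)"
    proof (cases "x < 0")
      case True
      thus ?thesis by (simp add: exponential_density_def)
    next
      case False
      have "emeasure (distr M borel Y) {y. x < y} = emeasure M {\<omega> \<in> space M. x < Y \<omega>}"
        by (subst emeasure_distr) (auto intro!: arg_cong[where f = "emeasure M"])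
      also have "\<dots> = ennreal (exp (- x * b))"
        using exponential_distributedD_gt[OF Y, of x] b False by (simp add: emeasure_eq_measure)
      also have "ennreal (exponential_density a x) * \<dots> = ennreal (exponential_density a x * exp (- x * b))"
        using a by (simp add: ennreal_mult'' exponential_density_nonneg)
      also have "exponential_density a x * exp (- x * b) = a / (a + b) * exponential_density (a + b) x"
      proof -
        have "exp (- x * (a + b)) = exp (- x * a) * exp (- x * b)"
          unfolding exp_add[symmetric] by (simp add: algebra_simps)
        thus ?thesis using a b False by (simp add: exponential_density_def)
      qed
      also have "ennreal \<dots> = ennreal (a / (a + b)) * ennreal (exponential_density (a + b) x)"
        using a b by (subst ennreal_mult) (simp_all add: exponential_density_nonneg)
      finally show ?thesis .
    qed
  qed
  also have "\<dots> = ennreal (a / (a + b)) * (\<integral>\<^sup>+ x. ennreal (exponential_density (a + b) x) \<partial>lborel)"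
    by (rule nn_integral_cmult) simp
  also have "(\<integral>\<^sup>+ x. ennreal (exponential_density (a + b) x) \<partial>lborel) = 1"
    using prob_space.emeasure_space_1[OF prob_space_exponential_density[of "a + b"]] a b
    by (simp add: emeasure_density)
  finally show ?thesis using a b by (simp add: emeasure_eq_measure)
qed

lemma exponential_distributed_scale:
  assumes X: "distributed M lborel X (exponential_density 1)" and w: "w > 0"
  shows "distributed M lborel (\<lambda>\<omega>. X \<omega> / w) (exponential_density w)"
  unfolding exponential_distributed_iff[OF w]
proof safe
  show "(\<lambda>\<omega>. X \<omega> / w) \<in> borel_measurable M"
    using X by (auto dest: distributed_measurable)
  fix a :: real assume "a \<ge> 0"
  hence "\<P>(\<omega> in M. X \<omega> \<le> a * w) = 1 - exp (- (a * w) * 1)"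
    using w by (intro exponential_distributedD_le[OF X]) auto
  thus "\<P>(\<omega> in M. X \<omega> / w \<le> a) = 1 - exp (- a * w)"
    using w by (simp add: pos_divide_le_eq)
qed

text \<open>The minimum of the other scaled clocks is exponential with the sum of their rates and
  independent of the clock of \<open>v\<close>, so a race between two clocks is left. A single node
  has to be treated apart, as it leaves no others to take the minimum of.\<close>

lemma prob_exponential_race:
  assumes fin: "finite V" and v: "v \<in> V"
    and T: "\<And>u. u \<in> V \<Longrightarrow> distributed M lborel (T u) (exponential_density 1)"
    and w: "\<And>u. u \<in> V \<Longrightarrow> w u > 0"
    and ind: "indep_vars (\<lambda>_. borel) T V"
  shows "prob {\<omega> \<in> space M. \<forall>u\<in>V - {v}. T v \<omega> / w v < T u \<omega> / w u} = w v / (\<Sum>u\<in>V. w u)"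
proof (cases "V = {v}")
  case True
  thus ?thesis using w[of v] by (simp add: prob_space)
next
  case False
  define I where "I = V - {v}"
  have I: "finite I" "I \<noteq> {}" "v \<notin> I" "V = insert v I" using False fin v by (auto simp: I_def)
  define X where "X u \<omega> = T u \<omega> / w u" for u \<omega>
  have X: "distributed M lborel (X u) (exponential_density (w u))" if "u \<in> V" for u
    unfolding X_def using that by (intro exponential_distributed_scale T w)
  have ind': "indep_vars (\<lambda>_. borel) X V"
    unfolding X_def by (rule indep_vars_compose2[OF ind]) simp
  have Min: "distributed M lborel (\<lambda>\<omega>. Min ((\<lambda>u. X u \<omega>) ` I)) (exponential_density (\<Sum>u\<in>I. w u))"
    by (rule exponential_distributed_Min[OF I(1,2)])
      (use I w X in \<open>auto intro: indep_vars_subset[OF ind']\<close>)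
  have "prob {\<omega> \<in> space M. X v \<omega> < Min ((\<lambda>u. X u \<omega>) ` I)} = w v / (w v + (\<Sum>u\<in>I. w u))"
  proof (rule prob_exponential_less[OF X[OF v] w[OF v] Min])
    show "(\<Sum>u\<in>I. w u) > 0" using I w by (intro sum_pos) auto
    show "indep_var borel (X v) borel (\<lambda>\<omega>. Min ((\<lambda>u. X u \<omega>) ` I))"
      using I ind' by (intro indep_vars_Min) auto
  qed
  thus ?thesis using I by (simp add: X_def I_def[symmetric])
qed

text \<open>This does the work of the tower property: for a variable \<open>H\<close> with countably
  many values, conditional expectations may be compared on one level set at a time.\<close>

lemma expectation_eq_of_atoms:
  fixes H :: "'a \<Rightarrow> 'h :: countable" and f g :: "'a \<Rightarrow> real"
  assumes H: "H \<in> measurable M (count_space UNIV)"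
    and f: "integrable M f" and g: "integrable M g"
    and eq: "\<And>h. (\<integral>\<omega>. indicator {\<omega> \<in> space M. H \<omega> = h} \<omega> * f \<omega> \<partial>M)
        = (\<integral>\<omega>. indicator {\<omega> \<in> space M. H \<omega> = h} \<omega> * g \<omega> \<partial>M)"
  shows "expectation f = expectation g"
proof -
  define A where "A i = {\<omega> \<in> space M. to_nat (H \<omega>) = i}" for i
  have A: "A i \<in> sets M" for i
  proof -
    have "A i = H -` {h. to_nat h = i} \<inter> space M" by (auto simp: A_def)
    thus ?thesis using measurable_sets[OF H, of "{h. to_nat h = i}"] by simp
  qed
  have U: "(\<Union>i. A i) = space M" by (auto simp: A_def)
  have sum: "expectation k = (\<Sum>i. LINT \<omega>:A i|M. k \<omega>)" if "integrable M k" for k :: "'a \<Rightarrow> real"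
  proof -
    have "(LINT \<omega>:(\<Union>i. A i)|M. k \<omega>) = (\<Sum>i. LINT \<omega>:A i|M. k \<omega>)"
      by (rule lebesgue_integral_countable_add[OF A])
        (use U integrable_mult_indicator[OF sets.top that] in \<open>auto simp: A_def set_integrable_def\<close>)
    thus ?thesis using that U set_integral_space[OF that] by simp
  qed
  have "(LINT \<omega>:A i|M. f \<omega>) = (LINT \<omega>:A i|M. g \<omega>)" for i
  proof (cases "i \<in> range (to_nat :: 'h \<Rightarrow> nat)")
    case True
    then obtain h :: 'h where "i = to_nat h" by auto
    hence "A i = {\<omega> \<in> space M. H \<omega> = h}" by (auto simp: A_def)
    thus ?thesis using eq[of h] by (simp add: set_lebesgue_integral_def)
  next
    case False
    hence "A i = {}" by (auto simp: A_def)
    thus ?thesis by (simp add: set_lebesgue_integral_def)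
  qed
  thus ?thesis using sum[OF f] sum[OF g] by simp
qed

text \<open>Serves to read one row of clocks as a family indexed by nodes, and to rename out-clocks
  as in-clocks.\<close>

lemma indep_sets_reindex:
  assumes "indep_sets F (g ` I)" "inj_on g I"
  shows "indep_sets (\<lambda>i. F (g i)) I"
proof (rule indep_setsI)
  show "F (g i) \<subseteq> events" if "i \<in> I" for i
    using assms(1) that by (auto simp: indep_sets_def)
  fix A J assume J: "J \<noteq> {}" "J \<subseteq> I" "finite J" "\<forall>j\<in>J. A j \<in> F (g j)"
  have inj: "inj_on g J" using assms(2) J(2) by (rule inj_on_subset)
  define A' where "A' = A \<circ> the_inv_into J g"
  have A': "A' (g j) = A j" if "j \<in> J" for j
    using that by (simp add: A'_def the_inv_into_f_f[OF inj])
  have "prob (\<Inter>j\<in>g ` J. A' j) = (\<Prod>j\<in>g ` J. prob (A' j))"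
    using J A' by (intro indep_setsD[OF assms(1)]) auto
  thus "prob (\<Inter>j\<in>J. A j) = (\<Prod>j\<in>J. prob (A j))"
    using A' by (simp add: prod.reindex[OF inj])
qed

lemma indep_vars_reindex:
  assumes "indep_vars N X (g ` I)" "inj_on g I"
  shows "indep_vars (\<lambda>i. N (g i)) (\<lambda>i. X (g i)) I"
  using assms indep_sets_reindex[of _ g I] unfolding indep_vars_def by blast

section \<open>Square-integrable variables\<close>

definition L2 :: "('a \<Rightarrow> real) \<Rightarrow> bool" where
  "L2 f \<longleftrightarrow> f \<in> borel_measurable M \<and> integrable M (\<lambda>\<omega>. (f \<omega>)\<^sup>2)"

lemma L2_measurable: "L2 f \<Longrightarrow> f \<in> borel_measurable M"
  and L2_square: "L2 f \<Longrightarrow> integrable M (\<lambda>\<omega>. (f \<omega>)\<^sup>2)"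
  by (simp_all add: L2_def)

lemma L2_mult: 
  assumes f: "L2 f" and g: "L2 g"
  shows "integrable M (\<lambda>\<omega>. f \<omega> * g \<omega>)"
proof (rule Bochner_Integration.integrable_bound)
  show "integrable M (\<lambda>\<omega>. (f \<omega>)\<^sup>2 + (g \<omega>)\<^sup>2)"
    using f g by (intro Bochner_Integration.integrable_add L2_square)
  show "(\<lambda>\<omega>. f \<omega> * g \<omega>) \<in> borel_measurable M"
    using f g by (intro borel_measurable_times L2_measurable)
  have "\<bar>x * y\<bar> \<le> x\<^sup>2 + y\<^sup>2" for x y :: real
  proof -
    have "2 * \<bar>x * y\<bar> \<le> x\<^sup>2 + y\<^sup>2"
      using sum_squares_bound[of "\<bar>x\<bar>" "\<bar>y\<bar>"] by (simp add: abs_mult mult.assoc)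
    moreover have "\<bar>x * y\<bar> \<le> 2 * \<bar>x * y\<bar>" by simp
    ultimately show ?thesis by (rule order_trans[rotated])
  qed
  thus "AE \<omega> in M. norm (f \<omega> * g \<omega>) \<le> norm ((f \<omega>)\<^sup>2 + (g \<omega>)\<^sup>2)"
    by (intro AE_I2) (simp add: order_trans[OF _ abs_ge_self])
qed

lemma L2_bound:
  assumes "L2 g" "f \<in> borel_measurable M" "AE \<omega> in M. \<bar>f \<omega>\<bar> \<le> \<bar>g \<omega>\<bar>"
  shows "L2 f"
  unfolding L2_def
proof
  have "AE \<omega> in M. norm ((f \<omega>)\<^sup>2) \<le> norm ((g \<omega>)\<^sup>2)"
    using assms(3) by eventually_elim (simp add: abs_le_square_iff)
  thus "integrable M (\<lambda>\<omega>. (f \<omega>)\<^sup>2)"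
    using assms(2) by (intro Bochner_Integration.integrable_bound[OF L2_square[OF assms(1)]]) auto
qed fact

lemma L2_const [simp]: "L2 (\<lambda>_. c)"
  by (simp add: L2_def)

lemma L2_add: 
  assumes f: "L2 f" and g: "L2 g"
  shows "L2 (\<lambda>\<omega>. f \<omega> + g \<omega>)"
  unfolding L2_def
proof
  show "(\<lambda>\<omega>. f \<omega> + g \<omega>) \<in> borel_measurable M"
    using f g by (intro borel_measurable_add L2_measurable)
  show "integrable M (\<lambda>\<omega>. (f \<omega> + g \<omega>)\<^sup>2)"
    unfolding power2_sum
    using L2_square[OF f] L2_square[OF g] L2_mult[OF f g] by (simp add: mult.assoc)
qed

lemma L2_cmult: "L2 f \<Longrightarrow> L2 (\<lambda>\<omega>. c * f \<omega>)"
  unfolding L2_def by (auto simp: power_mult_distrib)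

lemma L2_diff: "L2 f \<Longrightarrow> L2 g \<Longrightarrow> L2 (\<lambda>\<omega>. f \<omega> - g \<omega>)"
  using L2_add[of f "\<lambda>\<omega>. (-1) * g \<omega>"] L2_cmult[of g "-1"] by simp

lemma L2_abs: "L2 f \<Longrightarrow> L2 (\<lambda>\<omega>. \<bar>f \<omega>\<bar>)"
  by (auto simp: L2_def)

lemma L2_integrable: "L2 f \<Longrightarrow> integrable M f"
  using L2_mult[of f "\<lambda>_. 1"] by simp

text \<open>For \<open>\<Delta>\<close> the increment of \<open>Y\<close>, the first bound concerns
  the drift and the second the size of the increment. With bounds independent of the step, second
  moments grow at most linearly.\<close>

lemma L2_step:
  assumes Y: "L2 Y" and D: "L2 \<Delta>" and 1: "expectation (\<lambda>\<omega>. Y \<omega> * \<Delta> \<omega>) \<le> c"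
    and 2: "expectation (\<lambda>\<omega>. (\<Delta> \<omega>)\<^sup>2) \<le> c'"
  shows "expectation (\<lambda>\<omega>. (Y \<omega> + \<Delta> \<omega>)\<^sup>2) \<le> expectation (\<lambda>\<omega>. (Y \<omega>)\<^sup>2) + (2 * c + c')"
proof -
  have "expectation (\<lambda>\<omega>. (Y \<omega> + \<Delta> \<omega>)\<^sup>2)
      = expectation (\<lambda>\<omega>. (Y \<omega>)\<^sup>2) + expectation (\<lambda>\<omega>. (\<Delta> \<omega>)\<^sup>2) + 2 * expectation (\<lambda>\<omega>. Y \<omega> * \<Delta> \<omega>)"
    using L2_square[OF Y] L2_square[OF D] L2_mult[OF Y D] by (simp add: power2_sum mult.assoc)
  thus ?thesis using 1 2 by linarith
qed

lemma chebyshev: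
  assumes "L2 f" "k > 0"
  shows "prob {\<omega> \<in> space M. k \<le> \<bar>f \<omega>\<bar>} \<le> expectation (\<lambda>\<omega>. (f \<omega>)\<^sup>2) / k\<^sup>2"
proof -
  have "k \<le> \<bar>x\<bar> \<longleftrightarrow> k\<^sup>2 \<le> x\<^sup>2" for x
    using assms(2) abs_le_square_iff[of k x] by simp
  thus ?thesis
    using integral_Markov_inequality_measure[OF L2_square[OF assms(1)], of "{}" "k\<^sup>2"] assms(2) by simp
qed

text \<open>A second moment of order n against the square of a threshold of order n leaves a
  probability of order 1/n.\<close>

lemma tendsto_prob_of_L2:
  assumes f: "\<And>n. L2 (f n)" and C: "\<And>n. expectation (\<lambda>\<omega>. (f n \<omega>)\<^sup>2) \<le> C * (real n + 1)" and k: "k > 0"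
  shows "(\<lambda>n. prob {\<omega> \<in> space M. k * (real n + 1) \<le> \<bar>f n \<omega>\<bar>}) \<longlonglongrightarrow> 0"
proof (rule tendsto_sandwich[OF _ _ tendsto_const])
  show "\<forall>\<^sub>F n in sequentially. 0 \<le> prob {\<omega> \<in> space M. k * (real n + 1) \<le> \<bar>f n \<omega>\<bar>}" by simp
  show "\<forall>\<^sub>F n in sequentially. prob {\<omega> \<in> space M. k * (real n + 1) \<le> \<bar>f n \<omega>\<bar>} \<le> (C / k\<^sup>2) * (1 / (real n + 1))"
  proof (rule always_eventually, rule allI)
    fix n
    have "prob {\<omega> \<in> space M. k * (real n + 1) \<le> \<bar>f n \<omega>\<bar>} \<le> expectation (\<lambda>\<omega>. (f n \<omega>)\<^sup>2) / (k * (real n + 1))\<^sup>2"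
      using k by (intro chebyshev f mult_pos_pos) auto
    also have "\<dots> \<le> C * (real n + 1) / (k * (real n + 1))\<^sup>2"
      using C by (intro divide_right_mono) auto
    also have "\<dots> = (C / k\<^sup>2) * (1 / (real n + 1))"
      by (simp add: power_mult_distrib power2_eq_square[of "real n + 1"])
    finally show "prob {\<omega> \<in> space M. k * (real n + 1) \<le> \<bar>f n \<omega>\<bar>} \<le> (C / k\<^sup>2) * (1 / (real n + 1))" .
  qed
  have "(\<lambda>n. 1 / (real n + 1)) \<longlonglongrightarrow> 0" by real_asymp
  from tendsto_mult_left[OF this, of "C / k\<^sup>2"]
  show "(\<lambda>n. (C / k\<^sup>2) * (1 / (real n + 1))) \<longlonglongrightarrow> 0" by simp
qed

end

text \<open>The value is a function of the set \<open>S \<omega>\<close> of all minimisers. That set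
  takes finitely many values, each on an event defined by finitely many comparisons, so the choice
  operator itself needs no analysis.\<close>

lemma measurable_arg_min_on:
  fixes f :: "'b \<Rightarrow> 'a \<Rightarrow> real"
  assumes "finite V" "\<And>v. v \<in> V \<Longrightarrow> f v \<in> borel_measurable N"
  shows "(\<lambda>\<omega>. arg_min_on (\<lambda>v. f v \<omega>) V) \<in> measurable N (count_space UNIV)"
proof -
  define S where "S \<omega> = {x \<in> V. \<forall>y\<in>V. \<not> f y \<omega> < f x \<omega>}" for \<omega>
  have eq: "arg_min_on (\<lambda>v. f v \<omega>) V = (SOME x. x \<in> S \<omega>)" for \<omega>
    by (simp add: arg_min_on_def arg_min_def is_arg_min_def S_def conj_commute)
       (metis (no_types, lifting))
  have "S \<in> measurable N (count_space (Pow V))"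
  proof (rule measurable_count_space_eq2[THEN iffD2, OF _ conjI])
    show "finite (Pow V)" using assms(1) by simp
    show "S \<in> space N \<rightarrow> Pow V" by (auto simp: S_def)
    show "\<forall>T\<in>Pow V. S -` {T} \<inter> space N \<in> sets N"
    proof
      fix T assume T: "T \<in> Pow V"
      have "S \<omega> = T \<longleftrightarrow> (\<forall>x\<in>V. (x \<in> T) = (x \<in> S \<omega>))" for \<omega>
      proof -
        have "S \<omega> \<subseteq> V" by (auto simp: S_def)
        thus ?thesis using T by blast
      qed
      hence "S -` {T} \<inter> space N = {\<omega> \<in> space N. \<forall>x\<in>V. (x \<in> T) = (x \<in> S \<omega>)}"
        by blast
      also have "\<dots> = {\<omega> \<in> space N. \<forall>x\<in>V. (x \<in> T) = (\<forall>y\<in>V. \<not> f y \<omega> < f x \<omega>)}"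
        by (simp add: S_def)
      also have "\<dots> \<in> sets N"
      proof (rule sets.sets_Collect_finite_All[OF _ assms(1)])
        fix x assume x: "x \<in> V"
        have "{\<omega> \<in> space N. f y \<omega> < f x \<omega>} \<in> sets N" if "y \<in> V" for y
          using x that assms(2) by (intro borel_measurable_less)
        from sets.sets_Collect_neg[OF this]
        have "{\<omega> \<in> space N. \<forall>y\<in>V. \<not> f y \<omega> < f x \<omega>} \<in> sets N"
          using assms(1) by (rule sets.sets_Collect_finite_All)
        from this sets.sets_Collect_neg[OF this]
        show "{\<omega> \<in> space N. (x \<in> T) = (\<forall>y\<in>V. \<not> f y \<omega> < f x \<omega>)} \<in> sets N"
          by (cases "x \<in> T") simp_all
      qed
      finally show "S -` {T} \<inter> space N \<in> sets N" .
    qed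
  qed
  hence "(\<lambda>\<omega>. SOME x. x \<in> S \<omega>) \<in> measurable N (count_space UNIV)"
    by (rule measurable_compose) simp
  thus ?thesis by (simp add: eq)
qed

text \<open>Winning the race strictly forces the choice of \<open>v\<close>, so the race
  probabilities are lower bounds for those of the choice. Both families sum to 1, hence they agree.
  This settles ties without computing their probability.\<close>

lemma (in prob_space) prob_attach:
  assumes fin: "finite V" and ne: "V \<noteq> {}" and S: "S \<subseteq> V" and \<delta>: "\<delta> > 0"
    and T: "\<And>u. u \<in> V \<Longrightarrow> distributed M lborel (T u) (exponential_density 1)"
    and ind: "indep_vars (\<lambda>_. borel) T V"
  shows "prob {\<omega> \<in> space M. attach (\<lambda>v. T v \<omega>) \<delta> g V \<in> S} = (\<Sum>u\<in>S. real (g u) + \<delta>) / (\<Sum>u\<in>V. real (g u) + \<delta>)"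
proof -
  let ?w = "\<lambda>u. real (g u) + \<delta>" and ?a = "\<lambda>\<omega>. attach (\<lambda>v. T v \<omega>) \<delta> g V"
  have [measurable]: "T u \<in> borel_measurable M" if "u \<in> V" for u
    using distributed_measurable[OF T[OF that]] by simp
  have w: "?w u > 0" for u using \<delta> by simp
  have a: "?a \<in> measurable M (count_space UNIV)"
    unfolding attach_def by (rule measurable_arg_min_on[OF fin]) measurable
  have aV: "?a \<omega> \<in> V" for \<omega>
    unfolding attach_def by (rule arg_min_if_finite[OF fin ne])
  define E where "E v = {\<omega> \<in> space M. ?a \<omega> = v}" for v
  have E: "E v \<in> events" for v
    unfolding E_def using measurable_sets[OF a, of "{v}"] by (simp add: vimage_def Int_def conj_commute)
  have ge: "?w v / (\<Sum>u\<in>V. ?w u) \<le> prob (E v)" if "v \<in> V" for v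
  proof -
    have "?w v / (\<Sum>u\<in>V. ?w u) = prob {\<omega> \<in> space M. \<forall>u\<in>V - {v}. T v \<omega> / ?w v < T u \<omega> / ?w u}"
      using prob_exponential_race[OF fin that T _ ind, of ?w] w by simp
    also have "\<dots> \<le> prob (E v)"
    proof (rule finite_measure_mono[OF _ E], safe)
      fix \<omega> assume \<omega>: "\<omega> \<in> space M" "\<forall>u\<in>V - {v}. T v \<omega> / ?w v < T u \<omega> / ?w u"
      have "\<not> T v \<omega> / ?w v < T (?a \<omega>) \<omega> / ?w (?a \<omega>)"
        unfolding attach_def using arg_min_if_finite(2)[OF fin ne, of "\<lambda>u. T u \<omega> / ?w u"] that by blast
      thus "\<omega> \<in> E v" using \<omega> aV[of \<omega>] by (auto simp: E_def)
    qed
    finally show ?thesis .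
  qed
  have U: "prob (\<Union>v\<in>S. E v) = (\<Sum>v\<in>S. prob (E v))" if "S \<subseteq> V" for S
    by (rule finite_measure_finite_Union) (use that fin E finite_subset in \<open>auto simp: E_def disjoint_family_on_def\<close>)
  have "(\<Union>v\<in>V. E v) = space M" using aV by (auto simp: E_def)
  hence tot: "(\<Sum>v\<in>V. prob (E v)) = 1" using U[of V] by (simp add: prob_space)
  have "(\<Sum>u\<in>V. ?w u) > 0" using fin ne w by (intro sum_pos) auto
  hence "(\<Sum>v\<in>V. ?w v / (\<Sum>u\<in>V. ?w u)) = (\<Sum>v\<in>V. prob (E v))"
    using tot by (simp flip: sum_divide_distrib)
  hence eq: "prob (E v) = ?w v / (\<Sum>u\<in>V. ?w u)" if "v \<in> V" for v
    using sum_mono_inv[of "\<lambda>v. ?w v / (\<Sum>u\<in>V. ?w u)" V "\<lambda>v. prob (E v)" v] ge that fin by simp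
  have "{\<omega> \<in> space M. ?a \<omega> \<in> S} = (\<Union>v\<in>S. E v)" by (auto simp: E_def)
  thus ?thesis using U[OF S] eq S by (auto simp: sum_divide_distrib intro!: sum.cong)
qed

section \<open>Elementary estimates for the second moments\<close>

lemma linear_growth:
  fixes y :: "nat \<Rightarrow> real"
  assumes "\<And>n. y (Suc n) \<le> y n + C"
  shows "y n \<le> (\<bar>y 0\<bar> + \<bar>C\<bar>) * (real n + 1)"
proof -
  have "y n \<le> \<bar>y 0\<bar> + \<bar>C\<bar> * real n"
  proof (induction n)
    case (Suc n)
    have "y (Suc n) \<le> y n + \<bar>C\<bar>" using assms[of n] by linarith
    also have "\<dots> \<le> \<bar>y 0\<bar> + \<bar>C\<bar> * real (Suc n)" using Suc by (simp add: algebra_simps)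
    finally show ?case .
  qed simp
  also have "\<dots> \<le> (\<bar>y 0\<bar> + \<bar>C\<bar>) * (real n + 1)" by (simp add: algebra_simps)
  finally show ?thesis .
qed

lemma sum_indicator_bounds:
  "0 \<le> (\<Sum>x\<in>I. indicat_real (U x) \<omega>)" "(\<Sum>x\<in>I. indicat_real (U x) \<omega>) \<le> card I"
  using sum_bounded_above[of I "\<lambda>x. indicat_real (U x) \<omega>" 1]
  by (auto intro!: sum_nonneg simp: indicator_def)

lemma le_power2_if_ge_1: "x \<ge> 1 \<Longrightarrow> x \<le> x\<^sup>2" "x \<ge> 1 \<Longrightarrow> 1 \<le> x\<^sup>2" for x :: real
  using mult_mono[of 1 x x x] mult_mono[of 1 x 1 x] by (auto simp: power2_eq_square)

text \<open>\<open>eqn\<close> says that \<open>c\<close> is the fixed point at which the drift vanishes in the limit. The term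
  \<open>- a * (N - c * T)\<^sup>2\<close> hidden in the left-hand side absorbs the mixed terms.\<close>

lemma drift_bound:
  fixes T w a b c c' e \<delta> N N' W :: real
  assumes pos: "T > 0" "w > 0" "a > 0" "b \<ge> 0" "W > 0" "\<delta> > 0"
    and N: "0 \<le> N" "\<delta> * N \<le> W" and N': "0 \<le> N'" "\<delta> * N' \<le> W"
    and eqn: "c + a * c / w = b * c' / w + e"
  shows "(N - c * T) * (b * N' / W - a * N / W + e - c)
     \<le> ((b\<^sup>2 / a) * (N' - c' * T)\<^sup>2 + ((a + b) / \<delta>)\<^sup>2 / a * (W - w * T)\<^sup>2) / (w * T)"
proof -
  define Y Y' Z \<nu> \<nu>' where "Y = N - c * T" and "Y' = N' - c' * T" and "Z = W - w * T"
    and "\<nu> = N / W" and "\<nu>' = N' / W"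
  have \<nu>: "0 \<le> \<nu>" "\<nu> \<le> 1 / \<delta>" "0 \<le> \<nu>'" "\<nu>' \<le> 1 / \<delta>"
    using assms by (auto simp: \<nu>_def \<nu>'_def field_simps)
  define g where "g = a * \<nu> - b * \<nu>'"
  \<comment> \<open>Replaces the random denominator by \<open>w * T\<close>. The error is
    \<open>Z\<close> times a quotient \<open>x / W\<close> that is at most 1 / delta, so no lower
    bound on \<open>W\<close> enters.\<close>
  have id: "x / W - y / w = (x - y * T - x / W * Z) / (w * T)" for x y
    using pos by (simp add: Z_def field_simps)
  have "b * N' / W - a * N / W + e - c = b * (N' / W - c' / w) - a * (N / W - c / w)"
    using eqn by (simp add: right_diff_distrib)
  also have "\<dots> = b * ((Y' - \<nu>' * Z) / (w * T)) - a * ((Y - \<nu> * Z) / (w * T))"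
    unfolding id by (simp add: Y_def Y'_def \<nu>_def \<nu>'_def)
  also have "\<dots> = (b * (Y' - \<nu>' * Z) - a * (Y - \<nu> * Z)) / (w * T)"
    by (simp add: diff_divide_distrib right_diff_distrib)
  also have "b * (Y' - \<nu>' * Z) - a * (Y - \<nu> * Z) = b * Y' - a * Y + g * Z"
    by (simp add: g_def algebra_simps)
  finally have drift: "b * N' / W - a * N / W + e - c = (b * Y' - a * Y + g * Z) / (w * T)" .
  have "\<bar>g\<bar> \<le> (a + b) / \<delta>"
  proof -
    have "a * \<nu> \<le> a * (1 / \<delta>)" "b * \<nu>' \<le> b * (1 / \<delta>)"
      using \<nu> pos by (intro mult_left_mono; simp)+
    moreover have "0 \<le> a * \<nu>" "0 \<le> b * \<nu>'" using \<nu> pos by simp_all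
    ultimately have "a * \<nu> \<le> a / \<delta>" "b * \<nu>' \<le> b / \<delta>" "0 \<le> a * \<nu>" "0 \<le> b * \<nu>'" by simp_all
    thus ?thesis unfolding g_def add_divide_distrib by simp
  qed
  hence "\<bar>g\<bar>\<^sup>2 \<le> ((a + b) / \<delta>)\<^sup>2" by (intro power_mono) auto
  hence g: "g\<^sup>2 * Z\<^sup>2 \<le> ((a + b) / \<delta>)\<^sup>2 * Z\<^sup>2" by (intro mult_right_mono) auto
  \<comment> \<open>The available a^2 Y^2 is split: a quarter completes the square with b Y', a
    quarter the one with g Z, and the remaining half is dropped.\<close>
  have "0 \<le> (b * Y' - a * Y / 2)\<^sup>2 + (g * Z - a * Y / 2)\<^sup>2 + a\<^sup>2 * Y\<^sup>2 / 2" by simp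
  also have "\<dots> = b\<^sup>2 * Y'\<^sup>2 + g\<^sup>2 * Z\<^sup>2 - a * (Y * (b * Y' - a * Y + g * Z))"
    by (simp add: power2_eq_square algebra_simps)
  finally have "a * (Y * (b * Y' - a * Y + g * Z)) \<le> b\<^sup>2 * Y'\<^sup>2 + ((a + b) / \<delta>)\<^sup>2 * Z\<^sup>2"
    using g by linarith
  hence "Y * (b * Y' - a * Y + g * Z) \<le> (b\<^sup>2 * Y'\<^sup>2 + ((a + b) / \<delta>)\<^sup>2 * Z\<^sup>2) / a"
    using pos by (simp add: pos_le_divide_eq mult.commute)
  hence "Y * (b * Y' - a * Y + g * Z) / (w * T) \<le> (b\<^sup>2 * Y'\<^sup>2 + ((a + b) / \<delta>)\<^sup>2 * Z\<^sup>2) / a / (w * T)"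
    using pos by (intro divide_right_mono) auto
  moreover have "(b\<^sup>2 * Y'\<^sup>2 + ((a + b) / \<delta>)\<^sup>2 * Z\<^sup>2) / a = (b\<^sup>2 / a) * Y'\<^sup>2 + ((a + b) / \<delta>)\<^sup>2 / a * Z\<^sup>2"
    by (simp only: add_divide_distrib times_divide_eq_left)
  ultimately show ?thesis
    unfolding drift Y_def[symmetric] Y'_def[symmetric] Z_def[symmetric] times_divide_eq_right
    by (simp only:)
qed

section \<open>Measurability of the model in its inputs\<close>

lemma measurable_count_space_if_real:
  assumes "(\<lambda>\<omega>. real (f \<omega>)) \<in> borel_measurable N"
  shows "f \<in> measurable N (count_space UNIV)"
proof -
  have "(\<lambda>\<omega>. nat \<lfloor>real (f \<omega>)\<rfloor>) \<in> measurable N (count_space UNIV)"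
    using assms by measurable
  thus ?thesis by simp
qed

text \<open>Countability of the first argument allows it to be fixed, one value at a time.\<close>

lemma measurable_count_space_op:
  assumes "f \<in> measurable N (count_space UNIV)" "g \<in> measurable N (count_space UNIV)"
  shows "(\<lambda>\<omega>. h (f \<omega> :: 'a :: countable) (g \<omega>)) \<in> measurable N (count_space UNIV)"
  by (rule measurable_compose_countable[OF _ assms(1)], rule measurable_compose[OF assms(2)]) simp

lemma measurable_sum_nat:
  fixes f :: "'i \<Rightarrow> 'a \<Rightarrow> nat"
  assumes "\<And>i. i \<in> A \<Longrightarrow> f i \<in> measurable N (count_space UNIV)"
  shows "(\<lambda>\<omega>. \<Sum>i\<in>A. f i \<omega>) \<in> measurable N (count_space UNIV)"
  using assms
proof (induction A rule: infinite_finite_induct)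
  case (insert i A)
  have "(\<lambda>\<omega>. f i \<omega> + (\<Sum>i\<in>A. f i \<omega>)) \<in> measurable N (count_space UNIV)"
    by (rule measurable_count_space_op[where h = "(+)"]) (use insert in auto)
  thus ?case using insert by simp
qed auto

text \<open>Random summation ranges and random node sets are countably valued, so each is fixed
  before measurability is checked. \<open>N\<close> is arbitrary because the lemma is applied both
  to the whole space and to the sigma-algebra of the past.\<close>

lemma measurable_model:
  fixes b d :: "nat \<Rightarrow> 'a \<Rightarrow> nat" and t :: "nat \<Rightarrow> nat \<Rightarrow> 'a \<Rightarrow> real"
  assumes b: "\<And>k. k \<ge> 1 \<Longrightarrow> b k \<in> measurable N (count_space UNIV)"
    and d: "\<And>k. k \<ge> 1 \<Longrightarrow> d k \<in> measurable N (count_space UNIV)"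
    and t: "\<And>k v. k \<ge> 1 \<Longrightarrow> v \<ge> 1 \<Longrightarrow> t k v \<in> borel_measurable N"
  shows measurable_edges_upto:
      "(\<lambda>\<omega>. edges_upto (\<lambda>k. d k \<omega>) n) \<in> measurable N (count_space UNIV)"
    and measurable_node_count:
      "(\<lambda>\<omega>. node_count (\<lambda>k. b k \<omega>) (edges_upto (\<lambda>k. d k \<omega>) n)) \<in> measurable N (count_space UNIV)"
    and measurable_batch_deg:
      "(\<lambda>\<omega>. batch_deg s \<delta> (\<lambda>k. b k \<omega>) (\<lambda>k v. t k v \<omega>) (\<lambda>k. d k \<omega>) n v) \<in> measurable N (count_space UNIV)"
proof -
  let ?E = "\<lambda>n \<omega>. edges_upto (\<lambda>k. d k \<omega>) n"
  have E: "?E n \<in> measurable N (count_space UNIV)" for n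
    unfolding edges_upto_def by (rule measurable_sum_nat) (use d in auto)
  have Nk: "(\<lambda>\<omega>. node_count (\<lambda>k. b k \<omega>) k) \<in> measurable N (count_space UNIV)" for k
    unfolding node_count_def
    by (rule measurable_count_space_op[where h = "(+)" and f = "\<lambda>_. 1"]) (auto intro!: measurable_sum_nat b)
  have V: "(\<lambda>\<omega>. node_count (\<lambda>k. b k \<omega>) (?E n \<omega>)) \<in> measurable N (count_space UNIV)" for n
    by (rule measurable_compose_countable[OF Nk E])
  show "?E n \<in> measurable N (count_space UNIV)" by (rule E)
  show "(\<lambda>\<omega>. node_count (\<lambda>k. b k \<omega>) (?E n \<omega>)) \<in> measurable N (count_space UNIV)" by (rule V)
  show "(\<lambda>\<omega>. batch_deg s \<delta> (\<lambda>k. b k \<omega>) (\<lambda>k v. t k v \<omega>) (\<lambda>k. d k \<omega>) n v) \<in> measurable N (count_space UNIV)"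
  proof (induction n arbitrary: v)
    case 0
    thus ?case by simp
  next
    case (Suc n)
    let ?deg = "\<lambda>\<omega>. batch_deg s \<delta> (\<lambda>k. b k \<omega>) (\<lambda>k v. t k v \<omega>) (\<lambda>k. d k \<omega>) n"
    let ?J = "\<lambda>k \<omega>. attach (\<lambda>v. t k v \<omega>) \<delta> (?deg \<omega>) (nodes (\<lambda>k. b k \<omega>) (\<lambda>k. d k \<omega>) n)"
    have J: "?J k \<in> measurable N (count_space UNIV)" if "k \<ge> 1" for k
      unfolding nodes_eq
    proof (rule measurable_compose_countable[OF _ V])
      fix x
      have [measurable]: "(\<lambda>\<omega>. real (?deg \<omega> v)) \<in> borel_measurable N" for v
        by (rule measurable_compose[OF Suc.IH]) simp
      show "(\<lambda>\<omega>. attach (\<lambda>v. t k v \<omega>) \<delta> (?deg \<omega>) {1..x}) \<in> measurable N (count_space UNIV)"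
        unfolding attach_def
      proof (rule measurable_arg_min_on)
        fix v assume "v \<in> {1..x}"
        hence [measurable]: "t k v \<in> borel_measurable N" using t[of k v] that by simp
        show "(\<lambda>\<omega>. t k v \<omega> / (real (?deg \<omega> v) + \<delta>)) \<in> borel_measurable N" by measurable
      qed simp
    qed
    define inc where "inc k \<omega> = (1 - s * b k \<omega>) * of_bool (?J k \<omega> = v)
        + s * b k \<omega> * of_bool (node_count (\<lambda>k. b k \<omega>) k = v)" for k \<omega>
    have "inc k \<in> measurable N (count_space UNIV)" if "k \<ge> 1" for k
      unfolding inc_def
      by (intro measurable_count_space_op[where h = "(+)"]
          measurable_count_space_op[where h = "\<lambda>b j. (1 - s * b) * of_bool (j = v)"]
          measurable_count_space_op[where h = "\<lambda>b j. s * b * of_bool (j = v)"] J Nk b that)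
    hence sums: "(\<lambda>\<omega>. \<Sum>k=l+1..m. inc k \<omega>) \<in> measurable N (count_space UNIV)" for l m
      by (intro measurable_sum_nat) auto
    have "(\<lambda>\<omega>. \<Sum>k=?E n \<omega>+1..?E (Suc n) \<omega>. inc k \<omega>) \<in> measurable N (count_space UNIV)"
      by (rule measurable_compose_countable[OF measurable_compose_countable[OF sums E] E])
    from measurable_count_space_op[OF Suc.IH this, of "(+)"]
    show ?case unfolding batch_deg.simps inc_def node_count_def .
  qed
qed

section \<open>The law of one batch given the history\<close>

text \<open>The clocks of whichever degree is considered, also the out-clocks, are indexed by \<open>In_Clock\<close>.\<close>

definition inputs :: "source set" where
  "inputs = {Coin k | k. k \<ge> 1} \<union> {In_Clock k v | k v. k \<ge> 1 \<and> v \<ge> 1} \<union> {Batch k | k. k \<ge> 1}"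

definition input_var ::
    "(nat \<Rightarrow> 'a \<Rightarrow> nat) \<Rightarrow> (nat \<Rightarrow> nat \<Rightarrow> 'a \<Rightarrow> real) \<Rightarrow> (nat \<Rightarrow> 'a \<Rightarrow> nat) \<Rightarrow> source \<Rightarrow> 'a \<Rightarrow> real" where
  "input_var B t dM i \<omega> = (case i of
       Coin k \<Rightarrow> real (B k \<omega>)
     | In_Clock k v \<Rightarrow> t k v \<omega>
     | Out_Clock k v \<Rightarrow> 0
     | Batch k \<Rightarrow> real (dM k \<omega>))"

text \<open>Carries a single family of clocks, so that one development serves both degrees:
  \<open>s = 0\<close> with the in-clocks and \<open>s = 1\<close> with the out-clocks.\<close>

locale pa_family = prob_space M for M :: "'a measure" +
  fixes p lam \<delta> :: real and s :: nat
    and B :: "nat \<Rightarrow> 'a \<Rightarrow> nat"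
    and t :: "nat \<Rightarrow> nat \<Rightarrow> 'a \<Rightarrow> real"
    and dM :: "nat \<Rightarrow> 'a \<Rightarrow> nat"
  assumes p: "0 < p" "p < 1" and \<delta>: "\<delta> > 0" and lam: "lam > 0" and s: "s \<in> {0, 1}"
    and indep: "indep_vars (\<lambda>_. borel) (input_var B t dM) inputs"
    and coin_1: "k \<ge> 1 \<Longrightarrow> prob {\<omega> \<in> space M. B k \<omega> = 1} = p"
    and coin_0: "k \<ge> 1 \<Longrightarrow> prob {\<omega> \<in> space M. B k \<omega> = 0} = 1 - p"
    and clock: "k \<ge> 1 \<Longrightarrow> v \<ge> 1 \<Longrightarrow> distributed M lborel (t k v) (exponential_density 1)"
    and batch: "k \<ge> 1 \<Longrightarrow> j \<ge> 1 \<Longrightarrow>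
      prob {\<omega> \<in> space M. dM k \<omega> = j} = exp (- lam) * lam ^ (j - 1) / fact (j - 1)"
begin

section \<open>Independence of disjoint blocks of inputs\<close>

definition gen :: "source set \<Rightarrow> 'a measure" where
  "gen G = sigma (space M) (\<Union>i\<in>G. {input_var B t dM i -` S \<inter> space M | S. S \<in> sets borel})"

lemma space_gen [simp]: "space (gen G) = space M"
  unfolding gen_def by (rule space_measure_of) auto

lemma sets_gen: "sets (gen G) =
    sigma_sets (space M) (\<Union>i\<in>G. {input_var B t dM i -` S \<inter> space M | S. S \<in> sets borel})"
  unfolding gen_def by (rule sets_measure_of) auto

lemma input_gen: "i \<in> G \<Longrightarrow> input_var B t dM i \<in> borel_measurable (gen G)"
  by (rule measurableI) (auto simp: sets_gen intro!: sigma_sets.Basic)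

lemma
  shows coin_gen: "Coin k \<in> G \<Longrightarrow> B k \<in> measurable (gen G) (count_space UNIV)"
    and batch_gen: "Batch k \<in> G \<Longrightarrow> dM k \<in> measurable (gen G) (count_space UNIV)"
    and clock_gen: "In_Clock k v \<in> G \<Longrightarrow> t k v \<in> borel_measurable (gen G)"
  using input_gen[of "Coin k" G] input_gen[of "Batch k" G] input_gen[of "In_Clock k v" G]
  by (auto simp: input_var_def[abs_def] intro!: measurable_count_space_if_real)

lemma sets_gen_events: "G \<subseteq> inputs \<Longrightarrow> sets (gen G) \<subseteq> events"
  unfolding sets_gen
  by (intro sets.sigma_sets_subset) (use indep in \<open>auto simp: indep_vars_def2 intro!: measurable_sets\<close>)

lemma measurable_gen: "G \<subseteq> inputs \<Longrightarrow> f \<in> measurable (gen G) N \<Longrightarrow> f \<in> measurable M N"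
  using sets_gen_events[of G] unfolding measurable_def by auto

lemma
  shows measurable_coin: "k \<ge> 1 \<Longrightarrow> B k \<in> measurable M (count_space UNIV)"
    and measurable_batch: "k \<ge> 1 \<Longrightarrow> dM k \<in> measurable M (count_space UNIV)"
    and measurable_clock: "k \<ge> 1 \<Longrightarrow> v \<ge> 1 \<Longrightarrow> t k v \<in> borel_measurable M"
  using measurable_gen[OF subset_refl coin_gen] measurable_gen[OF subset_refl batch_gen]
    measurable_gen[OF subset_refl clock_gen]
  by (auto simp: inputs_def)

text \<open>Preimages of Borel sets under one input form a pi-system, so independence of the inputs
  passes to the sigma-algebras of disjoint blocks.\<close>

lemma prob_Inter_gen:
  assumes "finite J" "J \<noteq> {}" and G: "\<And>j. j \<in> J \<Longrightarrow> G j \<subseteq> inputs" and "disjoint_family_on G J"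
    and A: "\<And>j. j \<in> J \<Longrightarrow> A j \<in> sets (gen (G j))"
  shows "prob (\<Inter>j\<in>J. A j) = (\<Prod>j\<in>J. prob (A j))"
proof (rule indep_setsD[where F = "\<lambda>j. sets (gen (G j))" and I = J])
  show "indep_sets (\<lambda>j. sets (gen (G j))) J"
    unfolding sets_gen
  proof (rule indep_sets_collect_sigma)
    show "indep_sets (\<lambda>i. {input_var B t dM i -` S \<inter> space M | S. S \<in> sets borel}) (\<Union>j\<in>J. G j)"
      by (rule indep_sets_mono_index[of _ inputs])
        (use G indep in \<open>auto simp: indep_vars_def2\<close>)
    show "Int_stable {input_var B t dM i -` S \<inter> space M | S. S \<in> sets borel}" for i
    proof (rule Int_stableI, clarify)
      fix S T :: "real set" assume "S \<in> sets borel" "T \<in> sets borel"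
      thus "\<exists>U. input_var B t dM i -` S \<inter> space M \<inter> (input_var B t dM i -` T \<inter> space M)
          = input_var B t dM i -` U \<inter> space M \<and> U \<in> sets borel"
        by (intro exI[of _ "S \<inter> T"]) auto
    qed
  qed fact
  show "\<forall>j\<in>J. A j \<in> sets (gen (G j))" using A by blast
qed (use assms(1,2) in simp_all)

text \<open>\<open>K\<close> stands for a value of the number of edges after \<open>n\<close> steps.
  Coins and clocks are cut off at \<open>K\<close>, batch sizes at \<open>n\<close>.\<close>

definition past :: "nat \<Rightarrow> nat \<Rightarrow> source set" where
  "past n K = {Coin k | k. k \<in> {1..K}} \<union> {In_Clock k v | k v. k \<in> {1..K} \<and> v \<ge> 1} \<union> {Batch k | k. k \<in> {1..n}}"

text \<open>Five blocks cover every later use: the history, the size of the next batch, and of the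
  next edges one coin and two rows of clocks. The second row is there for collisions.\<close>

lemma prob_step:
  assumes A: "A \<in> sets (gen (past n K))" and D: "D \<in> sets (gen {Batch (Suc n)})"
    and k: "K < k" "K < l" "k \<noteq> l"
    and E1: "E1 \<in> sets (gen {Coin k})" and E2: "E2 \<in> sets (gen {In_Clock k v | v. v \<ge> 1})"
    and E3: "E3 \<in> sets (gen {In_Clock l v | v. v \<ge> 1})"
  shows "prob (A \<inter> D \<inter> E1 \<inter> E2 \<inter> E3) = prob A * prob D * prob E1 * prob E2 * prob E3"
proof -
  define G where "G j = [past n K, {Batch (Suc n)}, {Coin k}, {In_Clock k v | v. v \<ge> 1}, {In_Clock l v | v. v \<ge> 1}] ! j" for j
  define F where "F j = [A, D, E1, E2, E3] ! j" for j
  have k1: "Suc 0 \<le> k" "Suc 0 \<le> l" using k by auto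
  have past: "past n K \<subseteq> inputs" by (auto simp: past_def inputs_def)
  have five: "{..<5::nat} = {0, 1, 2, 3, 4}" by auto
  have "prob (\<Inter>j\<in>{..<5::nat}. F j) = (\<Prod>j\<in>{..<5::nat}. prob (F j))"
  proof (rule prob_Inter_gen[where G = G])
    show "G j \<subseteq> inputs" if "j \<in> {..<5}" for j
      using that k1 past unfolding five by (elim insertE emptyE) (auto simp: G_def inputs_def)
    show "disjoint_family_on G {..<5}"
      using k unfolding five disjoint_family_on_def by (auto simp: G_def past_def)
    show "F j \<in> sets (gen (G j))" if "j \<in> {..<5}" for j
      using that assms unfolding five by (auto simp: G_def F_def)
  qed (simp_all add: five)
  thus ?thesis unfolding five by (simp add: F_def Int_assoc)
qed

abbreviation "edges n \<omega> \<equiv> edges_upto (\<lambda>k. dM k \<omega>) n"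
abbreviation "V n \<omega> \<equiv> node_count (\<lambda>k. B k \<omega>) (edges n \<omega>)"
abbreviation "deg n \<omega> \<equiv> batch_deg s \<delta> (\<lambda>k. B k \<omega>) (\<lambda>k v. t k v \<omega>) (\<lambda>k. dM k \<omega>) n"
abbreviation "J n k \<omega> \<equiv> attach (\<lambda>v. t k v \<omega>) \<delta> (deg n \<omega>) (nodes (\<lambda>k. B k \<omega>) (\<lambda>k. dM k \<omega>) n)"

lemmas measurable_edges [measurable] = measurable_edges_upto[OF measurable_coin measurable_batch measurable_clock]
lemmas measurable_V [measurable] = measurable_node_count[OF measurable_coin measurable_batch measurable_clock]

text \<open>The history takes countably many values, so conditioning on it amounts to splitting expectations
  along the events on which it is constant.\<close>

definition hist :: "nat \<Rightarrow> 'a \<Rightarrow> nat \<times> nat list" where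
  "hist n \<omega> = (edges n \<omega>, map (deg n \<omega>) [1..<Suc (V n \<omega>)])"

lemma hist_eq_iff: "hist n \<omega> = (K, xs) \<longleftrightarrow> edges n \<omega> = K \<and> V n \<omega> = length xs
    \<and> (\<forall>v\<in>{1..length xs}. deg n \<omega> v = xs ! (v - 1))"
proof -
  have eq: "(\<forall>v\<in>{1..length xs}. deg n \<omega> v = xs ! (v - 1)) \<longleftrightarrow> (\<forall>i<length xs. deg n \<omega> (Suc i) = xs ! i)"
    unfolding image_Suc_lessThan[symmetric] by auto
  show ?thesis
    unfolding hist_def prod.inject list_eq_iff_nth_eq eq by (auto simp del: upt_Suc)
qed

text \<open>The model is run on inputs set to 0 beyond \<open>n\<close> and \<open>K\<close>, which
  makes it measurable with respect to the past. Where the number of edges is \<open>K\<close>, it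
  agrees with the true model by \<open>batch_deg_cong\<close>.\<close>

lemma hist_events_gen: "{\<omega> \<in> space M. hist n \<omega> = (K, xs)} \<in> sets (gen (past n K))"
proof -
  define b where "b k \<omega> = (if k \<le> K then B k \<omega> else 0)" for k \<omega>
  define d where "d k \<omega> = (if k \<le> n then dM k \<omega> else 0)" for k \<omega>
  define u where "u k v \<omega> = (if k \<le> K then t k v \<omega> else 0)" for k v \<omega>
  have b: "b k \<in> measurable (gen (past n K)) (count_space UNIV)" if "k \<ge> 1" for k
    unfolding b_def[abs_def] using that by (cases "k \<le> K") (auto simp: past_def intro!: coin_gen)
  have d: "d k \<in> measurable (gen (past n K)) (count_space UNIV)" if "k \<ge> 1" for k
    unfolding d_def[abs_def] using that by (cases "k \<le> n") (auto simp: past_def intro!: batch_gen)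
  have u: "u k v \<in> borel_measurable (gen (past n K))" if "k \<ge> 1" "v \<ge> 1" for k v
    unfolding u_def[abs_def] using that by (cases "k \<le> K") (auto simp: past_def intro!: clock_gen)
  note [measurable] = measurable_edges_upto[OF b d u] measurable_node_count[OF b d u] measurable_batch_deg[OF b d u]
  let ?e = "\<lambda>\<omega>. edges_upto (\<lambda>k. d k \<omega>) n"
  let ?b = "\<lambda>\<omega>. batch_deg s \<delta> (\<lambda>k. b k \<omega>) (\<lambda>k v. u k v \<omega>) (\<lambda>k. d k \<omega>) n"
  have eq: "hist n \<omega> = (K, xs) \<longleftrightarrow> ?e \<omega> = K \<and> node_count (\<lambda>k. b k \<omega>) (?e \<omega>) = length xs
    \<and> (\<forall>v\<in>{1..length xs}. ?b \<omega> v = xs ! (v - 1))" for \<omega>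
  proof (cases "edges n \<omega> = K")
    case True
    have "edges n \<omega> = ?e \<omega> \<and> nodes (\<lambda>k. B k \<omega>) (\<lambda>k. dM k \<omega>) n = nodes (\<lambda>k. b k \<omega>) (\<lambda>k. d k \<omega>) n \<and> deg n \<omega> = ?b \<omega>"
      by (rule batch_deg_cong) (auto simp: True b_def d_def u_def)
    moreover have "node_count (\<lambda>k. b k \<omega>) K = node_count (\<lambda>k. B k \<omega>) K"
      by (simp add: node_count_def b_def)
    ultimately show ?thesis unfolding hist_eq_iff True by auto
  next
    case False
    \<comment> \<open>Batch sizes up to \<open>n\<close> are kept unchanged, so the truncated model
      also recognises that the number of edges is not \<open>K\<close>.\<close>
    moreover have "?e \<omega> = edges n \<omega>"
      by (simp add: edges_upto_def d_def)
    ultimately show ?thesis by (simp add: hist_eq_iff)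
  qed
  have m: "{\<omega> \<in> space (gen (past n K)). ?e \<omega> = K \<and> node_count (\<lambda>k. b k \<omega>) (?e \<omega>) = length xs
    \<and> (\<forall>v\<in>{1..length xs}. ?b \<omega> v = xs ! (v - 1))} \<in> sets (gen (past n K))"
    by measurable
  have e: "{\<omega> \<in> space M. hist n \<omega> = (K, xs)} =
     {\<omega> \<in> space (gen (past n K)). ?e \<omega> = K \<and> node_count (\<lambda>k. b k \<omega>) (?e \<omega>) = length xs
       \<and> (\<forall>v\<in>{1..length xs}. ?b \<omega> v = xs ! (v - 1))}"
    unfolding space_gen by (rule Collect_cong, rule conj_cong[OF refl eq])
  show ?thesis unfolding e by (rule m)
qed

lemma measurable_hist [measurable]: "hist n \<in> measurable M (count_space UNIV)"
proof (rule measurableI)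
  fix H :: "(nat \<times> nat list) set"
  have "hist n -` {h} \<inter> space M \<in> events" for h
  proof (cases h)
    case (Pair K xs)
    have "past n K \<subseteq> inputs" by (auto simp: past_def inputs_def)
    with hist_events_gen[of n K xs] sets_gen_events[of "past n K"] Pair show ?thesis
      by (auto simp: vimage_def Int_def conj_commute)
  qed
  hence "(\<Union>h\<in>H. hist n -` {h} \<inter> space M) \<in> events"
    by (intro sets.countable_UN'') auto
  moreover have "hist n -` H \<inter> space M = (\<Union>h\<in>H. hist n -` {h} \<inter> space M)" by blast
  ultimately show "hist n -` H \<inter> space M \<in> events" by simp
qed simp

section \<open>Moments of the batch size\<close>

definition batch_prob :: "nat \<Rightarrow> real" where
  "batch_prob j = (if j = 0 then 0 else exp (- lam) * lam ^ (j - 1) / fact (j - 1))"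

text \<open>A batch size is 1 plus a Poisson variable, so sums against its law are exponential-type
  series in \<open>j - 1\<close>.\<close>

lemma batch_prob_sums: "(\<lambda>i. f i * (lam ^ i / fact i)) sums S \<Longrightarrow>
   (\<lambda>j. f (j - 1) * batch_prob j) sums (exp (- lam) * S)"
  using sums_mult[of "\<lambda>i. f i * (lam ^ i / fact i)" S "exp (- lam)"]
    sums_Suc[of "\<lambda>j. f (j - 1) * batch_prob j" "exp (- lam) * S"]
  by (simp add: batch_prob_def mult_ac)

lemma pow_fact_sums: "(\<lambda>i. x ^ i / fact i) sums exp (x::real)"
  using exp_converges[of x] by (simp add: divide_inverse mult.commute)

lemma sums_batch_prob: "batch_prob sums 1"
  using batch_prob_sums[of "\<lambda>_. 1" "exp lam"] pow_fact_sums[of lam] by (simp add: exp_minus)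

text \<open>The hypotheses give the law for sizes from 1 on only. These masses already sum to 1, so
  size 0 has probability 0.\<close>

lemma prob_batch:
  assumes "k \<ge> 1"
  shows "prob {\<omega> \<in> space M. dM k \<omega> = j} = batch_prob j"
proof (cases "j = 0")
  case False
  thus ?thesis using batch[OF assms, of j] by (simp add: batch_prob_def)
next
  case True
  have [measurable]: "dM k \<in> measurable M (count_space UNIV)" by (rule measurable_batch[OF assms])
  have "(\<lambda>j. prob {\<omega> \<in> space M. dM k \<omega> = j}) sums prob (\<Union>j. {\<omega> \<in> space M. dM k \<omega> = j})"
    by (rule finite_measure_UNION) (auto simp: disjoint_family_on_def)
  moreover have "(\<Union>j. {\<omega> \<in> space M. dM k \<omega> = j}) = space M" by auto
  ultimately have *: "(\<lambda>j. prob {\<omega> \<in> space M. dM k \<omega> = j}) sums 1" by (simp add: prob_space)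
  have "(\<lambda>j. prob {\<omega> \<in> space M. dM k \<omega> = j} - batch_prob j) sums (1 - 1)"
    by (rule sums_diff[OF * sums_batch_prob])
  moreover have "(\<lambda>j. prob {\<omega> \<in> space M. dM k \<omega> = j} - batch_prob j) =
     (\<lambda>j. if j = 0 then prob {\<omega> \<in> space M. dM k \<omega> = 0} else 0)"
    using batch[OF assms] by (auto simp: batch_prob_def fun_eq_iff)
  ultimately have "(\<lambda>j::nat. if j = 0 then prob {\<omega> \<in> space M. dM k \<omega> = 0} else 0) sums 0" by simp
  hence "prob {\<omega> \<in> space M. dM k \<omega> = 0} = 0"
    using sums_single[of 0 "\<lambda>_. prob {\<omega> \<in> space M. dM k \<omega> = 0}"] sums_unique2 by blast
  thus ?thesis using True by (simp add: batch_prob_def)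
qed

text \<open>Nonnegativity of \<open>f\<close> allows termwise integration over the values of
  \<open>dM k\<close>, so integrability and the value come out together. In the uses,
  \<open>c\<close> is the probability of \<open>A\<close>.\<close>

lemma
  fixes f :: "nat \<Rightarrow> real"
  assumes k: "k \<ge> 1" and A: "A \<in> events" and f: "\<And>j. f j \<ge> 0" and c: "c \<ge> 0"
    and AD: "\<And>j. prob (A \<inter> {\<omega> \<in> space M. dM k \<omega> = j}) = c * batch_prob j"
    and S: "(\<lambda>j. f j * batch_prob j) sums S"
  shows integrable_batch: "integrable M (\<lambda>\<omega>. indicator A \<omega> * f (dM k \<omega>))"
    and expectation_batch: "expectation (\<lambda>\<omega>. indicator A \<omega> * f (dM k \<omega>)) = c * S"
proof -
  have [measurable]: "dM k \<in> measurable M (count_space UNIV)" by (rule measurable_batch[OF k])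
  note [measurable] = A
  have bp: "batch_prob j \<ge> 0" for j using lam by (simp add: batch_prob_def)
  have "(\<integral>\<^sup>+\<omega>. ennreal (indicator A \<omega> * f (dM k \<omega>)) \<partial>M)
      = (\<integral>\<^sup>+\<omega>. (\<Sum>j. ennreal (f j) * indicator (A \<inter> {\<omega> \<in> space M. dM k \<omega> = j}) \<omega>) \<partial>M)"
  proof (rule nn_integral_cong)
    fix \<omega> assume \<omega>: "\<omega> \<in> space M"
    have "(\<lambda>j. ennreal (f j) * indicator (A \<inter> {\<omega> \<in> space M. dM k \<omega> = j}) \<omega>) =
       (\<lambda>j. if j = dM k \<omega> then ennreal (f j) * indicator A \<omega> else 0)"
      using \<omega> by (auto simp: fun_eq_iff indicator_def)
    hence "(\<Sum>j. ennreal (f j) * indicator (A \<inter> {\<omega> \<in> space M. dM k \<omega> = j}) \<omega>) = ennreal (f (dM k \<omega>)) * indicator A \<omega>"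
      using sums_single[of "dM k \<omega>" "\<lambda>j. ennreal (f j) * indicator A \<omega>"] by (simp add: sums_iff)
    thus "ennreal (indicator A \<omega> * f (dM k \<omega>)) = (\<Sum>j. ennreal (f j) * indicator (A \<inter> {\<omega> \<in> space M. dM k \<omega> = j}) \<omega>)"
      by (auto simp: indicator_def)
  qed
  also have "\<dots> = (\<Sum>j. \<integral>\<^sup>+\<omega>. ennreal (f j) * indicator (A \<inter> {\<omega> \<in> space M. dM k \<omega> = j}) \<omega> \<partial>M)"
    by (rule nn_integral_suminf) measurable
  also have "\<dots> = (\<Sum>j. ennreal (c * (f j * batch_prob j)))"
    by (subst nn_integral_cmult_indicator)
       (simp_all add: emeasure_eq_measure AD f c bp mult_ac flip: ennreal_mult)
  also have "\<dots> = ennreal (c * S)"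
    using sums_mult[OF S, of c] f c bp by (intro suminf_ennreal_eq) auto
  finally have *: "(\<integral>\<^sup>+\<omega>. ennreal (indicator A \<omega> * f (dM k \<omega>)) \<partial>M) = ennreal (c * S)" .
  have "S \<ge> 0" using S f bp by (intro sums_le[OF _ sums_zero S]) auto
  hence "integrable M (\<lambda>\<omega>. indicator A \<omega> * f (dM k \<omega>)) \<and> expectation (\<lambda>\<omega>. indicator A \<omega> * f (dM k \<omega>)) = c * S"
    using * f c by (subst nn_integral_eq_integrable[symmetric]) (auto simp: indicator_def)
  thus "integrable M (\<lambda>\<omega>. indicator A \<omega> * f (dM k \<omega>))"
    and "expectation (\<lambda>\<omega>. indicator A \<omega> * f (dM k \<omega>)) = c * S" by auto
qed

lemma batch_mean_sums: "(\<lambda>j. real j * batch_prob j) sums (1 + lam)"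
proof -
  have "(\<lambda>i. real i * (lam ^ i / fact i)) sums (lam * exp lam)"
  proof -
    have "real (Suc i) * (lam ^ Suc i / fact (Suc i)) = lam * (lam ^ i / fact i)" for i
      by (simp del: of_nat_Suc)
    hence "(\<lambda>i. real (Suc i) * (lam ^ Suc i / fact (Suc i))) sums (lam * exp lam)"
      using sums_mult[OF pow_fact_sums, of lam lam] by simp
    from sums_Suc[OF this] show ?thesis by simp
  qed
  from sums_add[OF this pow_fact_sums[of lam]]
  have "(\<lambda>i. real (i + 1) * (lam ^ i / fact i)) sums (lam * exp lam + exp lam)"
    by (simp add: algebra_simps add_divide_distrib)
  from batch_prob_sums[OF this]
  have "(\<lambda>j. real (j - 1 + 1) * batch_prob j) sums (exp (- lam) * (lam * exp lam + exp lam))" .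
  moreover have "(\<lambda>j. real (j - 1 + 1) * batch_prob j) = (\<lambda>j. real j * batch_prob j)"
    by (auto simp: fun_eq_iff batch_prob_def)
  moreover have "exp (- lam) * (lam * exp lam + exp lam) = (1 + lam) * (exp lam * exp (- lam))"
    by (simp only: ring_distribs mult_1 mult_1_right ac_simps)
  ultimately show ?thesis by (simp only: exp_minus_inverse mult_1_right)
qed

text \<open>One exponential moment dominates all polynomial ones, with bounds that do not depend on
  the step.\<close>

lemma batch_exp_summable: "summable (\<lambda>j. exp (real j) * batch_prob j)"
proof -
  have "(\<lambda>i. exp (real (i + 1)) * (lam ^ i / fact i)) = (\<lambda>i. exp 1 * ((exp 1 * lam) ^ i / fact i))"
    by (simp add: fun_eq_iff exp_add power_mult_distrib flip: exp_of_nat_mult)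
  hence "(\<lambda>i. exp (real (i + 1)) * (lam ^ i / fact i)) sums (exp 1 * exp (exp 1 * lam))"
    using sums_mult[OF pow_fact_sums] by simp
  from batch_prob_sums[OF this]
  have "summable (\<lambda>j. exp (real (j - 1 + 1)) * batch_prob j)" by (simp add: sums_iff)
  moreover have "(\<lambda>j. exp (real (j - 1 + 1)) * batch_prob j) = (\<lambda>j. exp (real j) * batch_prob j)"
    by (auto simp: fun_eq_iff batch_prob_def)
  ultimately show ?thesis by (simp only:)
qed

lemma integrable_batch_power:
  assumes k: "k \<ge> 1"
  shows "integrable M (\<lambda>\<omega>. real (dM k \<omega>) ^ r)"
proof -
  have [measurable]: "dM k \<in> measurable M (count_space UNIV)" by (rule measurable_batch[OF k])
  have "integrable M (\<lambda>\<omega>. indicator (space M) \<omega> * exp (real (dM k \<omega>)))"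
    by (rule integrable_batch[OF k, where c = 1])
       (use batch_exp_summable prob_batch[OF k] in \<open>auto simp: sums_iff Int_absorb1\<close>)
  hence "integrable M (\<lambda>\<omega>. fact r * (indicator (space M) \<omega> * exp (real (dM k \<omega>))))"
    by (rule integrable_mult_right)
  thus ?thesis
  proof (rule Bochner_Integration.integrable_bound)
    \<comment> \<open>The left-hand side is a single term of the exponential series.\<close>
    have "real n ^ r / fact r \<le> exp (real n)" for n
      using exp_ge_add_one_self[of "real n"] sums_le[OF _ sums_If_finite_set[of "{r}" "\<lambda>i. real n ^ i / fact i"] pow_fact_sums[of "real n"]]
      by auto
    thus "AE \<omega> in M. norm (real (dM k \<omega>) ^ r) \<le> norm (fact r * (indicator (space M) \<omega> * exp (real (dM k \<omega>))))"
      by (intro AE_I2) (simp add: pos_divide_le_eq mult.commute)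
  qed measurable
qed

lemma AE_good: "AE \<omega> in M. good_input s (\<lambda>k. B k \<omega>) (\<lambda>k. dM k \<omega>)"
proof -
  have "AE \<omega> in M. k \<ge> 1 \<longrightarrow> B k \<omega> \<in> {0, 1}" for k
  proof (cases "k \<ge> 1")
    case True
    note [measurable] = measurable_coin[OF True]
    have "prob ({\<omega> \<in> space M. B k \<omega> = 0} \<union> {\<omega> \<in> space M. B k \<omega> = 1}) = 1"
      using coin_0[OF True] coin_1[OF True] by (subst finite_measure_Union) auto
    hence "AE \<omega> in M. \<omega> \<in> {\<omega> \<in> space M. B k \<omega> = 0} \<union> {\<omega> \<in> space M. B k \<omega> = 1}"
      by (subst (asm) prob_eq_1) auto
    thus ?thesis by eventually_elim auto
  qed simp
  hence 1: "AE \<omega> in M. \<forall>k. k \<ge> 1 \<longrightarrow> B k \<omega> \<in> {0, 1}" by (simp add: AE_all_countable)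
  have "AE \<omega> in M. k \<ge> 1 \<longrightarrow> dM k \<omega> \<ge> 1" for k
  proof (cases "k \<ge> 1")
    case True
    note [measurable] = measurable_batch[OF True]
    have "AE \<omega> in M. \<not> dM k \<omega> = 0"
      using prob_batch[OF True, of 0] by (subst AE_iff_measurable[OF _ refl]) (auto simp: emeasure_eq_measure batch_prob_def)
    thus ?thesis by eventually_elim auto
  qed simp
  hence 2: "AE \<omega> in M. \<forall>k. k \<ge> 1 \<longrightarrow> dM k \<omega> \<ge> 1" by (simp add: AE_all_countable)
  from 1 2 show ?thesis by eventually_elim (unfold_locales; use s in auto)
qed

lemma L2_batch: "L2 (\<lambda>\<omega>. real (dM (Suc n) \<omega>))"
  unfolding L2_def using integrable_batch_power[of "Suc n" 2] measurable_batch[of "Suc n"]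
  by (auto intro: measurable_compose)

lemma L2_batch_square: "L2 (\<lambda>\<omega>. (real (dM (Suc n) \<omega>))\<^sup>2)"
  unfolding L2_def using integrable_batch_power[of "Suc n" 4] measurable_batch[of "Suc n"]
  by (auto intro: measurable_compose simp flip: power_mult)

lemma L2_edges: "L2 (\<lambda>\<omega>. real (edges n \<omega>))"
proof (induction n)
  case (Suc n)
  thus ?case using L2_add[OF Suc L2_batch[of n]] by simp
qed simp

lemma AE_V_le: "AE \<omega> in M. real (V n \<omega>) \<le> real (edges n \<omega>) + 1"
  using AE_good
proof eventually_elim
  case (elim \<omega>)
  interpret g: good_input s \<delta> "\<lambda>k. B k \<omega>" "\<lambda>k v. t k v \<omega>" "\<lambda>k. dM k \<omega>" by (rule elim)
  show ?case using g.node_count_le[of "edges n \<omega>"] by simp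
qed

lemma L2_V: "L2 (\<lambda>\<omega>. real (V n \<omega>))"
proof (rule L2_bound[OF L2_add[OF L2_edges L2_const]])
  show "AE \<omega> in M. \<bar>real (V n \<omega>)\<bar> \<le> \<bar>real (edges n \<omega>) + 1\<bar>"
    using AE_V_le[of n] by eventually_elim simp
qed measurable

section \<open>Quantities computed from a value of the history\<close>

definition hdeg :: "nat \<times> nat list \<Rightarrow> nat \<Rightarrow> nat" where
  "hdeg h v = snd h ! (v - 1)"

definition hnodes :: "nat \<times> nat list \<Rightarrow> nat" where
  "hnodes h = length (snd h)"

definition hcount :: "nat \<times> nat list \<Rightarrow> nat \<Rightarrow> real" where
  "hcount h m = real (deg_count (hnodes h) (hdeg h) m)"

definition hweight :: "nat \<times> nat list \<Rightarrow> real" where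
  "hweight h = (\<Sum>v=1..hnodes h. real (hdeg h v) + \<delta>)"

lemma
  shows fst_hist [simp]: "fst (hist n \<omega>) = edges n \<omega>"
    and hnodes_hist [simp]: "hnodes (hist n \<omega>) = V n \<omega>"
    and hdeg_hist: "v \<in> {1..V n \<omega>} \<Longrightarrow> hdeg (hist n \<omega>) v = deg n \<omega> v"
  using hist_eq_iff[of n \<omega> "fst (hist n \<omega>)" "snd (hist n \<omega>)"]
  by (auto simp: hnodes_def hdeg_def)

lemma hcount_hist: "hcount (hist n \<omega>) m = real (deg_count (V n \<omega>) (deg n \<omega>) m)"
  unfolding hcount_def hnodes_hist by (intro arg_cong[where f = real] deg_count_cong) (simp add: hdeg_hist)

lemma hcount_nonneg: "hcount h m \<ge> 0" and hcount_le: "hcount h m \<le> hnodes h"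
  by (simp_all add: hcount_def deg_count_le)

lemma hweight_ge: "hweight h \<ge> \<delta> * hnodes h"
proof -
  have "(\<Sum>v=1..hnodes h. \<delta>) \<le> hweight h" unfolding hweight_def by (intro sum_mono) simp
  thus ?thesis by (simp add: mult.commute)
qed

text \<open>The formula is the count of total degree in \<open>sum_deg\<close>. The lower bound
  holds because every batch has at least one edge; it makes \<open>n + 1\<close> comparable with the
  weight.\<close>

lemma AE_hweight: "AE \<omega> in M. hweight (hist n \<omega>) = 1 + real (edges n \<omega>) + \<delta> * V n \<omega>
    \<and> real n + 1 \<le> hweight (hist n \<omega>)"
  using AE_good
proof eventually_elim
  case (elim \<omega>)
  interpret g: good_input s \<delta> "\<lambda>k. B k \<omega>" "\<lambda>k v. t k v \<omega>" "\<lambda>k. dM k \<omega>" by (rule elim)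
  have "hweight (hist n \<omega>) = real (\<Sum>v=1..V n \<omega>. deg n \<omega> v) + \<delta> * V n \<omega>"
    unfolding hweight_def hnodes_hist by (simp add: hdeg_hist sum.distrib)
  also have "real (\<Sum>v=1..V n \<omega>. deg n \<omega> v) = 1 + real (edges n \<omega>)"
    unfolding g.sum_deg by simp
  finally show ?case using g.edges_upto_ge[of n] \<delta> by (simp add: add_increasing2)
qed

text \<open>Fixing the batch size along with the history makes the set of edge numbers in the next
  batch deterministic.\<close>

definition atom :: "nat \<Rightarrow> nat \<times> nat list \<Rightarrow> nat \<Rightarrow> 'a set" where
  "atom n h d = {\<omega> \<in> space M. hist n \<omega> = h} \<inter> {\<omega> \<in> space M. dM (Suc n) \<omega> = d}"

lemma measurable_batch_Suc [measurable]: "dM (Suc n) \<in> measurable M (count_space UNIV)"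
  by (rule measurable_batch) simp

lemma atom_events [measurable]: "atom n h d \<in> events"
  unfolding atom_def by measurable

lemma batch_event_gen: "{\<omega> \<in> space M. dM (Suc n) \<omega> = d} \<in> sets (gen {Batch (Suc n)})"
  using measurable_sets[OF batch_gen[of "Suc n" "{Batch (Suc n)}"], of "{d}"]
  by (simp add: vimage_def Int_def conj_commute)

lemma coin_event_gen: "{\<omega> \<in> space M. B k \<omega> \<in> S} \<in> sets (gen {Coin k})"
  using measurable_sets[OF coin_gen[of k "{Coin k}"], of S]
  by (simp add: vimage_def Int_def conj_commute)

text \<open>The target of edge \<open>k\<close> with the random state replaced by a fixed value
  \<open>h\<close>, so that only the clocks of that edge remain random.\<close>

definition hattach :: "nat \<times> nat list \<Rightarrow> nat \<Rightarrow> 'a \<Rightarrow> nat" where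
  "hattach h k \<omega> = attach (\<lambda>v. t k v \<omega>) \<delta> (hdeg h) {1..hnodes h}"

lemma hattach_event_gen:
  "{\<omega> \<in> space M. hattach h k \<omega> \<in> S} \<in> sets (gen {In_Clock k v | v. v \<ge> 1})"
proof -
  let ?N = "gen {In_Clock k v | v. v \<ge> 1}"
  have "hattach h k \<in> measurable ?N (count_space UNIV)"
    unfolding hattach_def attach_def
  proof (rule measurable_arg_min_on)
    fix v assume "v \<in> {1..hnodes h}"
    hence [measurable]: "t k v \<in> borel_measurable ?N" by (intro clock_gen) auto
    show "(\<lambda>\<omega>. t k v \<omega> / (real (hdeg h v) + \<delta>)) \<in> borel_measurable ?N" by measurable
  qed simp
  from measurable_sets[OF this, of S] show ?thesis
    by (simp add: vimage_def Int_def conj_commute)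
qed

lemma prob_hattach:
  assumes "k \<ge> 1" "hnodes h > 0" "S \<subseteq> {1..hnodes h}"
  shows "prob {\<omega> \<in> space M. hattach h k \<omega> \<in> S} = (\<Sum>v\<in>S. real (hdeg h v) + \<delta>) / hweight h"
  unfolding hattach_def hweight_def
proof (rule prob_attach[OF _ _ assms(3) \<delta>])
  show "indep_vars (\<lambda>_. borel) (t k) {1..hnodes h}"
  proof -
    have "indep_vars (\<lambda>_. borel) (input_var B t dM) (In_Clock k ` {1..hnodes h})"
      by (rule indep_vars_subset[OF indep]) (use assms(1) in \<open>auto simp: inputs_def\<close>)
    hence "indep_vars (\<lambda>_. borel) (\<lambda>v. input_var B t dM (In_Clock k v)) {1..hnodes h}"
      by (rule indep_vars_reindex) (auto simp: inj_on_def)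
    thus ?thesis by (simp add: input_var_def[abs_def])
  qed
qed (use assms clock in auto)

lemma J_eq_hattach: "J n k \<omega> = hattach (hist n \<omega>) k \<omega>"
  unfolding hattach_def nodes_eq hnodes_hist by (rule attach_cong) (auto simp: hdeg_hist)

lemma hist_pos: "atom n h d \<noteq> {} \<Longrightarrow> hnodes h > 0"
  by (auto simp: atom_def node_count_pos[THEN gr_implies_not0])

text \<open>\<open>prob_step\<close> is used twice. With the whole space in the last three blocks it
  factors the probability of the atom itself, which turns the other factorisation into conditional
  independence given the atom.\<close>

lemma prob_atom_step:
  assumes k: "fst h < k" "fst h < l" "k \<noteq> l"
    and E1: "E1 \<in> sets (gen {Coin k})" and E2: "E2 \<in> sets (gen {In_Clock k v | v. v \<ge> 1})"
    and E3: "E3 \<in> sets (gen {In_Clock l v | v. v \<ge> 1})"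
  shows "prob (atom n h d \<inter> E1 \<inter> E2 \<inter> E3) = prob (atom n h d) * prob E1 * prob E2 * prob E3"
proof -
  obtain K xs where h: "h = (K, xs)" by (cases h)
  let ?A = "{\<omega> \<in> space M. hist n \<omega> = h}" and ?D = "{\<omega> \<in> space M. dM (Suc n) \<omega> = d}"
  have A: "?A \<in> sets (gen (past n K))" unfolding h by (rule hist_events_gen)
  note step = prob_step[OF A batch_event_gen _ _ k(3)]
  have T: "space M \<in> sets (gen G)" for G using sets.top[of "gen G"] by simp
  have sub: "X \<inter> space M = X" if "X \<subseteq> space M" for X using that by blast
  have "prob (?A \<inter> ?D \<inter> space M \<inter> space M \<inter> space M) = prob ?A * prob ?D * prob (space M) * prob (space M) * prob (space M)"
    using k by (intro step T) (auto simp: h)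
  moreover have "?A \<inter> ?D \<inter> space M \<inter> space M \<inter> space M = atom n h d"
    by (auto simp: atom_def)
  ultimately have "prob (atom n h d) = prob ?A * prob ?D" by (simp add: prob_space)
  moreover have "prob (?A \<inter> ?D \<inter> E1 \<inter> E2 \<inter> E3) = prob ?A * prob ?D * prob E1 * prob E2 * prob E3"
    using k by (intro step E1 E2 E3) (auto simp: h)
  ultimately show ?thesis by (simp add: atom_def)
qed

lemma prob_hist_batch:
  "prob ({\<omega> \<in> space M. hist n \<omega> = h} \<inter> {\<omega> \<in> space M. dM (Suc n) \<omega> = d})
     = prob {\<omega> \<in> space M. hist n \<omega> = h} * batch_prob d"
proof -
  obtain K xs where h: "h = (K, xs)" by (cases h)
  let ?A = "{\<omega> \<in> space M. hist n \<omega> = h}" and ?D = "{\<omega> \<in> space M. dM (Suc n) \<omega> = d}"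
  have A: "?A \<in> sets (gen (past n K))" unfolding h by (rule hist_events_gen)
  have T: "space M \<in> sets (gen G)" for G using sets.top[of "gen G"] by simp
  have "prob (?A \<inter> ?D \<inter> space M \<inter> space M \<inter> space M) = prob ?A * prob ?D * prob (space M) * prob (space M) * prob (space M)"
    by (rule prob_step[OF A batch_event_gen, of "K + 1" "K + 2"]) (use T in auto)
  moreover have "?A \<inter> ?D \<inter> space M \<inter> space M \<inter> space M = ?A \<inter> ?D" by auto
  ultimately show ?thesis using prob_batch[of "Suc n" d] by (simp add: prob_space)
qed

lemma measurable_of_hist [measurable]:
  "(\<lambda>\<omega>. \<psi> (hist n \<omega>)) \<in> borel_measurable M" for \<psi> :: "_ \<Rightarrow> real"
  by (rule measurable_compose[OF measurable_hist]) simp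

lemma expectation_hist_batch:
  fixes \<psi> :: "nat \<times> nat list \<Rightarrow> real"
  assumes "L2 (\<lambda>\<omega>. \<psi> (hist n \<omega>))"
  shows "expectation (\<lambda>\<omega>. \<psi> (hist n \<omega>) * dM (Suc n) \<omega>) = (1 + lam) * expectation (\<lambda>\<omega>. \<psi> (hist n \<omega>))"
proof -
  have "expectation (\<lambda>\<omega>. \<psi> (hist n \<omega>) * dM (Suc n) \<omega>) = expectation (\<lambda>\<omega>. (1 + lam) * \<psi> (hist n \<omega>))"
  proof (rule expectation_eq_of_atoms[where H = "hist n"])
    show "integrable M (\<lambda>\<omega>. \<psi> (hist n \<omega>) * dM (Suc n) \<omega>)" by (rule L2_mult[OF assms L2_batch])
    show "integrable M (\<lambda>\<omega>. (1 + lam) * \<psi> (hist n \<omega>))" using L2_integrable[OF assms] by simp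
    fix h
    let ?A = "{\<omega> \<in> space M. hist n \<omega> = h}"
    have [measurable]: "?A \<in> events" by measurable
    have "(\<integral>\<omega>. indicator ?A \<omega> * (\<psi> (hist n \<omega>) * dM (Suc n) \<omega>) \<partial>M)
        = (\<integral>\<omega>. \<psi> h * (indicat_real ?A \<omega> * dM (Suc n) \<omega>) \<partial>M)"
      by (intro Bochner_Integration.integral_cong) (auto simp: indicator_def)
    also have "\<dots> = \<psi> h * (prob ?A * (1 + lam))"
      using expectation_batch[of "Suc n" ?A real "prob ?A", OF _ _ _ _ prob_hist_batch batch_mean_sums] by simp
    also have "\<dots> = (\<integral>\<omega>. ((1 + lam) * \<psi> h) * indicator ?A \<omega> \<partial>M)" by simp
    also have "\<dots> = (\<integral>\<omega>. indicator ?A \<omega> * ((1 + lam) * \<psi> (hist n \<omega>)) \<partial>M)"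
      by (intro Bochner_Integration.integral_cong) (auto simp: indicator_def)
    finally show "(\<integral>\<omega>. indicator ?A \<omega> * (\<psi> (hist n \<omega>) * dM (Suc n) \<omega>) \<partial>M) = \<dots>" .
  qed measurable
  thus ?thesis by simp
qed

text \<open>On an atom the index set is a fixed finite set and every event has the same conditional
  probability, so the conditional mean of the number of events is cardinality times probability. The
  index type is left open because both edges and pairs of edges are counted this way.\<close>

lemma
  fixes I :: "nat \<times> nat list \<Rightarrow> nat \<Rightarrow> 'i set" and U :: "'i \<Rightarrow> nat \<times> nat list \<Rightarrow> 'a set"
    and \<psi> \<pi> :: "nat \<times> nat list \<Rightarrow> real"
  assumes I: "\<And>h d. finite (I h d)"
    and U: "\<And>h d x. x \<in> I h d \<Longrightarrow> U x h \<in> events"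
    and pr: "\<And>h d x. x \<in> I h d \<Longrightarrow> atom n h d \<noteq> {} \<Longrightarrow> prob (atom n h d \<inter> U x h) = prob (atom n h d) * \<pi> h"
    and int: "integrable M (\<lambda>\<omega>. \<psi> (hist n \<omega>) * card (I (hist n \<omega>) (dM (Suc n) \<omega>)))"
    and \<pi>: "\<And>h. \<bar>\<pi> h\<bar> \<le> c"
  shows integrable_batch_sum: "integrable M (\<lambda>\<omega>. \<psi> (hist n \<omega>) *
      (\<Sum>x\<in>I (hist n \<omega>) (dM (Suc n) \<omega>). indicator (U x (hist n \<omega>)) \<omega>))" (is ?int)
    and expectation_batch_sum: "expectation (\<lambda>\<omega>. \<psi> (hist n \<omega>) *
      (\<Sum>x\<in>I (hist n \<omega>) (dM (Suc n) \<omega>). indicator (U x (hist n \<omega>)) \<omega>))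
    = expectation (\<lambda>\<omega>. \<psi> (hist n \<omega>) * card (I (hist n \<omega>) (dM (Suc n) \<omega>)) * \<pi> (hist n \<omega>))" (is ?eq)
proof -
  define S :: "nat \<times> nat list \<Rightarrow> nat \<Rightarrow> 'a \<Rightarrow> real" where "S h d \<omega> = (\<Sum>x\<in>I h d. indicator (U x h) \<omega>)" for h d \<omega>
  have S: "(\<lambda>\<omega>. S h d \<omega>) \<in> borel_measurable M" for h d
    unfolding S_def using U by (intro borel_measurable_sum borel_measurable_indicator) auto
  have mS [measurable]: "(\<lambda>\<omega>. S (hist n \<omega>) (dM (Suc n) \<omega>) \<omega>) \<in> borel_measurable M"
    by (rule measurable_compose_countable[OF measurable_compose_countable[OF S measurable_batch_Suc] measurable_hist])
  have [measurable]: "(\<lambda>\<omega>. real (card (I (hist n \<omega>) (dM (Suc n) \<omega>)))) \<in> borel_measurable M"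
    by (rule measurable_compose_countable[OF measurable_compose_countable[OF measurable_const measurable_batch_Suc] measurable_hist]) simp
  have S_le: "0 \<le> S h d \<omega>" "S h d \<omega> \<le> card (I h d)" for h d \<omega>
    unfolding S_def using sum_bounded_above[of "I h d" "\<lambda>x. indicator (U x h) \<omega> :: real" 1]
    by (auto intro!: sum_nonneg simp: indicator_def)
  have "integrable M (\<lambda>\<omega>. \<psi> (hist n \<omega>) * S (hist n \<omega>) (dM (Suc n) \<omega>) \<omega>)"
  proof (rule Bochner_Integration.integrable_bound[OF int])
    show "AE \<omega> in M. norm (\<psi> (hist n \<omega>) * S (hist n \<omega>) (dM (Suc n) \<omega>) \<omega>)
        \<le> norm (\<psi> (hist n \<omega>) * card (I (hist n \<omega>) (dM (Suc n) \<omega>)))"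
      by (intro AE_I2) (simp add: abs_mult S_le mult_left_mono)
  qed measurable
  thus int1: ?int by (simp add: S_def)
  have int2: "integrable M (\<lambda>\<omega>. \<psi> (hist n \<omega>) * card (I (hist n \<omega>) (dM (Suc n) \<omega>)) * \<pi> (hist n \<omega>))"
  proof (rule Bochner_Integration.integrable_bound[OF integrable_mult_right[OF int, of c]])
    show "AE \<omega> in M. norm (\<psi> (hist n \<omega>) * card (I (hist n \<omega>) (dM (Suc n) \<omega>)) * \<pi> (hist n \<omega>))
        \<le> norm (c * (\<psi> (hist n \<omega>) * card (I (hist n \<omega>) (dM (Suc n) \<omega>))))"
      using order_trans[OF \<pi> abs_ge_self] by (intro AE_I2) (simp add: abs_mult mult.commute[of "\<bar>c\<bar>"] mult_left_mono)
  qed measurable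
  show ?eq
  proof (rule expectation_eq_of_atoms[where H = "\<lambda>\<omega>. (hist n \<omega>, dM (Suc n) \<omega>)", OF _ int1 int2])
    show "(\<lambda>\<omega>. (hist n \<omega>, dM (Suc n) \<omega>)) \<in> measurable M (count_space UNIV)"
      by (rule measurable_count_space_op[where h = Pair, OF measurable_hist measurable_batch_Suc])
    fix hd :: "(nat \<times> nat list) \<times> nat"
    obtain h d where hd: "hd = (h, d)" by (cases hd)
    have A: "{\<omega> \<in> space M. (hist n \<omega>, dM (Suc n) \<omega>) = hd} = atom n h d"
      by (auto simp: atom_def hd)
    have "(\<integral>\<omega>. indicator (atom n h d) \<omega> * (\<psi> (hist n \<omega>) * (\<Sum>x\<in>I (hist n \<omega>) (dM (Suc n) \<omega>). indicator (U x (hist n \<omega>)) \<omega>)) \<partial>M)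
       = (\<integral>\<omega>. \<psi> h * (\<Sum>x\<in>I h d. indicator (atom n h d \<inter> U x h) \<omega>) \<partial>M)"
      by (intro Bochner_Integration.integral_cong) (auto simp: indicator_def atom_def)
    also have "\<dots> = \<psi> h * (\<Sum>x\<in>I h d. prob (atom n h d \<inter> U x h))"
      using U by (simp add: integrable_real_indicator emeasure_eq_measure)
    also have "(\<Sum>x\<in>I h d. prob (atom n h d \<inter> U x h)) = (\<Sum>x\<in>I h d. prob (atom n h d) * \<pi> h)"
    proof (intro sum.cong refl)
      fix x assume "x \<in> I h d"
      thus "prob (atom n h d \<inter> U x h) = prob (atom n h d) * \<pi> h"
        using pr[of x h d] by (cases "atom n h d = {}") auto
    qed
    also have "\<psi> h * \<dots> = (\<integral>\<omega>. (\<psi> h * card (I h d) * \<pi> h) * indicator (atom n h d) \<omega> \<partial>M)"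
      by simp
    also have "\<dots> = (\<integral>\<omega>. indicator (atom n h d) \<omega> * (\<psi> (hist n \<omega>) * card (I (hist n \<omega>) (dM (Suc n) \<omega>)) * \<pi> (hist n \<omega>)) \<partial>M)"
      by (intro Bochner_Integration.integral_cong) (auto simp: indicator_def atom_def)
    finally show "(\<integral>\<omega>. indicator {\<omega> \<in> space M. (hist n \<omega>, dM (Suc n) \<omega>) = hd} \<omega> *
         (\<psi> (hist n \<omega>) * (\<Sum>x\<in>I (hist n \<omega>) (dM (Suc n) \<omega>). indicator (U x (hist n \<omega>)) \<omega>)) \<partial>M)
       = (\<integral>\<omega>. indicator {\<omega> \<in> space M. (hist n \<omega>, dM (Suc n) \<omega>) = hd} \<omega> *
         (\<psi> (hist n \<omega>) * card (I (hist n \<omega>) (dM (Suc n) \<omega>)) * \<pi> (hist n \<omega>)) \<partial>M)"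
      unfolding A .
  qed
qed

lemma batch_moment: "expectation (\<lambda>\<omega>. real (dM (Suc n) \<omega>) ^ r) \<le> fact r * (\<Sum>j. exp (real j) * batch_prob j)"
proof -
  have sp: "prob (space M \<inter> {\<omega> \<in> space M. dM (Suc n) \<omega> = j}) = 1 * batch_prob j" for j
    using prob_batch[of "Suc n" j] by (simp add: Int_absorb1)
  note * = integrable_batch[of "Suc n" "space M" "\<lambda>j. exp (real j)" 1, OF _ _ _ _ sp summable_sums[OF batch_exp_summable]]
    expectation_batch[of "Suc n" "space M" "\<lambda>j. exp (real j)" 1, OF _ _ _ _ sp summable_sums[OF batch_exp_summable]]
  have "expectation (\<lambda>\<omega>. real (dM (Suc n) \<omega>) ^ r) \<le> expectation (\<lambda>\<omega>. fact r * (indicator (space M) \<omega> * exp (real (dM (Suc n) \<omega>))))"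
  proof (rule integral_mono)
    show "integrable M (\<lambda>\<omega>. real (dM (Suc n) \<omega>) ^ r)" by (rule integrable_batch_power) simp
    show "integrable M (\<lambda>\<omega>. fact r * (indicat_real (space M) \<omega> * exp (real (dM (Suc n) \<omega>))))"
      using *(1) by simp
    fix \<omega> assume "\<omega> \<in> space M"
    have "x ^ r / fact r \<le> exp x" if "x \<ge> 0" for x :: real
      using sums_le[OF _ sums_If_finite_set[of "{r}" "\<lambda>i. x ^ i / fact i"] pow_fact_sums[of x]] that
      by auto
    thus "real (dM (Suc n) \<omega>) ^ r \<le> fact r * (indicator (space M) \<omega> * exp (real (dM (Suc n) \<omega>)))"
      using \<open>\<omega> \<in> space M\<close> by (simp add: pos_divide_le_eq mult.commute)
  qed
  thus ?thesis using *(2) by simp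
qed

text \<open>The square of the batch size appears because collisions are counted by pairs; squaring
  again calls for the fourth moment. What matters is that \<open>C\<close> does not depend on
  \<open>n\<close>.\<close>

lemma batch_square_bound:
  obtains C where "\<And>\<Delta> n. L2 \<Delta> \<Longrightarrow> AE \<omega> in M. \<bar>\<Delta> \<omega>\<bar> \<le> K * (real (dM (Suc n) \<omega>))\<^sup>2
      \<Longrightarrow> expectation (\<lambda>\<omega>. (\<Delta> \<omega>)\<^sup>2) \<le> C"
proof
  fix \<Delta> n
  assume D: "L2 \<Delta>" and le: "AE \<omega> in M. \<bar>\<Delta> \<omega>\<bar> \<le> K * (real (dM (Suc n) \<omega>))\<^sup>2"
  have "expectation (\<lambda>\<omega>. (\<Delta> \<omega>)\<^sup>2) \<le> expectation (\<lambda>\<omega>. K\<^sup>2 * real (dM (Suc n) \<omega>) ^ 4)"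
  proof (rule integral_mono_AE[OF L2_square[OF D]])
    show "integrable M (\<lambda>\<omega>. K\<^sup>2 * real (dM (Suc n) \<omega>) ^ 4)" using integrable_batch_power[of "Suc n" 4] by simp
    show "AE \<omega> in M. (\<Delta> \<omega>)\<^sup>2 \<le> K\<^sup>2 * real (dM (Suc n) \<omega>) ^ 4"
      using le
    proof eventually_elim
      case (elim \<omega>)
      have "\<bar>\<Delta> \<omega>\<bar>\<^sup>2 \<le> (K * (real (dM (Suc n) \<omega>))\<^sup>2)\<^sup>2" using elim by (intro power_mono) auto
      thus ?case by (simp add: power_mult_distrib flip: power_mult)
    qed
  qed
  also have "\<dots> \<le> K\<^sup>2 * (fact 4 * (\<Sum>j. exp (real j) * batch_prob j))"
    using batch_moment[of n 4] by (simp add: mult_left_mono)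
  finally show "expectation (\<lambda>\<omega>. (\<Delta> \<omega>)\<^sup>2) \<le> K\<^sup>2 * (fact 4 * (\<Sum>j. exp (real j) * batch_prob j))" .
qed

lemma AE_batch_ge: "AE \<omega> in M. dM (Suc n) \<omega> \<ge> 1"
  using AE_good
proof eventually_elim
  case (elim \<omega>)
  interpret g: good_input s \<delta> "\<lambda>k. B k \<omega>" "\<lambda>k v. t k v \<omega>" "\<lambda>k. dM k \<omega>" by (rule elim)
  show ?case by (rule g.d) simp
qed

abbreviation "batch_edges n \<omega> \<equiv> {edges n \<omega> + 1..edges (Suc n) \<omega>}"

text \<open>Wald's identity for one batch: the number of edges has mean \<open>1 + lam\<close> given
  the history, and each hits with probability \<open>\<pi>\<close>.\<close>

lemma
  fixes U :: "nat \<Rightarrow> nat \<times> nat list \<Rightarrow> 'a set" and \<psi> \<pi> :: "nat \<times> nat list \<Rightarrow> real"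
  assumes U: "\<And>h k. fst h < k \<Longrightarrow> U k h \<in> events"
    and pr: "\<And>h d k. fst h < k \<Longrightarrow> atom n h d \<noteq> {} \<Longrightarrow> prob (atom n h d \<inter> U k h) = prob (atom n h d) * \<pi> h"
    and \<psi>: "L2 (\<lambda>\<omega>. \<psi> (hist n \<omega>))"
    and \<pi>: "\<And>h. \<bar>\<pi> h\<bar> \<le> c"
  shows integrable_batch_edges: "integrable M (\<lambda>\<omega>. \<psi> (hist n \<omega>) *
      (\<Sum>k\<in>batch_edges n \<omega>. indicator (U k (hist n \<omega>)) \<omega>))"
    and expectation_batch_edges: "expectation (\<lambda>\<omega>. \<psi> (hist n \<omega>) *
      (\<Sum>k\<in>batch_edges n \<omega>. indicator (U k (hist n \<omega>)) \<omega>))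
    = (1 + lam) * expectation (\<lambda>\<omega>. \<psi> (hist n \<omega>) * \<pi> (hist n \<omega>))"
proof -
  define I where "I h d = {fst h + 1..fst h + d}" for h :: "nat \<times> nat list" and d
  have I: "batch_edges n \<omega> = I (hist n \<omega>) (dM (Suc n) \<omega>)" for \<omega> by (simp add: I_def)
  have card: "card (I h d) = d" for h d by (simp add: I_def)
  have int: "integrable M (\<lambda>\<omega>. \<psi> (hist n \<omega>) * card (I (hist n \<omega>) (dM (Suc n) \<omega>)))"
    unfolding card by (rule L2_mult[OF \<psi> L2_batch])
  note * = integrable_batch_sum[of I U n \<pi> \<psi> c] expectation_batch_sum[of I U n \<pi> \<psi> c]
  have sets: "finite (I h d)" "x \<in> I h d \<Longrightarrow> U x h \<in> events"
    "x \<in> I h d \<Longrightarrow> atom n h d \<noteq> {} \<Longrightarrow> prob (atom n h d \<inter> U x h) = prob (atom n h d) * \<pi> h" for h d x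
    using U[of h x] pr[of h x d] by (auto simp: I_def)
  show "integrable M (\<lambda>\<omega>. \<psi> (hist n \<omega>) * (\<Sum>k\<in>batch_edges n \<omega>. indicator (U k (hist n \<omega>)) \<omega>))"
    unfolding I by (rule *(1)[OF sets int \<pi>])
  have L2': "L2 (\<lambda>\<omega>. \<psi> (hist n \<omega>) * \<pi> (hist n \<omega>))"
  proof (rule L2_bound[OF L2_cmult[OF \<psi>, of c]])
    show "AE \<omega> in M. \<bar>\<psi> (hist n \<omega>) * \<pi> (hist n \<omega>)\<bar> \<le> \<bar>c * \<psi> (hist n \<omega>)\<bar>"
      using order_trans[OF \<pi> abs_ge_self] by (intro AE_I2) (simp add: abs_mult mult.commute[of "\<bar>c\<bar>"] mult_left_mono)
  qed measurable
  have "expectation (\<lambda>\<omega>. \<psi> (hist n \<omega>) * (\<Sum>k\<in>batch_edges n \<omega>. indicator (U k (hist n \<omega>)) \<omega>))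
     = expectation (\<lambda>\<omega>. \<psi> (hist n \<omega>) * card (I (hist n \<omega>) (dM (Suc n) \<omega>)) * \<pi> (hist n \<omega>))"
    unfolding I by (rule *(2)[OF sets int \<pi>])
  also have "\<dots> = expectation (\<lambda>\<omega>. (\<psi> (hist n \<omega>) * \<pi> (hist n \<omega>)) * dM (Suc n) \<omega>)"
    unfolding card by (simp add: mult_ac)
  also have "\<dots> = (1 + lam) * expectation (\<lambda>\<omega>. \<psi> (hist n \<omega>) * \<pi> (hist n \<omega>))"
    using expectation_hist_batch[of "\<lambda>h. \<psi> h * \<pi> h" n, OF L2'] .
  finally show "expectation (\<lambda>\<omega>. \<psi> (hist n \<omega>) * (\<Sum>k\<in>batch_edges n \<omega>. indicator (U k (hist n \<omega>)) \<omega>))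
    = (1 + lam) * expectation (\<lambda>\<omega>. \<psi> (hist n \<omega>) * \<pi> (hist n \<omega>))" .
qed

section \<open>New nodes and hits of a given degree\<close>

definition coin_hit :: "nat \<Rightarrow> nat \<times> nat list \<Rightarrow> 'a set" where
  "coin_hit k h = {\<omega> \<in> space M. B k \<omega> \<in> {1}}"

definition attach_prob :: "real" where
  "attach_prob = 1 - s * p"

definition deg_hit :: "nat \<Rightarrow> nat \<Rightarrow> nat \<times> nat list \<Rightarrow> 'a set" where
  "deg_hit j k h = {\<omega> \<in> space M. B k \<omega> \<in> {b. s * b = 0}} \<inter>
     {\<omega> \<in> space M. hattach h k \<omega> \<in> {v \<in> {1..hnodes h}. hdeg h v = j}}"

definition deg_rate :: "nat \<Rightarrow> nat \<times> nat list \<Rightarrow> real" where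
  "deg_rate j h = (j + \<delta>) * hcount h j / hweight h"

lemma gen_inputs: "A \<in> sets (gen G) \<Longrightarrow> G \<subseteq> inputs \<Longrightarrow> A \<in> events"
  using sets_gen_events by blast

lemma coin_inputs: "k \<ge> 1 \<Longrightarrow> {Coin k} \<subseteq> inputs"
  and clock_inputs: "k \<ge> 1 \<Longrightarrow> {In_Clock k v | v. v \<ge> 1} \<subseteq> inputs"
  by (auto simp: inputs_def)

lemma space_gen_sets: "space M \<in> sets (gen G)"
  using sets.top[of "gen G"] by simp

lemma coin_event: "k \<ge> 1 \<Longrightarrow> {\<omega> \<in> space M. B k \<omega> \<in> S} \<in> events"
  by (rule gen_inputs[OF coin_event_gen coin_inputs])

lemma hattach_event: "k \<ge> 1 \<Longrightarrow> {\<omega> \<in> space M. hattach h k \<omega> \<in> S} \<in> events"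
  by (rule gen_inputs[OF hattach_event_gen clock_inputs])

lemma coin_hit_events: "fst h < k \<Longrightarrow> coin_hit k h \<in> events"
  unfolding coin_hit_def by (rule coin_event) simp

lemma prob_coin_hit:
  assumes "fst h < k"
  shows "prob (atom n h d \<inter> coin_hit k h) = prob (atom n h d) * p"
proof -
  have "prob (atom n h d \<inter> coin_hit k h \<inter> space M \<inter> space M) = prob (atom n h d) * prob (coin_hit k h) * prob (space M) * prob (space M)"
    unfolding coin_hit_def
    by (rule prob_atom_step[of h k "Suc k", OF _ _ _ coin_event_gen space_gen_sets space_gen_sets]) (use assms in auto)
  moreover have "atom n h d \<inter> coin_hit k h \<inter> space M \<inter> space M = atom n h d \<inter> coin_hit k h"
    by (auto simp: coin_hit_def)
  ultimately show ?thesis using coin_1[of k] assms by (simp add: prob_space coin_hit_def)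
qed

lemma deg_hit_events: "fst h < k \<Longrightarrow> deg_hit j k h \<in> events"
  unfolding deg_hit_def
  by (intro sets.Int coin_event hattach_event) simp_all

lemma prob_deg_hit:
  assumes k: "fst h < k" and ne: "atom n h d \<noteq> {}"
  shows "prob (atom n h d \<inter> deg_hit j k h) = prob (atom n h d) * (attach_prob * deg_rate j h)"
proof -
  let ?E = "{\<omega> \<in> space M. B k \<omega> \<in> {b. s * b = 0}}"
    and ?V = "{v \<in> {1..hnodes h}. hdeg h v = j}"
  let ?F = "{\<omega> \<in> space M. hattach h k \<omega> \<in> ?V}"
  \<comment> \<open>The last event is the whole space; any edge number other than \<open>k\<close>
    will do for its block, and \<open>Suc k\<close> is one.\<close>
  have 1: "prob (atom n h d \<inter> ?E \<inter> ?F \<inter> space M) = prob (atom n h d) * prob ?E * prob ?F * prob (space M)"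
    by (rule prob_atom_step[of h k "Suc k", OF _ _ _ coin_event_gen hattach_event_gen space_gen_sets]) (use k in auto)
  have 2: "atom n h d \<inter> ?E \<inter> ?F \<inter> space M = atom n h d \<inter> deg_hit j k h"
  proof -
    have "A \<inter> E \<inter> F \<inter> space M = A \<inter> (E \<inter> F)" if "A \<subseteq> space M" for A E F using that by blast
    from this[OF sets.sets_into_space[OF atom_events]] show ?thesis unfolding deg_hit_def .
  qed
  have 3: "prob ?E = attach_prob"
    using s coin_0[of k] k by (auto simp: attach_prob_def prob_space)
  have 4: "prob ?F = (\<Sum>v\<in>?V. real (hdeg h v) + \<delta>) / hweight h"
    by (rule prob_hattach) (use k hist_pos[OF ne] in auto)
  have 5: "(\<Sum>v\<in>?V. real (hdeg h v) + \<delta>) = (j + \<delta>) * hcount h j"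
    by (simp add: hcount_def deg_count_def mult.commute)
  show ?thesis
    using 1 unfolding 2 3 4 5 deg_rate_def prob_space by simp
qed

lemma attach_prob: "0 < attach_prob" "attach_prob \<le> 1"
  using s p by (auto simp: attach_prob_def)

lemma hcount_weight: "\<delta> * hcount h j \<le> hweight h"
  using hweight_ge[of h] hcount_le[of h j] \<delta> by (smt (verit) mult_left_mono)

lemma hweight_nonneg: "0 \<le> hweight h"
  using hcount_weight[of h 0] hcount_nonneg[of h 0] \<delta> by (smt (verit) mult_nonneg_nonneg)

lemma deg_rate_bound: "0 \<le> deg_rate j h" "deg_rate j h \<le> (j + \<delta>) / \<delta>"
proof -
  show "0 \<le> deg_rate j h"
    using \<delta> hcount_nonneg[of h j] hweight_nonneg[of h] by (simp add: deg_rate_def)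
  have "(j + \<delta>) * (\<delta> * hcount h j) \<le> (j + \<delta>) * hweight h"
    using \<delta> hcount_weight[of h j] by (intro mult_left_mono) auto
  \<comment> \<open>\<open>h\<close> need not be a value that the history attains. If its weight is
    0, the rate is 0 by the convention for division.\<close>
  thus "deg_rate j h \<le> (j + \<delta>) / \<delta>"
    using \<delta> hweight_nonneg[of h]
    by (cases "hweight h = 0") (auto simp: deg_rate_def divide_simps mult_ac)
qed

lemma expectation_coin_hits:
  assumes "L2 (\<lambda>\<omega>. \<psi> (hist n \<omega>))"
  shows "integrable M (\<lambda>\<omega>. \<psi> (hist n \<omega>) * (\<Sum>k\<in>batch_edges n \<omega>. indicator (coin_hit k (hist n \<omega>)) \<omega>))"
    and "expectation (\<lambda>\<omega>. \<psi> (hist n \<omega>) * (\<Sum>k\<in>batch_edges n \<omega>. indicator (coin_hit k (hist n \<omega>)) \<omega>))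
    = (1 + lam) * expectation (\<lambda>\<omega>. \<psi> (hist n \<omega>) * p)"
proof -
  have c: "\<bar>p\<bar> \<le> p" using p by simp
  show "integrable M (\<lambda>\<omega>. \<psi> (hist n \<omega>) * (\<Sum>k\<in>batch_edges n \<omega>. indicator (coin_hit k (hist n \<omega>)) \<omega>))"
    by (rule integrable_batch_edges[OF coin_hit_events prob_coin_hit assms c])
  show "expectation (\<lambda>\<omega>. \<psi> (hist n \<omega>) * (\<Sum>k\<in>batch_edges n \<omega>. indicator (coin_hit k (hist n \<omega>)) \<omega>))
    = (1 + lam) * expectation (\<lambda>\<omega>. \<psi> (hist n \<omega>) * p)"
    by (rule expectation_batch_edges[OF coin_hit_events prob_coin_hit assms c])
qed

lemma expectation_deg_hits:
  assumes "L2 (\<lambda>\<omega>. \<psi> (hist n \<omega>))"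
  shows "integrable M (\<lambda>\<omega>. \<psi> (hist n \<omega>) * (\<Sum>k\<in>batch_edges n \<omega>. indicator (deg_hit j k (hist n \<omega>)) \<omega>))"
    and "expectation (\<lambda>\<omega>. \<psi> (hist n \<omega>) * (\<Sum>k\<in>batch_edges n \<omega>. indicator (deg_hit j k (hist n \<omega>)) \<omega>))
    = (1 + lam) * expectation (\<lambda>\<omega>. \<psi> (hist n \<omega>) * (attach_prob * deg_rate j (hist n \<omega>)))"
proof -
  have c: "\<bar>attach_prob * deg_rate j h\<bar> \<le> (j + \<delta>) / \<delta>" for h
    using attach_prob deg_rate_bound[of j h] mult_mono[of attach_prob 1 "deg_rate j h" "(j + \<delta>) / \<delta>"] by simp
  show "integrable M (\<lambda>\<omega>. \<psi> (hist n \<omega>) * (\<Sum>k\<in>batch_edges n \<omega>. indicator (deg_hit j k (hist n \<omega>)) \<omega>))"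
    by (rule integrable_batch_edges[OF deg_hit_events prob_deg_hit assms c])
  show "expectation (\<lambda>\<omega>. \<psi> (hist n \<omega>) * (\<Sum>k\<in>batch_edges n \<omega>. indicator (deg_hit j k (hist n \<omega>)) \<omega>))
    = (1 + lam) * expectation (\<lambda>\<omega>. \<psi> (hist n \<omega>) * (attach_prob * deg_rate j (hist n \<omega>)))"
    by (rule expectation_batch_edges[OF deg_hit_events prob_deg_hit assms c])
qed

section \<open>Collisions within a batch\<close>

definition pairs :: "nat \<times> nat list \<Rightarrow> nat \<Rightarrow> (nat \<times> nat) set" where
  "pairs h d = (SIGMA k:{fst h + 1..fst h + d}. {fst h + 1..<k})"

text \<open>Only collisions at nodes of degree at most \<open>m\<close> affect the number of nodes of degree \<open>m\<close>. This
  bound on the degree makes their probability of order 1/n.\<close>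

definition collision :: "nat \<Rightarrow> nat \<times> nat \<Rightarrow> nat \<times> nat list \<Rightarrow> 'a set" where
  "collision m kl h = (\<Union>v\<in>{v \<in> {1..hnodes h}. hdeg h v \<le> m}.
     {\<omega> \<in> space M. hattach h (fst kl) \<omega> \<in> {v}} \<inter> {\<omega> \<in> space M. hattach h (snd kl) \<omega> \<in> {v}})"

definition collision_prob :: "nat \<Rightarrow> nat \<times> nat list \<Rightarrow> real" where
  "collision_prob m h = (\<Sum>v\<in>{v \<in> {1..hnodes h}. hdeg h v \<le> m}. ((real (hdeg h v) + \<delta>) / hweight h)\<^sup>2)"

lemma collision_events:
  assumes "kl \<in> pairs h d"
  shows "collision m kl h \<in> events"
  unfolding collision_def
  by (intro sets.finite_UN sets.Int hattach_event)
     (use assms in \<open>auto simp: pairs_def\<close>)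

text \<open>The union over the common target \<open>v\<close> is disjoint, and for each
  \<open>v\<close> the two edges use independent rows of clocks, hence the square.\<close>

lemma prob_collision:
  assumes kl: "kl \<in> pairs h d" and ne: "atom n h d \<noteq> {}"
  shows "prob (atom n h d \<inter> collision m kl h) = prob (atom n h d) * collision_prob m h"
proof -
  obtain k l where kl': "kl = (k, l)" "fst h < k" "fst h < l" "k \<noteq> l" "k \<ge> 1" "l \<ge> 1"
    using kl by (auto simp: pairs_def)
  let ?S = "{v \<in> {1..hnodes h}. hdeg h v \<le> m}"
  let ?E = "\<lambda>k v. {\<omega> \<in> space M. hattach h k \<omega> \<in> {v}}"
  have E: "?E k v \<in> events" if "k \<ge> 1" for k v
    using that by (rule hattach_event)
  have eq: "atom n h d \<inter> collision m kl h = (\<Union>v\<in>?S. atom n h d \<inter> (?E k v \<inter> ?E l v))"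
    by (auto simp: collision_def kl')
  have "prob (atom n h d \<inter> collision m kl h) = (\<Sum>v\<in>?S. prob (atom n h d \<inter> (?E k v \<inter> ?E l v)))"
    unfolding eq
    by (rule finite_measure_finite_Union)
       (use kl' E atom_events in \<open>auto simp: disjoint_family_on_def intro!: sets.Int\<close>)
  also have "\<dots> = (\<Sum>v\<in>?S. prob (atom n h d) * ((real (hdeg h v) + \<delta>) / hweight h)\<^sup>2)"
  proof (intro sum.cong refl)
    fix v assume v: "v \<in> ?S"
    have P: "prob (?E j v) = (real (hdeg h v) + \<delta>) / hweight h" if "j \<ge> 1" for j
      using prob_hattach[of j h "{v}"] that hist_pos[OF ne] v by simp
    have "prob (atom n h d \<inter> space M \<inter> ?E k v \<inter> ?E l v) = prob (atom n h d) * prob (space M) * prob (?E k v) * prob (?E l v)"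
      using kl' by (intro prob_atom_step[of h k l] space_gen_sets hattach_event_gen) auto
    moreover have "atom n h d \<inter> space M \<inter> ?E k v \<inter> ?E l v = atom n h d \<inter> (?E k v \<inter> ?E l v)" by auto
    ultimately show "prob (atom n h d \<inter> (?E k v \<inter> ?E l v)) = prob (atom n h d) * ((real (hdeg h v) + \<delta>) / hweight h)\<^sup>2"
      using P[OF kl'(5)] P[OF kl'(6)] by (simp add: prob_space power2_eq_square)
  qed
  finally show ?thesis by (simp add: collision_prob_def sum_distrib_left)
qed

lemma card_pairs: "card (pairs h d) \<le> d\<^sup>2"
proof -
  have "card (pairs h d) = (\<Sum>k\<in>{fst h + 1..fst h + d}. k - (fst h + 1))"
    unfolding pairs_def by (subst card_SigmaI) auto
  also have "\<dots> \<le> (\<Sum>k\<in>{fst h + 1..fst h + d}. d)"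
    by (intro sum_mono) auto
  finally show ?thesis by (simp add: power2_eq_square)
qed

lemma finite_pairs: "finite (pairs h d)"
  by (auto simp: pairs_def)

lemma collision_prob_le: 
  shows "0 \<le> collision_prob m h"
    and "collision_prob m h \<le> hnodes h * ((m + \<delta>) / hweight h)\<^sup>2"
proof -
  show "0 \<le> collision_prob m h" by (auto simp: collision_prob_def intro!: sum_nonneg)
  have "collision_prob m h \<le> (\<Sum>v\<in>{v \<in> {1..hnodes h}. hdeg h v \<le> m}. ((m + \<delta>) / hweight h)\<^sup>2)"
    unfolding collision_prob_def
    using \<delta> hweight_nonneg[of h] by (intro sum_mono power_mono divide_right_mono) auto
  also have "\<dots> \<le> (\<Sum>v\<in>{1..hnodes h}. ((m + \<delta>) / hweight h)\<^sup>2)"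
    by (intro sum_mono2) auto
  finally show "collision_prob m h \<le> hnodes h * ((m + \<delta>) / hweight h)\<^sup>2" by simp
qed

text \<open>A bound uniform in \<open>h\<close>, as \<open>expectation_batch_sum\<close> demands.
  The finer bound in \<open>collision_prob_le\<close> gives the decay.\<close>

lemma collision_prob_le': "collision_prob m h \<le> ((m + \<delta>) / \<delta>)\<^sup>2"
proof (cases "hnodes h = 0")
  case True
  thus ?thesis using collision_prob_le(2)[of m h] by (simp add: order_trans)
next
  case False
  have pos: "\<delta> * hnodes h > 0" using False \<delta> by simp
  have "hnodes h * ((m + \<delta>) / hweight h)\<^sup>2 \<le> (hnodes h)\<^sup>2 * ((m + \<delta>) / (\<delta> * hnodes h))\<^sup>2"
    using False \<delta> pos hweight_ge[of h] less_le_trans[OF pos hweight_ge]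
    by (intro mult_mono power_mono divide_left_mono mult_pos_pos divide_nonneg_nonneg)
       (auto simp: power2_eq_square)
  also have "\<dots> = ((m + \<delta>) / \<delta>)\<^sup>2"
    using False \<delta> by (simp add: power_divide power_mult_distrib)
  finally show ?thesis using collision_prob_le(2)[of m h] by simp
qed

section \<open>Second moments\<close>

text \<open>Normalising by \<open>n + 1\<close> instead of \<open>n\<close> avoids a special case at 0.\<close>

lemma edges_L2: "\<exists>C. \<forall>n. expectation (\<lambda>\<omega>. (real (edges n \<omega>) - (1 + lam) * (real n + 1))\<^sup>2) \<le> C * (real n + 1)"
proof -
  define Y where "Y n \<omega> = real (edges n \<omega>) - (1 + lam) * (real n + 1)" for n \<omega>
  define D where "D n \<omega> = real (dM (Suc n) \<omega>) - (1 + lam)" for n \<omega>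
  have Y: "L2 (Y n)" for n unfolding Y_def by (intro L2_diff L2_edges L2_const)
  have D: "L2 (D n)" for n unfolding D_def by (intro L2_diff L2_batch L2_const)
  \<comment> \<open>The constant comes from x + (1 + lam) <= (2 + lam) x^2 for a batch size x >=
    1.\<close>
  obtain C where C: "\<And>\<Delta> n. L2 \<Delta> \<Longrightarrow> AE \<omega> in M. \<bar>\<Delta> \<omega>\<bar> \<le> (2 + lam) * (real (dM (Suc n) \<omega>))\<^sup>2
      \<Longrightarrow> expectation (\<lambda>\<omega>. (\<Delta> \<omega>)\<^sup>2) \<le> C"
    by (rule batch_square_bound) blast
  have step: "expectation (\<lambda>\<omega>. (Y (Suc n) \<omega>)\<^sup>2) \<le> expectation (\<lambda>\<omega>. (Y n \<omega>)\<^sup>2) + (2 * 0 + C)" for n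
  proof -
    \<comment> \<open>Given the history the increment is centred, since \<open>1 + lam\<close> is
      the mean batch size. So the mixed term vanishes and the second moments merely add up.\<close>
    have "expectation (\<lambda>\<omega>. Y n \<omega> * D n \<omega>) = expectation (\<lambda>\<omega>. Y n \<omega> * dM (Suc n) \<omega>) - (1 + lam) * expectation (Y n)"
      unfolding D_def right_diff_distrib using L2_mult[OF Y L2_batch] L2_integrable[OF Y]
      by (simp add: mult.commute)
    also have "\<dots> = 0"
      using expectation_hist_batch[of "\<lambda>h. real (fst h) - (1 + lam) * (real n + 1)" n] Y[of n]
      by (simp add: Y_def[abs_def])
    finally have 1: "expectation (\<lambda>\<omega>. Y n \<omega> * D n \<omega>) \<le> 0" by simp
    have 2: "expectation (\<lambda>\<omega>. (D n \<omega>)\<^sup>2) \<le> C"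
    proof (rule C[OF D])
      show "AE \<omega> in M. \<bar>D n \<omega>\<bar> \<le> (2 + lam) * (real (dM (Suc n) \<omega>))\<^sup>2"
        using AE_batch_ge[of n]
      proof eventually_elim
        case (elim \<omega>)
        define x where "x = real (dM (Suc n) \<omega>)"
        have x: "1 \<le> x" using elim by (simp add: x_def)
        have "(1 + lam) * 1 \<le> (1 + lam) * x\<^sup>2"
          using lam le_power2_if_ge_1[OF x] by (intro mult_left_mono) auto
        hence "x + (1 + lam) \<le> (2 + lam) * x\<^sup>2"
          using le_power2_if_ge_1[OF x] by (simp add: algebra_simps)
        thus ?case using lam x unfolding D_def x_def[symmetric] by linarith
      qed
    qed
    have "Y (Suc n) = (\<lambda>\<omega>. Y n \<omega> + D n \<omega>)" by (auto simp: fun_eq_iff Y_def D_def algebra_simps)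
    thus ?thesis using L2_step[OF Y D 1 2] by simp
  qed
  show ?thesis
    using linear_growth[of "\<lambda>n. expectation (\<lambda>\<omega>. (Y n \<omega>)\<^sup>2)", OF step] unfolding Y_def by blast
qed

section \<open>The one-step change of the counts\<close>

definition deg_hits :: "nat \<Rightarrow> nat \<Rightarrow> 'a \<Rightarrow> real" where
  "deg_hits n j \<omega> = (\<Sum>k\<in>batch_edges n \<omega>. indicator (deg_hit j k (hist n \<omega>)) \<omega>)"

definition coin_hits :: "nat \<Rightarrow> 'a \<Rightarrow> real" where
  "coin_hits n \<omega> = (\<Sum>k\<in>batch_edges n \<omega>. indicator (coin_hit k (hist n \<omega>)) \<omega>)"

definition collisions :: "nat \<Rightarrow> nat \<Rightarrow> 'a \<Rightarrow> real" where
  "collisions n m \<omega> = (\<Sum>x\<in>pairs (hist n \<omega>) (dM (Suc n) \<omega>). indicator (collision m x (hist n \<omega>)) \<omega>)"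

lemma hits_bounds:
  "0 \<le> deg_hits n j \<omega>" "deg_hits n j \<omega> \<le> dM (Suc n) \<omega>"
  "0 \<le> coin_hits n \<omega>" "coin_hits n \<omega> \<le> dM (Suc n) \<omega>"
  "0 \<le> collisions n m \<omega>" "collisions n m \<omega> \<le> (real (dM (Suc n) \<omega>))\<^sup>2"
proof -
  have "card (batch_edges n \<omega>) = dM (Suc n) \<omega>" by simp
  thus "0 \<le> deg_hits n j \<omega>" "deg_hits n j \<omega> \<le> dM (Suc n) \<omega>"
    "0 \<le> coin_hits n \<omega>" "coin_hits n \<omega> \<le> dM (Suc n) \<omega>"
    unfolding deg_hits_def coin_hits_def
    using sum_indicator_bounds[of "\<lambda>k. deg_hit j k (hist n \<omega>)" \<omega> "batch_edges n \<omega>"]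
      sum_indicator_bounds[of "\<lambda>k. coin_hit k (hist n \<omega>)" \<omega> "batch_edges n \<omega>"] by simp_all
  have "real (card (pairs (hist n \<omega>) (dM (Suc n) \<omega>))) \<le> (real (dM (Suc n) \<omega>))\<^sup>2"
    using card_pairs[of "hist n \<omega>" "dM (Suc n) \<omega>"] by (metis of_nat_le_iff of_nat_power)
  thus "0 \<le> collisions n m \<omega>" "collisions n m \<omega> \<le> (real (dM (Suc n) \<omega>))\<^sup>2"
    unfolding collisions_def
    using sum_indicator_bounds[of "\<lambda>x. collision m x (hist n \<omega>)" \<omega> "pairs (hist n \<omega>) (dM (Suc n) \<omega>)"] by linarith+
qed

lemma AE_V_step: "AE \<omega> in M. real (V (Suc n) \<omega>) = V n \<omega> + coin_hits n \<omega>"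
  using AE_good AE_space
proof eventually_elim
  case (elim \<omega>)
  interpret g: good_input s \<delta> "\<lambda>k. B k \<omega>" "\<lambda>k v. t k v \<omega>" "\<lambda>k. dM k \<omega>" by (rule elim)
  have "(\<Sum>k\<in>batch_edges n \<omega>. real (B k \<omega>)) = coin_hits n \<omega>"
    unfolding coin_hits_def
  proof (intro sum.cong refl)
    fix k assume "k \<in> batch_edges n \<omega>"
    hence "B k \<omega> \<in> {0, 1}" by (intro g.b) simp
    thus "real (B k \<omega>) = indicator (coin_hit k (hist n \<omega>)) \<omega>"
      using elim by (auto simp: coin_hit_def)
  qed
  thus ?case
    using node_count_add[of "edges n \<omega>" "edges (Suc n) \<omega>" "\<lambda>k. B k \<omega>"] by simp
qed

lemma AE_deg_step:
  "AE \<omega> in M. \<bar>hcount (hist (Suc n) \<omega>) m - hcount (hist n \<omega>) m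
      - (of_bool (m > 0) * deg_hits n (m - 1) \<omega> - deg_hits n m \<omega> + of_bool (m = s) * coin_hits n \<omega>)\<bar>
    \<le> 2 * collisions n m \<omega>"
  using AE_good AE_space
proof eventually_elim
  case (elim \<omega>)
  interpret g: good_input s \<delta> "\<lambda>k. B k \<omega>" "\<lambda>k v. t k v \<omega>" "\<lambda>k. dM k \<omega>" by (rule elim)
  have range: "J n k \<omega> \<in> {1..V n \<omega>}" for k using g.J_range[of k n] by simp
  have hd: "hdeg (hist n \<omega>) (J n k \<omega>) = deg n \<omega> (J n k \<omega>)" for k by (rule hdeg_hist[OF range])
  have dh: "indicator (deg_hit j k (hist n \<omega>)) \<omega> = (of_bool (s * B k \<omega> = 0) * of_bool (deg n \<omega> (J n k \<omega>) = j) :: real)" for j k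
  proof -
    have "\<omega> \<in> deg_hit j k (hist n \<omega>) \<longleftrightarrow> s * B k \<omega> = 0 \<and> deg n \<omega> (J n k \<omega>) = j"
      using elim(2) range[of k] by (simp add: deg_hit_def J_eq_hattach[symmetric] hd)
    thus ?thesis by (simp add: indicator_def)
  qed
  have lin: "g.lin n m k = of_bool (m > 0) * indicator (deg_hit (m - 1) k (hist n \<omega>)) \<omega>
      - indicator (deg_hit m k (hist n \<omega>)) \<omega> + of_bool (m = s) * indicator (coin_hit k (hist n \<omega>)) \<omega>"
    if "k \<in> batch_edges n \<omega>" for k
  proof -
    have b: "B k \<omega> \<in> {0, 1}" using that by (intro g.b) simp
    have S: "Suc x = m \<longleftrightarrow> m > 0 \<and> x = m - 1" for x by auto
    show ?thesis
      unfolding g.lin_def dh S using b elim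
      by (auto simp: coin_hit_def)
  qed
  have "(\<Sum>k\<in>batch_edges n \<omega>. g.lin n m k)
     = of_bool (m > 0) * deg_hits n (m - 1) \<omega> - deg_hits n m \<omega> + of_bool (m = s) * coin_hits n \<omega>"
    unfolding deg_hits_def coin_hits_def sum_distrib_left sum.distrib[symmetric] sum_subtractf[symmetric]
    by (rule sum.cong[OF refl lin])
  moreover have "(\<Sum>k\<in>batch_edges n \<omega>. \<Sum>l\<in>{edges n \<omega> + 1..<k}. of_bool (J n l \<omega> = J n k \<omega> \<and> deg n \<omega> (J n k \<omega>) \<le> m))
     = collisions n m \<omega>"
  proof -
    have ci: "indicator (collision m (k, l) (hist n \<omega>)) \<omega> = (of_bool (J n l \<omega> = J n k \<omega> \<and> deg n \<omega> (J n k \<omega>) \<le> m) :: real)" for k l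
    proof -
      have "\<omega> \<in> collision m (k, l) (hist n \<omega>) \<longleftrightarrow> J n l \<omega> = J n k \<omega> \<and> deg n \<omega> (J n k \<omega>) \<le> m"
        using elim(2) range[of k] hd[of k] by (auto simp: collision_def J_eq_hattach[symmetric])
      thus ?thesis by (simp add: indicator_def)
    qed
    show ?thesis
      unfolding collisions_def pairs_def ci[symmetric] by (subst sum.Sigma) (simp_all add: case_prod_beta)
  qed
  ultimately show ?case
    using g.deg_count_step_error[of n m] unfolding hcount_hist by simp
qed

lemma measurable_hits [measurable]:
  "deg_hits n j \<in> borel_measurable M" "coin_hits n \<in> borel_measurable M"
proof -
  show "deg_hits n j \<in> borel_measurable M"
    using borel_measurable_integrable[OF expectation_deg_hits(1)[of "\<lambda>_. 1" n j]]
    by (simp add: deg_hits_def[abs_def])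
  show "coin_hits n \<in> borel_measurable M"
    using borel_measurable_integrable[OF expectation_coin_hits(1)[of "\<lambda>_. 1" n]]
    by (simp add: coin_hits_def[abs_def])
qed

lemma V_L2: "\<exists>C. \<forall>n. expectation (\<lambda>\<omega>. (real (V n \<omega>) - p * (1 + lam) * (real n + 1))\<^sup>2) \<le> C * (real n + 1)"
proof -
  define v where "v = p * (1 + lam)"
  have v: "v > 0" using p lam by (simp add: v_def)
  define Y where "Y n \<omega> = real (V n \<omega>) - v * (real n + 1)" for n \<omega>
  define D where "D n \<omega> = coin_hits n \<omega> - v" for n \<omega>
  have Y: "L2 (Y n)" for n unfolding Y_def by (intro L2_diff L2_V L2_const)
  have H: "L2 (coin_hits n)" for n
    by (rule L2_bound[OF L2_batch]) (use hits_bounds in \<open>auto intro!: AE_I2\<close>)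
  have D: "L2 (D n)" for n unfolding D_def by (intro L2_diff H L2_const)
  obtain C where C: "\<And>\<Delta> n. L2 \<Delta> \<Longrightarrow> AE \<omega> in M. \<bar>\<Delta> \<omega>\<bar> \<le> (1 + v) * (real (dM (Suc n) \<omega>))\<^sup>2
      \<Longrightarrow> expectation (\<lambda>\<omega>. (\<Delta> \<omega>)\<^sup>2) \<le> C"
    by (rule batch_square_bound) blast
  have step: "expectation (\<lambda>\<omega>. (Y (Suc n) \<omega>)\<^sup>2) \<le> expectation (\<lambda>\<omega>. (Y n \<omega>)\<^sup>2) + (2 * 0 + C)" for n
  proof -
    have "expectation (\<lambda>\<omega>. Y n \<omega> * D n \<omega>) = expectation (\<lambda>\<omega>. Y n \<omega> * coin_hits n \<omega>) - v * expectation (Y n)"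
      unfolding D_def right_diff_distrib using L2_mult[OF Y H] L2_integrable[OF Y]
      by (simp add: mult.commute)
    also have "\<dots> = 0"
      using expectation_coin_hits(2)[of "\<lambda>h. real (hnodes h) - v * (real n + 1)" n] Y[of n]
      by (simp add: Y_def[abs_def] coin_hits_def[abs_def] v_def mult_ac)
    finally have 1: "expectation (\<lambda>\<omega>. Y n \<omega> * D n \<omega>) \<le> 0" by simp
    have 2: "expectation (\<lambda>\<omega>. (D n \<omega>)\<^sup>2) \<le> C"
    proof (rule C[OF D])
      show "AE \<omega> in M. \<bar>D n \<omega>\<bar> \<le> (1 + v) * (real (dM (Suc n) \<omega>))\<^sup>2"
        using AE_batch_ge[of n]
      proof eventually_elim
        case (elim \<omega>)
        define x where "x = real (dM (Suc n) \<omega>)"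
        have x: "1 \<le> x" using elim by (simp add: x_def)
        have "v * 1 \<le> v * x\<^sup>2" using v le_power2_if_ge_1[OF x] by (intro mult_left_mono) auto
        hence "x + v \<le> (1 + v) * x\<^sup>2" using le_power2_if_ge_1[OF x] by (simp add: algebra_simps)
        thus ?case using v hits_bounds(3,4)[of n \<omega>] unfolding D_def x_def[symmetric] by linarith
      qed
    qed
    \<comment> \<open>The increment of the node count is given by the hits only almost surely,
      because a coin may take other values on a null set.\<close>
    have "expectation (\<lambda>\<omega>. (Y (Suc n) \<omega>)\<^sup>2) = expectation (\<lambda>\<omega>. (Y n \<omega> + D n \<omega>)\<^sup>2)"
    proof (rule integral_cong_AE)
      show "AE \<omega> in M. (Y (Suc n) \<omega>)\<^sup>2 = (Y n \<omega> + D n \<omega>)\<^sup>2"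
        using AE_V_step[of n] by eventually_elim (simp add: Y_def D_def algebra_simps del: edges_upto_Suc)
    qed (use L2_measurable[OF Y] L2_measurable[OF D] in measurable)
    thus ?thesis using L2_step[OF Y D 1 2] by simp
  qed
  show ?thesis
    using linear_growth[of "\<lambda>n. expectation (\<lambda>\<omega>. (Y n \<omega>)\<^sup>2)", OF step] unfolding Y_def v_def by blast
qed

text \<open>The deviation of the weight is 1 plus that of the edges plus delta times that of the
  nodes, and the square of three terms is at most three times the sum of the squares. No
  independence of the two deviations is involved.\<close>

lemma weight_L2: "\<exists>C. \<forall>n. expectation (\<lambda>\<omega>. (hweight (hist n \<omega>) - (1 + lam) * (1 + \<delta> * p) * (real n + 1))\<^sup>2) \<le> C * (real n + 1)"
proof -
  define X where "X n \<omega> = real (edges n \<omega>) - (1 + lam) * (real n + 1)" for n \<omega>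
  define Y where "Y n \<omega> = real (V n \<omega>) - p * (1 + lam) * (real n + 1)" for n \<omega>
  obtain C1 C2 where C: "expectation (\<lambda>\<omega>. (X n \<omega>)\<^sup>2) \<le> C1 * (real n + 1)" "expectation (\<lambda>\<omega>. (Y n \<omega>)\<^sup>2) \<le> C2 * (real n + 1)" for n
    using edges_L2 V_L2 unfolding X_def Y_def by blast
  have X: "L2 (X n)" for n unfolding X_def by (intro L2_diff L2_edges L2_const)
  have Y: "L2 (Y n)" for n unfolding Y_def by (intro L2_diff L2_V L2_const)
  have "expectation (\<lambda>\<omega>. (hweight (hist n \<omega>) - (1 + lam) * (1 + \<delta> * p) * (real n + 1))\<^sup>2)
      \<le> (3 + 3 * C1 + 3 * \<delta>\<^sup>2 * C2) * (real n + 1)" for n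
  proof -
    have "expectation (\<lambda>\<omega>. (hweight (hist n \<omega>) - (1 + lam) * (1 + \<delta> * p) * (real n + 1))\<^sup>2)
      \<le> expectation (\<lambda>\<omega>. 3 + 3 * (X n \<omega>)\<^sup>2 + 3 * \<delta>\<^sup>2 * (Y n \<omega>)\<^sup>2)"
    proof (rule integral_mono_AE')
      show "integrable M (\<lambda>\<omega>. 3 + 3 * (X n \<omega>)\<^sup>2 + 3 * \<delta>\<^sup>2 * (Y n \<omega>)\<^sup>2)"
        using L2_square[OF X] L2_square[OF Y] by simp
      show "AE \<omega> in M. (hweight (hist n \<omega>) - (1 + lam) * (1 + \<delta> * p) * (real n + 1))\<^sup>2
          \<le> 3 + 3 * (X n \<omega>)\<^sup>2 + 3 * \<delta>\<^sup>2 * (Y n \<omega>)\<^sup>2"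
        using AE_hweight[of n]
      proof eventually_elim
        case (elim \<omega>)
        have eq: "hweight (hist n \<omega>) - (1 + lam) * (1 + \<delta> * p) * (real n + 1) = 1 + X n \<omega> + \<delta> * Y n \<omega>"
          using elim by (simp add: X_def Y_def algebra_simps)
        have "(1 + x + y)\<^sup>2 \<le> 3 + 3 * x\<^sup>2 + 3 * y\<^sup>2" for x y :: real
        proof -
          have "0 \<le> (x - 1)\<^sup>2 + (y - 1)\<^sup>2 + (x - y)\<^sup>2" by simp
          thus ?thesis by (simp add: power2_eq_square algebra_simps)
        qed
        from this[of "X n \<omega>" "\<delta> * Y n \<omega>"] show ?case unfolding eq by (simp add: power_mult_distrib mult.assoc)
      qed
    qed simp
    also have "\<dots> = 3 + 3 * expectation (\<lambda>\<omega>. (X n \<omega>)\<^sup>2) + 3 * \<delta>\<^sup>2 * expectation (\<lambda>\<omega>. (Y n \<omega>)\<^sup>2)"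
      using L2_square[OF X] L2_square[OF Y] by (simp add: prob_space)
    also have "\<dots> \<le> 3 * (real n + 1) + 3 * (C1 * (real n + 1)) + 3 * \<delta>\<^sup>2 * (C2 * (real n + 1))"
      using C by (intro add_mono mult_left_mono) auto
    finally show ?thesis by (simp add: algebra_simps)
  qed
  thus ?thesis by blast
qed

lemma L2_hcount: "L2 (\<lambda>\<omega>. hcount (hist n \<omega>) m)"
  by (rule L2_bound[OF L2_V[of n]]) (use hcount_le hcount_nonneg in \<open>auto intro!: AE_I2 simp: abs_of_nonneg hcount_nonneg order_trans[OF hcount_le]\<close>)

text \<open>The deviation is at most a multiple of the weight W and the collision probability at
  most a multiple of 1 / W, so W cancels from the product.\<close>

lemma AE_collision_weight:
  "AE \<omega> in M. \<bar>hcount (hist n \<omega>) m - c * (real n + 1)\<bar> * collision_prob m (hist n \<omega>)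
     \<le> (1 / \<delta> + \<bar>c\<bar>) * ((m + \<delta>)\<^sup>2 / \<delta>)"
  using AE_hweight[of n]
proof eventually_elim
  case (elim \<omega>)
  let ?h = "hist n \<omega>"
  define W where "W = hweight ?h"
  have W: "real n + 1 \<le> W" "W > 0" using elim by (auto simp: W_def)
  have "\<bar>hcount ?h m - c * (real n + 1)\<bar> \<le> hcount ?h m + \<bar>c\<bar> * (real n + 1)"
    using abs_triangle_ineq4[of "hcount ?h m" "c * (real n + 1)"] hcount_nonneg[of ?h m] by (simp add: abs_mult)
  also have "\<dots> \<le> W / \<delta> + \<bar>c\<bar> * W"
    using hcount_weight[of ?h m] \<delta> W by (intro add_mono mult_left_mono) (auto simp: W_def field_simps)
  finally have 1: "\<bar>hcount ?h m - c * (real n + 1)\<bar> \<le> (1 / \<delta> + \<bar>c\<bar>) * W" by (simp add: algebra_simps)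
  have "collision_prob m ?h \<le> hnodes ?h * ((m + \<delta>) / W)\<^sup>2"
    unfolding W_def by (rule collision_prob_le)
  also have "\<dots> \<le> W / \<delta> * ((m + \<delta>) / W)\<^sup>2"
    using hweight_ge[of ?h] \<delta> by (intro mult_right_mono) (auto simp: W_def field_simps)
  also have "\<dots> = (m + \<delta>)\<^sup>2 / \<delta> / W" using W by (simp add: power_divide power2_eq_square[of W])
  finally have 2: "collision_prob m ?h \<le> (m + \<delta>)\<^sup>2 / \<delta> / W" .
  have "\<bar>hcount ?h m - c * (real n + 1)\<bar> * collision_prob m ?h \<le> (1 / \<delta> + \<bar>c\<bar>) * W * ((m + \<delta>)\<^sup>2 / \<delta> / W)"
    using \<delta> W collision_prob_le(1)[of m ?h] by (intro mult_mono[OF 1 2]) auto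
  also have "\<dots> = (1 / \<delta> + \<bar>c\<bar>) * ((m + \<delta>)\<^sup>2 / \<delta>)" using W by simp
  finally show ?case .
qed

text \<open>Given the history, the number of collisions has mean at most
  \<open>collision_prob\<close> times the mean squared batch size.
  \<open>AE_collision_weight\<close> removes the growth of the other factor.\<close>

lemma expectation_collisions:
  "integrable M (\<lambda>\<omega>. \<bar>hcount (hist n \<omega>) m - c * (real n + 1)\<bar> * collisions n m \<omega>)"
  "\<exists>C. \<forall>n. expectation (\<lambda>\<omega>. \<bar>hcount (hist n \<omega>) m - c * (real n + 1)\<bar> * collisions n m \<omega>) \<le> C"
proof -
  let ?\<psi> = "\<lambda>n h. \<bar>hcount h m - c * (real n + 1)\<bar>"
  let ?I = "\<lambda>n \<omega>. pairs (hist n \<omega>) (dM (Suc n) \<omega>)"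
  define K where "K = (1 / \<delta> + \<bar>c\<bar>) * ((m + \<delta>)\<^sup>2 / \<delta>)"
  have K: "K \<ge> 0" using \<delta> by (simp add: K_def)
  have L: "L2 (\<lambda>\<omega>. ?\<psi> n (hist n \<omega>))" for n by (intro L2_abs L2_diff L2_hcount L2_const)
  have card: "real (card (?I n \<omega>)) \<le> (real (dM (Suc n) \<omega>))\<^sup>2" for n \<omega>
    using card_pairs[of "hist n \<omega>" "dM (Suc n) \<omega>"] by (metis of_nat_le_iff of_nat_power)
  have mc: "(\<lambda>\<omega>. real (card (?I n \<omega>))) \<in> borel_measurable M" for n
    by (rule measurable_compose_countable[OF measurable_compose_countable[OF measurable_const measurable_batch_Suc] measurable_hist]) simp
  have Lc: "L2 (\<lambda>\<omega>. real (card (?I n \<omega>)))" for n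
    by (rule L2_bound[OF L2_batch_square mc]) (use card in \<open>auto intro!: AE_I2\<close>)
  have int: "integrable M (\<lambda>\<omega>. ?\<psi> n (hist n \<omega>) * card (?I n \<omega>))" for n by (rule L2_mult[OF L Lc])
  have pb: "\<bar>collision_prob m h\<bar> \<le> ((m + \<delta>) / \<delta>)\<^sup>2" for h
    using collision_prob_le(1)[of m h] collision_prob_le'[of m h] by simp
  show "integrable M (\<lambda>\<omega>. \<bar>hcount (hist n \<omega>) m - c * (real n + 1)\<bar> * collisions n m \<omega>)"
    unfolding collisions_def
    by (rule integrable_batch_sum[where \<psi> = "?\<psi> n", OF finite_pairs collision_events prob_collision int pb])
  have "expectation (\<lambda>\<omega>. \<bar>hcount (hist n \<omega>) m - c * (real n + 1)\<bar> * collisions n m \<omega>)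
      \<le> K * (fact 2 * (\<Sum>j. exp (real j) * batch_prob j))" for n
  proof -
    have "expectation (\<lambda>\<omega>. \<bar>hcount (hist n \<omega>) m - c * (real n + 1)\<bar> * collisions n m \<omega>)
      = expectation (\<lambda>\<omega>. ?\<psi> n (hist n \<omega>) * card (?I n \<omega>) * collision_prob m (hist n \<omega>))"
      unfolding collisions_def
      by (rule expectation_batch_sum[where \<psi> = "?\<psi> n", OF finite_pairs collision_events prob_collision int pb])
    also have "\<dots> \<le> expectation (\<lambda>\<omega>. K * (real (dM (Suc n) \<omega>))\<^sup>2)"
    proof (rule integral_mono_AE')
      show "integrable M (\<lambda>\<omega>. K * (real (dM (Suc n) \<omega>))\<^sup>2)"
        using L2_square[OF L2_batch[of n]] by simp
      show "AE \<omega> in M. ?\<psi> n (hist n \<omega>) * card (?I n \<omega>) * collision_prob m (hist n \<omega>) \<le> K * (real (dM (Suc n) \<omega>))\<^sup>2"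
        using AE_collision_weight[of n m c]
      proof eventually_elim
        case (elim \<omega>)
        have "(?\<psi> n (hist n \<omega>) * collision_prob m (hist n \<omega>)) * card (?I n \<omega>) \<le> K * (real (dM (Suc n) \<omega>))\<^sup>2"
          using elim K card[of n \<omega>] by (intro mult_mono) (auto simp: K_def)
        thus ?case by (simp only: mult_ac)
      qed
      show "AE \<omega> in M. 0 \<le> K * (real (dM (Suc n) \<omega>))\<^sup>2" using K by simp
    qed
    also have "\<dots> \<le> K * (fact 2 * (\<Sum>j. exp (real j) * batch_prob j))"
      using K batch_moment[of n 2] by (simp add: mult_left_mono)
    finally show ?thesis .
  qed
  thus "\<exists>C. \<forall>n. expectation (\<lambda>\<omega>. \<bar>hcount (hist n \<omega>) m - c * (real n + 1)\<bar> * collisions n m \<omega>) \<le> C" by blast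
qed

text \<open>The 5 counts arrivals, departures and newborn nodes once each and collisions twice; each
  of these is at most the squared batch size.\<close>

lemma AE_increment_bound:
  "AE \<omega> in M. \<bar>hcount (hist (Suc n) \<omega>) m - hcount (hist n \<omega>) m - c\<bar> \<le> (5 + \<bar>c\<bar>) * (real (dM (Suc n) \<omega>))\<^sup>2"
  using AE_deg_step[of n m] AE_batch_ge[of n]
proof eventually_elim
  case (elim \<omega>)
  define x where "x = real (dM (Suc n) \<omega>)"
  have x: "x \<ge> 1" using elim by (simp add: x_def)
  have b: "0 \<le> deg_hits n j \<omega>" "deg_hits n j \<omega> \<le> x\<^sup>2" "0 \<le> coin_hits n \<omega>" "coin_hits n \<omega> \<le> x\<^sup>2"
    "0 \<le> collisions n m \<omega>" "collisions n m \<omega> \<le> x\<^sup>2" for j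
    using hits_bounds[where n = n and \<omega> = \<omega>, folded x_def] le_power2_if_ge_1[OF x] by (auto intro: order_trans)
  have c: "\<bar>c\<bar> * 1 \<le> \<bar>c\<bar> * x\<^sup>2" using le_power2_if_ge_1[OF x] by (intro mult_left_mono) auto
  have "0 \<le> of_bool (m > 0) * deg_hits n (m - 1) \<omega>" "of_bool (m > 0) * deg_hits n (m - 1) \<omega> \<le> x\<^sup>2"
    "0 \<le> of_bool (m = s) * coin_hits n \<omega>" "of_bool (m = s) * coin_hits n \<omega> \<le> x\<^sup>2"
    using b by (auto simp: of_bool_def)
  hence "\<bar>hcount (hist (Suc n) \<omega>) m - hcount (hist n \<omega>) m - c\<bar> \<le> 5 * x\<^sup>2 + \<bar>c\<bar> * x\<^sup>2"
    using elim(1) b(1,2)[of m] b(5,6) c by linarith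
  thus ?case by (simp add: x_def algebra_simps)
qed

text \<open>The induction step over the degree: \<open>a\<close>, \<open>b\<close> and
  \<open>e\<close> are the drift coefficients, each with the mean batch size as a factor, and
  \<open>w\<close> is the growth rate of the weight. For \<open>m = 0\<close> the count below and
  its coefficient are set to 0, so the base case has the same form.\<close>

lemma deg_count_L2_step:
  fixes c c' C1 C2 :: real and m :: nat
  defines "T \<equiv> \<lambda>n. real n + 1"
    and "N' \<equiv> \<lambda>h. if m = 0 then 0 else hcount h (m - 1)"
    and "b \<equiv> (if m = 0 then 0 else (1 + lam) * attach_prob * (real (m - 1) + \<delta>))"
    and "a \<equiv> (1 + lam) * attach_prob * (real m + \<delta>)"
    and "e \<equiv> (if m = s then p * (1 + lam) else 0)"
    and "w \<equiv> (1 + lam) * (1 + \<delta> * p)"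
  assumes eqn: "c + a * c / w = b * c' / w + e"
    and prev: "\<And>n. expectation (\<lambda>\<omega>. (N' (hist n \<omega>) - c' * T n)\<^sup>2) \<le> C1 * T n"
  shows "\<exists>C. \<forall>n. expectation (\<lambda>\<omega>. (hcount (hist n \<omega>) m - c * T n)\<^sup>2) \<le> C * T n"
proof -
  obtain C2 where wt: "\<And>n. expectation (\<lambda>\<omega>. (hweight (hist n \<omega>) - w * T n)\<^sup>2) \<le> C2 * T n"
    using weight_L2 unfolding w_def T_def by blast
  obtain C3 where col: "\<And>n. expectation (\<lambda>\<omega>. \<bar>hcount (hist n \<omega>) m - c * T n\<bar> * collisions n m \<omega>) \<le> C3"
    using expectation_collisions(2)[of m c] unfolding T_def by blast
  obtain C4 where sq: "\<And>\<Delta> n. L2 \<Delta> \<Longrightarrow> AE \<omega> in M. \<bar>\<Delta> \<omega>\<bar> \<le> (5 + \<bar>c\<bar>) * (real (dM (Suc n) \<omega>))\<^sup>2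
      \<Longrightarrow> expectation (\<lambda>\<omega>. (\<Delta> \<omega>)\<^sup>2) \<le> C4"
    by (rule batch_square_bound) blast
  have T: "T n > 0" for n by (simp add: T_def)
  have wpos: "w > 0" using lam \<delta> p by (simp add: w_def add_pos_pos)
  have apos: "a > 0" using lam \<delta> attach_prob by (simp add: a_def)
  have bpos: "b \<ge> 0" using lam \<delta> attach_prob by (simp add: b_def)
  define Y where "Y n \<omega> = hcount (hist n \<omega>) m - c * T n" for n \<omega>
  define D where "D n \<omega> = hcount (hist (Suc n) \<omega>) m - hcount (hist n \<omega>) m - c" for n \<omega>
  define drift where "drift h = b * N' h / hweight h - a * hcount h m / hweight h + e - c" for h
  define L where "L n \<omega> = of_bool (m > 0) * deg_hits n (m - 1) \<omega> - deg_hits n m \<omega> + of_bool (m = s) * coin_hits n \<omega>" for n \<omega>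
  have Y: "L2 (Y n)" for n unfolding Y_def by (intro L2_diff L2_hcount L2_const)
  have D: "L2 (D n)" for n unfolding D_def by (intro L2_diff L2_hcount L2_const)
  have LN': "L2 (\<lambda>\<omega>. N' (hist n \<omega>) - c' * T n)" for n
    unfolding N'_def using L2_hcount by (cases "m = 0") (auto intro!: L2_diff)
  have LW: "L2 (\<lambda>\<omega>. hweight (hist n \<omega>) - w * T n)" for n
  proof (rule L2_diff[OF L2_bound L2_const])
    show "L2 (\<lambda>\<omega>. 1 + real (edges n \<omega>) + \<delta> * V n \<omega>)"
      by (intro L2_add L2_const L2_edges L2_cmult L2_V)
    show "AE \<omega> in M. \<bar>hweight (hist n \<omega>)\<bar> \<le> \<bar>1 + real (edges n \<omega>) + \<delta> * V n \<omega>\<bar>"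
      using AE_hweight[of n] by eventually_elim simp
  qed measurable
  have drift_eq: "drift h = (1 + lam) * (of_bool (m > 0) * (attach_prob * deg_rate (m - 1) h)
      - attach_prob * deg_rate m h + of_bool (m = s) * p) - c" for h
  proof -
    have "b * N' h / hweight h = (1 + lam) * (of_bool (m > 0) * (attach_prob * deg_rate (m - 1) h))"
      by (simp add: b_def N'_def deg_rate_def mult.assoc)
    moreover have "a * hcount h m / hweight h = (1 + lam) * (attach_prob * deg_rate m h)"
      by (simp add: a_def deg_rate_def mult.assoc)
    moreover have "e = (1 + lam) * (of_bool (m = s) * p)" by (simp add: e_def)
    ultimately show ?thesis unfolding drift_def by (simp only: right_diff_distrib distrib_left)
  qed
  \<comment> \<open>Both second moments are bounded by multiples of \<open>T n\<close>, and
    \<open>drift_bound\<close> divides by \<open>w * T n\<close>. The quotient \<open>K\<close> is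
    free of \<open>n\<close>.\<close>
  define K where "K = ((b\<^sup>2 / a) * C1 + ((a + b) / \<delta>)\<^sup>2 / a * C2) / w"
  have Ydrift: "expectation (\<lambda>\<omega>. Y n \<omega> * drift (hist n \<omega>)) \<le> K" for n
  proof -
    let ?R = "\<lambda>\<omega>. ((b\<^sup>2 / a) * (N' (hist n \<omega>) - c' * T n)\<^sup>2 + ((a + b) / \<delta>)\<^sup>2 / a * (hweight (hist n \<omega>) - w * T n)\<^sup>2) / (w * T n)"
    \<comment> \<open>A bound on the drift for all \<open>h\<close>, which makes its product with
      \<open>Y n\<close> integrable.\<close>
    have bound: "\<bar>drift h\<bar> \<le> (1 + lam) * ((real (m - 1) + \<delta>) / \<delta> + (real m + \<delta>) / \<delta> + 1) + \<bar>c\<bar>" for h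
    proof -
      have q: "0 \<le> attach_prob * deg_rate j h" "attach_prob * deg_rate j h \<le> (real j + \<delta>) / \<delta>" for j
        using attach_prob deg_rate_bound[of j h] mult_mono[of attach_prob 1 "deg_rate j h" "(real j + \<delta>) / \<delta>"] by auto
      have "0 \<le> of_bool (m > 0) * (attach_prob * deg_rate (m - 1) h)"
        "of_bool (m > 0) * (attach_prob * deg_rate (m - 1) h) \<le> (real (m - 1) + \<delta>) / \<delta>"
        "0 \<le> of_bool (m = s) * p" "of_bool (m = s) * p \<le> 1"
        using q[of "m - 1"] p \<delta> by (auto simp: of_bool_def)
      hence "\<bar>of_bool (m > 0) * (attach_prob * deg_rate (m - 1) h)
        - attach_prob * deg_rate m h + of_bool (m = s) * p\<bar> \<le> (real (m - 1) + \<delta>) / \<delta> + (real m + \<delta>) / \<delta> + 1"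
        using q[of m] by linarith
      hence "\<bar>(1 + lam) * (of_bool (m > 0) * (attach_prob * deg_rate (m - 1) h)
        - attach_prob * deg_rate m h + of_bool (m = s) * p)\<bar> \<le> (1 + lam) * ((real (m - 1) + \<delta>) / \<delta> + (real m + \<delta>) / \<delta> + 1)"
        using lam by (simp only: abs_mult) (intro mult_mono; simp)
      thus ?thesis unfolding drift_eq by linarith
    qed
    have "L2 (\<lambda>\<omega>. drift (hist n \<omega>))"
    proof (rule L2_bound[OF L2_const])
      show "AE \<omega> in M. \<bar>drift (hist n \<omega>)\<bar>
          \<le> \<bar>(1 + lam) * ((real (m - 1) + \<delta>) / \<delta> + (real m + \<delta>) / \<delta> + 1) + \<bar>c\<bar>\<bar>"
        by (rule AE_I2) (rule order_trans[OF bound abs_ge_self])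
    qed measurable
    hence int: "integrable M (\<lambda>\<omega>. Y n \<omega> * drift (hist n \<omega>))" by (rule L2_mult[OF Y])
    have intR: "integrable M ?R"
      using L2_square[OF LN'] L2_square[OF LW] by simp
    have "expectation (\<lambda>\<omega>. Y n \<omega> * drift (hist n \<omega>)) \<le> expectation ?R"
    proof (rule integral_mono_AE[OF int intR])
      show "AE \<omega> in M. Y n \<omega> * drift (hist n \<omega>) \<le> ?R \<omega>"
        using AE_hweight[of n]
      proof eventually_elim
        case (elim \<omega>)
        have "hweight (hist n \<omega>) > 0" using elim by simp
        thus ?case
          unfolding Y_def drift_def
          using hcount_nonneg hcount_weight \<delta>
          by (intro drift_bound T wpos apos bpos eqn) (auto simp: N'_def hweight_nonneg)
      qed
    qed
    also have "\<dots> = ((b\<^sup>2 / a) * expectation (\<lambda>\<omega>. (N' (hist n \<omega>) - c' * T n)\<^sup>2)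
        + ((a + b) / \<delta>)\<^sup>2 / a * expectation (\<lambda>\<omega>. (hweight (hist n \<omega>) - w * T n)\<^sup>2)) / (w * T n)"
      using L2_square[OF LN'] L2_square[OF LW] by simp
    also have "\<dots> \<le> ((b\<^sup>2 / a) * (C1 * T n) + ((a + b) / \<delta>)\<^sup>2 / a * (C2 * T n)) / (w * T n)"
      using T[of n] wpos apos by (intro divide_right_mono add_mono mult_left_mono prev wt) auto
    also have "\<dots> = K"
      using T[of n] wpos apos unfolding K_def by (simp add: divide_simps) (simp add: algebra_simps)
    finally show "expectation (\<lambda>\<omega>. Y n \<omega> * drift (hist n \<omega>)) \<le> K" .
  qed
  \<comment> \<open>\<open>L n\<close> is the change of the count with collisions ignored. Given the
    history, \<open>L n - c\<close> has mean \<open>drift\<close>, and \<open>Y n\<close> is a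
    function of the history.\<close>
  have YL: "integrable M (\<lambda>\<omega>. Y n \<omega> * (L n \<omega> - c))"
      "expectation (\<lambda>\<omega>. Y n \<omega> * (L n \<omega> - c)) = expectation (\<lambda>\<omega>. Y n \<omega> * drift (hist n \<omega>))" for n
  proof -
    define \<psi> where "\<psi> h = hcount h m - c * T n" for h
    have \<psi>: "L2 (\<lambda>\<omega>. \<psi> (hist n \<omega>))" using Y[of n] by (simp add: Y_def[abs_def] \<psi>_def)
    note d = expectation_deg_hits[OF \<psi>, folded deg_hits_def] and co = expectation_coin_hits[OF \<psi>, folded coin_hits_def]
    have Lr: "integrable M (\<lambda>\<omega>. \<psi> (hist n \<omega>) * deg_rate j (hist n \<omega>))" for j
    proof (rule L2_mult[OF \<psi> L2_bound[OF L2_const]])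
      show "AE \<omega> in M. \<bar>deg_rate j (hist n \<omega>)\<bar> \<le> \<bar>(j + \<delta>) / \<delta>\<bar>"
        using deg_rate_bound[of j] \<delta> by (intro AE_I2) simp
    qed measurable
    have eqY: "Y n \<omega> * (L n \<omega> - c) = of_bool (m > 0) * (\<psi> (hist n \<omega>) * deg_hits n (m - 1) \<omega>)
        - \<psi> (hist n \<omega>) * deg_hits n m \<omega> + of_bool (m = s) * (\<psi> (hist n \<omega>) * coin_hits n \<omega>) - c * \<psi> (hist n \<omega>)" for \<omega>
      by (simp add: Y_def \<psi>_def L_def algebra_simps)
    have eqD: "Y n \<omega> * drift (hist n \<omega>) = of_bool (m > 0) * ((1 + lam) * (attach_prob * (\<psi> (hist n \<omega>) * deg_rate (m - 1) (hist n \<omega>))))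
        - (1 + lam) * (attach_prob * (\<psi> (hist n \<omega>) * deg_rate m (hist n \<omega>)))
        + of_bool (m = s) * ((1 + lam) * (\<psi> (hist n \<omega>) * p)) - c * \<psi> (hist n \<omega>)" for \<omega>
      unfolding drift_eq by (simp add: Y_def \<psi>_def algebra_simps)
    show "integrable M (\<lambda>\<omega>. Y n \<omega> * (L n \<omega> - c))"
      unfolding eqY using d(1) co(1) L2_integrable[OF \<psi>]
      by (intro Bochner_Integration.integrable_diff Bochner_Integration.integrable_add integrable_mult_right)
    have "expectation (\<lambda>\<omega>. Y n \<omega> * (L n \<omega> - c)) =
      of_bool (m > 0) * expectation (\<lambda>\<omega>. \<psi> (hist n \<omega>) * deg_hits n (m - 1) \<omega>)
        - expectation (\<lambda>\<omega>. \<psi> (hist n \<omega>) * deg_hits n m \<omega>)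
        + of_bool (m = s) * expectation (\<lambda>\<omega>. \<psi> (hist n \<omega>) * coin_hits n \<omega>) - c * expectation (\<lambda>\<omega>. \<psi> (hist n \<omega>))"
      unfolding eqY using d(1) co(1) L2_integrable[OF \<psi>] by simp
    also have "\<dots> = of_bool (m > 0) * ((1 + lam) * (attach_prob * expectation (\<lambda>\<omega>. \<psi> (hist n \<omega>) * deg_rate (m - 1) (hist n \<omega>))))
        - (1 + lam) * (attach_prob * expectation (\<lambda>\<omega>. \<psi> (hist n \<omega>) * deg_rate m (hist n \<omega>)))
        + of_bool (m = s) * ((1 + lam) * (expectation (\<lambda>\<omega>. \<psi> (hist n \<omega>)) * p)) - c * expectation (\<lambda>\<omega>. \<psi> (hist n \<omega>))"
      unfolding d(2) co(2) by (simp add: mult.left_commute[of _ attach_prob])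
    also have "\<dots> = expectation (\<lambda>\<omega>. Y n \<omega> * drift (hist n \<omega>))"
      unfolding eqD using Lr L2_integrable[OF \<psi>] by simp
    finally show "expectation (\<lambda>\<omega>. Y n \<omega> * (L n \<omega> - c)) = expectation (\<lambda>\<omega>. Y n \<omega> * drift (hist n \<omega>))" .
  qed
  have step: "expectation (\<lambda>\<omega>. (Y (Suc n) \<omega>)\<^sup>2) \<le> expectation (\<lambda>\<omega>. (Y n \<omega>)\<^sup>2) + (2 * (K + 2 * C3) + C4)" for n
  proof -
    have int_col: "integrable M (\<lambda>\<omega>. \<bar>Y n \<omega>\<bar> * collisions n m \<omega>)"
      unfolding Y_def T_def by (rule expectation_collisions)
    \<comment> \<open>Only here do collisions enter. As the sign of their effect is unknown, they
      are paired with the absolute value of \<open>Y n\<close>.\<close>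
    have "expectation (\<lambda>\<omega>. Y n \<omega> * D n \<omega>) \<le> expectation (\<lambda>\<omega>. Y n \<omega> * (L n \<omega> - c) + 2 * (\<bar>Y n \<omega>\<bar> * collisions n m \<omega>))"
    proof (rule integral_mono_AE[OF L2_mult[OF Y D]])
      show "integrable M (\<lambda>\<omega>. Y n \<omega> * (L n \<omega> - c) + 2 * (\<bar>Y n \<omega>\<bar> * collisions n m \<omega>))"
        using YL(1) int_col by simp
      show "AE \<omega> in M. Y n \<omega> * D n \<omega> \<le> Y n \<omega> * (L n \<omega> - c) + 2 * (\<bar>Y n \<omega>\<bar> * collisions n m \<omega>)"
        using AE_deg_step[of n m]
      proof eventually_elim
        case (elim \<omega>)
        have "Y n \<omega> * (D n \<omega> - (L n \<omega> - c)) \<le> \<bar>Y n \<omega>\<bar> * \<bar>D n \<omega> - (L n \<omega> - c)\<bar>"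
          unfolding abs_mult[symmetric] by (rule abs_ge_self)
        also have "\<dots> \<le> \<bar>Y n \<omega>\<bar> * (2 * collisions n m \<omega>)"
          using elim by (intro mult_left_mono) (auto simp: D_def L_def)
        finally show ?case by (simp add: algebra_simps)
      qed
    qed
    also have "\<dots> = expectation (\<lambda>\<omega>. Y n \<omega> * drift (hist n \<omega>)) + 2 * expectation (\<lambda>\<omega>. \<bar>Y n \<omega>\<bar> * collisions n m \<omega>)"
      using YL int_col by simp
    also have "\<dots> \<le> K + 2 * C3"
      using Ydrift[of n] col[of n] by (simp add: Y_def)
    finally have 1: "expectation (\<lambda>\<omega>. Y n \<omega> * D n \<omega>) \<le> K + 2 * C3" .
    have 2: "expectation (\<lambda>\<omega>. (D n \<omega>)\<^sup>2) \<le> C4"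
      by (rule sq[OF D]) (unfold D_def, rule AE_increment_bound)
    have "Y (Suc n) = (\<lambda>\<omega>. Y n \<omega> + D n \<omega>)" by (auto simp: fun_eq_iff Y_def D_def T_def algebra_simps)
    thus ?thesis using L2_step[OF Y D 1 2] by simp
  qed
  show ?thesis
    using linear_growth[of "\<lambda>n. expectation (\<lambda>\<omega>. (Y n \<omega>)\<^sup>2)", OF step] unfolding Y_def T_def by blast
qed

lemma deg_count_L2:
  fixes c :: "nat \<Rightarrow> real"
  assumes c: "\<And>m. c m * (1 + attach_prob * (real m + \<delta>) / (1 + \<delta> * p)) =
      (if m = 0 then 0 else attach_prob * (real (m - 1) + \<delta>) / (1 + \<delta> * p) * c (m - 1))
      + (if m = s then p * (1 + lam) else 0)"
  shows "\<exists>C. \<forall>n. expectation (\<lambda>\<omega>. (hcount (hist n \<omega>) m - c m * (real n + 1))\<^sup>2) \<le> C * (real n + 1)"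
proof (induction m)
  \<comment> \<open>The drift coefficients and the growth rate of the weight share the factor
    \<open>1 + lam\<close>. It survives only in the rate \<open>p * (1 + lam)\<close> of new
    nodes.\<close>
  have cancel: "(1 + lam) * x * y * z / ((1 + lam) * u) = x * y / u * z" for x y z u :: real
    using lam by simp
  case 0
  show ?case
  proof (rule deg_count_L2_step[where c' = 0 and ?C1.0 = 0])
    show "c 0 + (1 + lam) * attach_prob * (real 0 + \<delta>) * c 0 / ((1 + lam) * (1 + \<delta> * p)) =
      (if (0::nat) = 0 then 0 else (1 + lam) * attach_prob * (real (0 - 1) + \<delta>)) * 0 / ((1 + lam) * (1 + \<delta> * p))
      + (if 0 = s then p * (1 + lam) else 0)"
      unfolding cancel using c[of 0] by (simp add: distrib_left mult.commute[of "c 0"])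
  qed simp
next
  have cancel: "(1 + lam) * x * y * z / ((1 + lam) * u) = x * y / u * z" for x y z u :: real
    using lam by simp
  have alg: "y + k * y = y * (1 + k)" for y k :: real by (simp add: algebra_simps)
  case (Suc m)
  then obtain C where C: "\<And>n. expectation (\<lambda>\<omega>. (hcount (hist n \<omega>) m - c m * (real n + 1))\<^sup>2) \<le> C * (real n + 1)"
    by blast
  show ?case
  proof (rule deg_count_L2_step[where c' = "c m" and ?C1.0 = C])
    show "c (Suc m) + (1 + lam) * attach_prob * (real (Suc m) + \<delta>) * c (Suc m) / ((1 + lam) * (1 + \<delta> * p)) =
      (if Suc m = 0 then 0 else (1 + lam) * attach_prob * (real (Suc m - 1) + \<delta>)) * c m / ((1 + lam) * (1 + \<delta> * p))
      + (if Suc m = s then p * (1 + lam) else 0)"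
      unfolding if_not_P[OF nat.distinct(2)] cancel alg
      using c[of "Suc m"] by (simp only: if_not_P[OF nat.distinct(2)] diff_Suc_1)
  qed (use C in simp)
qed

text \<open>Nodes appear at rate v = p (1 + lam) per step, so the fixed point for the counts is
  \<open>v * r m\<close>. The fraction is then a quotient of two quantities known up to o(n), and v
  cancels.\<close>

theorem node_fraction_tendsto:
  assumes r: "\<And>m. r m * (1 + attach_prob * (real m + \<delta>) / (1 + \<delta> * p)) =
      (if m = 0 then 0 else attach_prob * (real (m - 1) + \<delta>) / (1 + \<delta> * p) * r (m - 1)) + of_bool (m = s)"
  shows "tendsto_in_prob M (\<lambda>n \<omega>. node_fraction (nodes (\<lambda>k. B k \<omega>) (\<lambda>k. dM k \<omega>) n) (deg n \<omega>) m) (r m)"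
  unfolding tendsto_in_prob_def
proof (intro conjI allI impI)
  define X where "X n \<omega> = hcount (hist n \<omega>) m / real (V n \<omega>)" for n \<omega>
  have eq: "node_fraction (nodes (\<lambda>k. B k \<omega>) (\<lambda>k. dM k \<omega>) n) (deg n \<omega>) m = X n \<omega>" for n \<omega>
    by (simp add: X_def node_fraction_eq hcount_hist)
  have X [measurable]: "X n \<in> borel_measurable M" for n
    unfolding X_def
    using L2_measurable[OF L2_hcount] L2_measurable[OF L2_V] by (rule borel_measurable_divide)
  show "(\<lambda>\<omega>. node_fraction (nodes (\<lambda>k. B k \<omega>) (\<lambda>k. dM k \<omega>) n) (deg n \<omega>) m) \<in> borel_measurable M" for n
    unfolding eq by (rule X)
  fix \<epsilon> :: real assume \<epsilon>: "\<epsilon> > 0"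
  define v where "v = p * (1 + lam)"
  have v: "v > 0" using p lam by (simp add: v_def)
  \<comment> \<open>The first bound makes the contribution of the node count to the error at most a
    quarter of epsilon v T, where the added 1 keeps the denominator positive. The second keeps the
    node count above v T / 2.\<close>
  define \<eta> where "\<eta> = min (\<epsilon> * v / (4 * (\<bar>r m\<bar> + 1))) (v / 2)"
  have \<eta>: "\<eta> > 0" "\<eta> \<le> v / 2" "\<bar>r m\<bar> * \<eta> \<le> \<epsilon> * v / 4"
  proof -
    show "\<eta> > 0" using \<epsilon> v by (auto simp: \<eta>_def)
    show "\<eta> \<le> v / 2" unfolding \<eta>_def by (rule min.cobounded2)
    have "\<bar>r m\<bar> * \<eta> \<le> (\<bar>r m\<bar> + 1) * (\<epsilon> * v / (4 * (\<bar>r m\<bar> + 1)))"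
      using \<open>\<eta> > 0\<close> by (intro mult_mono) (auto simp: \<eta>_def)
    also have "\<dots> = \<epsilon> * v / 4" by (simp add: field_simps add_pos_nonneg)
    finally show "\<bar>r m\<bar> * \<eta> \<le> \<epsilon> * v / 4" .
  qed
  define F where "F n \<omega> = hcount (hist n \<omega>) m - v * r m * (real n + 1)" for n \<omega>
  define G where "G n \<omega> = real (V n \<omega>) - v * (real n + 1)" for n \<omega>
  have F: "L2 (F n)" for n unfolding F_def by (intro L2_diff L2_hcount L2_const)
  have G: "L2 (G n)" for n unfolding G_def by (intro L2_diff L2_V L2_const)
  have "\<exists>C. \<forall>n. expectation (\<lambda>\<omega>. (hcount (hist n \<omega>) m - (v * r m) * (real n + 1))\<^sup>2) \<le> C * (real n + 1)"
  proof (rule deg_count_L2)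
    fix m
    have "v * r m * (1 + attach_prob * (real m + \<delta>) / (1 + \<delta> * p)) =
      v * (r m * (1 + attach_prob * (real m + \<delta>) / (1 + \<delta> * p)))" by (simp only: mult.assoc)
    also have "\<dots> = (if m = 0 then 0 else attach_prob * (real (m - 1) + \<delta>) / (1 + \<delta> * p) * (v * r (m - 1)))
      + (if m = s then p * (1 + lam) else 0)"
    proof -
      have "(if m = s then p * (1 + lam) else 0) = v * of_bool (m = s)" by (simp add: v_def)
      thus ?thesis unfolding r unfolding distrib_left[of v] by (cases "m = 0") (simp_all add: mult.left_commute[of v])
    qed
    finally show "v * r m * (1 + attach_prob * (real m + \<delta>) / (1 + \<delta> * p)) = \<dots>" .
  qed
  then obtain C1 where C1: "\<And>n. expectation (\<lambda>\<omega>. (F n \<omega>)\<^sup>2) \<le> C1 * (real n + 1)"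
    unfolding F_def by blast
  obtain C2 where C2: "\<And>n. expectation (\<lambda>\<omega>. (G n \<omega>)\<^sup>2) \<le> C2 * (real n + 1)"
    using V_L2 unfolding G_def v_def by blast
  let ?A = "\<lambda>n. {\<omega> \<in> space M. \<epsilon> * v / 4 * (real n + 1) \<le> \<bar>F n \<omega>\<bar>}"
    and ?B = "\<lambda>n. {\<omega> \<in> space M. \<eta> * (real n + 1) \<le> \<bar>G n \<omega>\<bar>}"
  have [measurable]: "F n \<in> borel_measurable M" "G n \<in> borel_measurable M" for n
    using F G by (auto intro: L2_measurable)
  show "(\<lambda>n. prob {\<omega> \<in> space M. \<epsilon> < \<bar>node_fraction (nodes (\<lambda>k. B k \<omega>) (\<lambda>k. dM k \<omega>) n) (deg n \<omega>) m - r m\<bar>}) \<longlonglongrightarrow> 0"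
    unfolding eq
  proof (rule tendsto_sandwich[OF _ _ tendsto_const])
    show "\<forall>\<^sub>F n in sequentially. 0 \<le> prob {\<omega> \<in> space M. \<epsilon> < \<bar>X n \<omega> - r m\<bar>}" by simp
    have "(\<lambda>n. prob (?A n)) \<longlonglongrightarrow> 0" using tendsto_prob_of_L2[OF F C1, of "\<epsilon> * v / 4"] \<epsilon> v by simp
    moreover have "(\<lambda>n. prob (?B n)) \<longlonglongrightarrow> 0" using tendsto_prob_of_L2[OF G C2, of \<eta>] \<eta> by simp
    ultimately show "(\<lambda>n. prob (?A n) + prob (?B n)) \<longlonglongrightarrow> 0" using tendsto_add by fastforce
    show "\<forall>\<^sub>F n in sequentially. prob {\<omega> \<in> space M. \<epsilon> < \<bar>X n \<omega> - r m\<bar>} \<le> prob (?A n) + prob (?B n)"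
    proof (rule always_eventually, rule allI)
      fix n
      define T where "T = real n + 1"
      have T: "T > 0" by (simp add: T_def)
      \<comment> \<open>Outside both exceptional events the numerator is off by at most epsilon v T
        / 2, which is at most epsilon times the number of nodes.\<close>
      have "{\<omega> \<in> space M. \<epsilon> < \<bar>X n \<omega> - r m\<bar>} \<subseteq> ?A n \<union> ?B n"
      proof
        fix \<omega> assume \<omega>: "\<omega> \<in> {\<omega> \<in> space M. \<epsilon> < \<bar>X n \<omega> - r m\<bar>}"
        show "\<omega> \<in> ?A n \<union> ?B n"
        proof (rule ccontr)
          assume "\<omega> \<notin> ?A n \<union> ?B n"
          hence a: "\<bar>F n \<omega>\<bar> < \<epsilon> * v / 4 * T" and b: "\<bar>G n \<omega>\<bar> < \<eta> * T"
            using \<omega> by (auto simp: T_def)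
          define N where "N = real (V n \<omega>)"
          have N: "N > 0" by (simp add: N_def)
          have "\<eta> * T \<le> v / 2 * T" using \<eta> T by (intro mult_right_mono) auto
          hence NT: "v / 2 * T \<le> N" using b unfolding G_def N_def[symmetric] T_def[symmetric] by linarith
          have "hcount (hist n \<omega>) m - r m * N = F n \<omega> - r m * G n \<omega>"
            by (simp add: F_def G_def N_def algebra_simps)
          hence "\<bar>hcount (hist n \<omega>) m - r m * N\<bar> \<le> \<bar>F n \<omega>\<bar> + \<bar>r m\<bar> * \<bar>G n \<omega>\<bar>"
            using abs_triangle_ineq4[of "F n \<omega>" "r m * G n \<omega>"] by (simp add: abs_mult)
          also have "\<bar>r m\<bar> * \<bar>G n \<omega>\<bar> \<le> \<bar>r m\<bar> * (\<eta> * T)" using b by (intro mult_left_mono) auto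
          also have "\<dots> \<le> \<epsilon> * v / 4 * T" using mult_right_mono[OF \<eta>(3), of T] T by (simp add: mult.assoc)
          finally have "\<bar>hcount (hist n \<omega>) m - r m * N\<bar> \<le> \<epsilon> * (v / 2 * T)" using a by simp
          also have "\<dots> \<le> \<epsilon> * N" using NT \<epsilon> by (intro mult_left_mono) auto
          finally have "\<bar>hcount (hist n \<omega>) m - r m * N\<bar> / N \<le> \<epsilon>" using N by (simp add: pos_divide_le_eq)
          moreover have "X n \<omega> - r m = (hcount (hist n \<omega>) m - r m * N) / N"
            using N by (simp add: X_def N_def[symmetric] diff_divide_distrib)
          ultimately show False using \<omega> N by (simp add: abs_divide)
        qed
      qed
      hence "prob {\<omega> \<in> space M. \<epsilon> < \<bar>X n \<omega> - r m\<bar>} \<le> prob (?A n \<union> ?B n)"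
        by (rule finite_measure_mono) measurable
      also have "\<dots> \<le> prob (?A n) + prob (?B n)"
        by (rule measure_Un_le) measurable
      finally show "prob {\<omega> \<in> space M. \<epsilon> < \<bar>X n \<omega> - r m\<bar>} \<le> prob (?A n) + prob (?B n)" .
    qed
  qed
qed

end

section \<open>In-degrees and out-degrees as two instances\<close>

theorem corollary5p1:
  fixes M :: "'a measure"
    and p lam \<delta>in \<delta>out :: real
    and B :: "nat \<Rightarrow> 'a \<Rightarrow> nat"
    and \<tau> \<tau>' :: "nat \<Rightarrow> nat \<Rightarrow> 'a \<Rightarrow> real"
    and dM :: "nat \<Rightarrow> 'a \<Rightarrow> nat"
  assumes "0 < p" "p < 1" "\<delta>in > 0" "\<delta>out > 0" "lam > 0"
    and "pa_poisson_input M p lam B \<tau> \<tau>' dM"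
  shows "(\<forall>m. tendsto_in_prob M
            (\<lambda>n \<omega>. node_fraction (nodes (\<lambda>k. B k \<omega>) (\<lambda>k. dM k \<omega>) n)
                     (indeg \<delta>in (\<lambda>k. B k \<omega>) (\<lambda>k v. \<tau> k v \<omega>) (\<lambda>k. dM k \<omega>) n) m)
            (p_in p \<delta>in m))
       \<and> (\<forall>l\<ge>1. tendsto_in_prob M
            (\<lambda>n \<omega>. node_fraction (nodes (\<lambda>k. B k \<omega>) (\<lambda>k. dM k \<omega>) n)
                     (outdeg \<delta>out (\<lambda>k. B k \<omega>) (\<lambda>k v. \<tau>' k v \<omega>) (\<lambda>k. dM k \<omega>) n) l)
            (p_out p \<delta>out l))
       \<and> p_in p \<delta>in \<sim>[at_top]
            (\<lambda>m. (1 + \<delta>in * p) * (Gamma (1 + \<delta>in * (1 + p)) / Gamma \<delta>in)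
                   * real m powr (- (1 + iota_in p \<delta>in)))
       \<and> p_out p \<delta>out \<sim>[at_top]
            (\<lambda>l. (1 + \<delta>out * p) / (1 - p)
                   * (Gamma (1 + (1 + \<delta>out) / (1 - p)) / Gamma (1 + \<delta>out))
                   * real l powr (- (1 + iota_out p \<delta>out)))"
proof -
  interpret pa_poisson_input M p lam B \<tau> \<tau>' dM by fact
  define X where "X = (\<lambda>i \<omega>. case i of
          Coin k \<Rightarrow> real (B k \<omega>)
        | In_Clock k v \<Rightarrow> \<tau> k v \<omega>
        | Out_Clock k v \<Rightarrow> \<tau>' k v \<omega>
        | Batch k \<Rightarrow> real (dM k \<omega>))"
  have indep_in: "indep_vars (\<lambda>_. borel) (input_var B \<tau> dM) inputs"
  proof -
    have "indep_vars (\<lambda>_. borel) X inputs"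
      unfolding X_def by (rule indep_vars_subset[OF indep]) (auto simp: inputs_def)
    thus ?thesis
      by (rule iffD1[OF indep_vars_cong, rotated -1])
         (auto simp: X_def inputs_def input_var_def[abs_def] fun_eq_iff)
  qed
  \<comment> \<open>Moves the out-clocks into the place of the in-clocks. It is injective on
    \<open>inputs\<close>, which contains no out-clock.\<close>
  define g where "g i = (case i of In_Clock k v \<Rightarrow> Out_Clock k v | _ \<Rightarrow> i)" for i
  have indep_out: "indep_vars (\<lambda>_. borel) (input_var B \<tau>' dM) inputs"
  proof -
    have "indep_vars (\<lambda>_. borel) X (g ` inputs)"
      unfolding X_def by (rule indep_vars_subset[OF indep]) (auto simp: inputs_def g_def)
    hence "indep_vars (\<lambda>_. borel) (\<lambda>i. X (g i)) inputs"
      by (rule indep_vars_reindex) (auto simp: inj_on_def inputs_def g_def)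
    thus ?thesis
      by (rule iffD1[OF indep_vars_cong, rotated -1])
         (auto simp: X_def g_def inputs_def input_var_def[abs_def] fun_eq_iff)
  qed
  interpret I: pa_family M p lam \<delta>in 0 B \<tau> dM
    by unfold_locales (use assms indep_in coin_1 coin_0 in_clock batch in auto)
  interpret O: pa_family M p lam \<delta>out 1 B \<tau>' dM
    by unfold_locales (use assms indep_out coin_1 coin_0 out_clock batch in auto)
  have "tendsto_in_prob M
            (\<lambda>n \<omega>. node_fraction (nodes (\<lambda>k. B k \<omega>) (\<lambda>k. dM k \<omega>) n)
                     (indeg \<delta>in (\<lambda>k. B k \<omega>) (\<lambda>k v. \<tau> k v \<omega>) (\<lambda>k. dM k \<omega>) n) m)
            (p_in p \<delta>in m)" for m
    unfolding indeg_eq_batch_deg p_in_eq[OF assms(1-3)]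
    by (rule I.node_fraction_tendsto)
       (use beta_weight_rec_in[OF assms(1,3)] in \<open>simp add: I.attach_prob_def\<close>)
  moreover have "tendsto_in_prob M
            (\<lambda>n \<omega>. node_fraction (nodes (\<lambda>k. B k \<omega>) (\<lambda>k. dM k \<omega>) n)
                     (outdeg \<delta>out (\<lambda>k. B k \<omega>) (\<lambda>k v. \<tau>' k v \<omega>) (\<lambda>k. dM k \<omega>) n) l)
            (p_out p \<delta>out l)" if "l \<ge> 1" for l
  proof -
    \<comment> \<open>The recursion has to hold at degree 0 as well, where the limit is 0.\<close>
    define r where "r m = (if m = 0 then 0 else beta_weight (1 + \<delta>out) ((1 + \<delta>out * p) / (1 - p)) (m - 1))" for m
    have "p_out p \<delta>out l = r l"
      using p_out_eq[OF assms(1,2,4), of "l - 1"] that by (simp add: r_def)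
    moreover have "tendsto_in_prob M
            (\<lambda>n \<omega>. node_fraction (nodes (\<lambda>k. B k \<omega>) (\<lambda>k. dM k \<omega>) n)
                     (outdeg \<delta>out (\<lambda>k. B k \<omega>) (\<lambda>k v. \<tau>' k v \<omega>) (\<lambda>k. dM k \<omega>) n) l) (r l)"
      unfolding outdeg_eq_batch_deg
    proof (rule O.node_fraction_tendsto)
      fix m
      have q: "O.attach_prob = 1 - p" unfolding O.attach_prob_def by simp
      show "r m * (1 + O.attach_prob * (real m + \<delta>out) / (1 + \<delta>out * p)) =
          (if m = 0 then 0 else O.attach_prob * (real (m - 1) + \<delta>out) / (1 + \<delta>out * p) * r (m - 1)) + of_bool (m = 1)"
        unfolding q r_def by (rule beta_weight_rec_out[OF assms(1,2,4)])
    qed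
    ultimately show ?thesis by simp
  qed
  moreover have "p_in p \<delta>in \<sim>[at_top]
            (\<lambda>m. (1 + \<delta>in * p) * (Gamma (1 + \<delta>in * (1 + p)) / Gamma \<delta>in)
                   * real m powr (- (1 + iota_in p \<delta>in)))"
  proof -
    have "1 + \<delta>in * p > 0" using assms by (simp add: add_pos_pos)
    note beta_weight_asymp_equiv[OF assms(3) this]
    moreover have "p_in p \<delta>in = beta_weight \<delta>in (1 + \<delta>in * p)"
      using p_in_eq[OF assms(1-3)] by (rule ext)
    moreover have "\<delta>in + (1 + \<delta>in * p) = 1 + \<delta>in * (1 + p)" by (simp add: algebra_simps)
    ultimately show ?thesis by (simp add: iota_in_def)
  qed
  moreover have "p_out p \<delta>out \<sim>[at_top]
            (\<lambda>l. (1 + \<delta>out * p) / (1 - p)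
                   * (Gamma (1 + (1 + \<delta>out) / (1 - p)) / Gamma (1 + \<delta>out))
                   * real l powr (- (1 + iota_out p \<delta>out)))"
  proof -
    define R where "R = (1 + \<delta>out * p) / (1 - p)"
    define c where "c = R * (Gamma (1 + \<delta>out + R) / Gamma (1 + \<delta>out))"
    have R: "R > 0" "1 + \<delta>out > 0" using assms by (auto simp: R_def add_pos_pos)
    have "(\<lambda>l. beta_weight (1 + \<delta>out) R (l - 1)) \<sim>[at_top] (\<lambda>l. c * real (l - 1) powr (- (1 + R)))"
      using asymp_equiv_compose'[OF beta_weight_asymp_equiv[OF R(2,1)], of "\<lambda>l. l - 1" at_top]
      by (simp add: c_def filterlim_minus_const_nat_at_top)
    \<comment> \<open>Truncated and real subtraction agree from \<open>l = 1\<close> on, and a shift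
      of the argument by 1 does not affect a power asymptotically.\<close>
    also have "(\<lambda>l. c * real (l - 1) powr (- (1 + R))) \<sim>[at_top] (\<lambda>l. c * (real l - 1) powr (- (1 + R)))"
      by (rule asymp_equiv_refl_ev) (use eventually_ge_at_top[of 1] in \<open>eventually_elim, simp add: of_nat_diff\<close>)
    also have "(\<lambda>l. (real l - 1) powr (- (1 + R))) \<sim>[at_top] (\<lambda>l. real l powr (- (1 + R)))"
      using R by real_asymp
    hence "(\<lambda>l. c * (real l - 1) powr (- (1 + R))) \<sim>[at_top] (\<lambda>l. c * real l powr (- (1 + R)))"
      by (rule asymp_equiv_mult[OF asymp_equiv_refl])
    finally have *: "(\<lambda>l. beta_weight (1 + \<delta>out) R (l - 1)) \<sim>[at_top] (\<lambda>l. c * real l powr (- (1 + R)))" .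
    have "1 + \<delta>out + R = 1 + (1 + \<delta>out) / (1 - p)"
      using assms by (simp add: R_def field_simps)
    with * have "(\<lambda>l. beta_weight (1 + \<delta>out) R (l - 1)) \<sim>[at_top]
      (\<lambda>l. R * (Gamma (1 + (1 + \<delta>out) / (1 - p)) / Gamma (1 + \<delta>out)) * real l powr (- (1 + R)))"
      by (simp add: c_def)
    moreover have "p_out p \<delta>out \<sim>[at_top] (\<lambda>l. beta_weight (1 + \<delta>out) R (l - 1))"
    proof (rule asymp_equiv_refl_ev)
      show "\<forall>\<^sub>F l in at_top. p_out p \<delta>out l = beta_weight (1 + \<delta>out) R (l - 1)"
        using eventually_ge_at_top[of 1]
      proof eventually_elim
        case (elim l)
        thus ?case using p_out_eq[OF assms(1,2,4), of "l - 1"] by (simp add: R_def)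
      qed
    qed
    ultimately show ?thesis
      unfolding iota_out_def R_def[symmetric] by (rule asymp_equiv_trans[rotated])
  qed
  ultimately show ?thesis by blast
qed

end
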